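(* Let $m$ be a locally summable weight on a simplicial complex $\Sigma$ and let $\circ\in\{+,-,H\}$. If all metric balls with respect to the path pseudo metric $d^\circ$ on $\Sigma_0$ are finite, and $\Sigma$ is locally finite or $m$ is balanced, then $\Delta^\circ_c$ is essentially self-adjoint.
   Context: Simplicial complex: $V$ is a countable set and $\hat\Sigma$ is a collection of finite subsets of $V$ closed under taking subsets. $\dim\tau=|\tau|-1$, $\hat\Sigma_k=\{\tau\in\hat\Sigma:\dim\tau=k\}$. A weight is a function $m:\hat\Sigma\to(0,\infty)$. Put $\Sigma=\hat\Sigma$ if $\sum_{v\in\hat\Sigma_0}m(v)<\infty$, and $\Sigma=\hat\Sigma\setminus\{\varnothing\}$ otherwise; $\Sigma_k=\hat\Sigma_k\cap\Sigma$, and $\Sigma_0$ is identified with $V$. The relation $\tau\prec\sigma$ (equivalently $\sigma\succ\tau$) means $\tau,\sigma\in\Sigma$, $\tau\subset\sigma$ and $|\sigma\setminus\tau|=1$. All sums and infima are over elements of $\Sigma$. The weight is locally summable if $\sum_{\sigma\succ\tau}m(\sigma)<\infty$ for all $\tau\in\Sigma$; it is balanced if $\sup_{\tau\prec\sigma}m(\sigma)/m(\tau)<\infty$. $\Sigma$ is locally finite if every $\tau\neq\varnothing$ has only finitely many $\sigma\succ\tau$. Functions: $F=\mathbb{R}^{\Sigma}$; $F^c$ is the subspace of finitely supported functions; $F^1=\{\omega\in F:\sum_{\sigma\succ\tau}m(\sigma)|\omega(\sigma)|<\infty\text{ for all }\tau\in\Sigma\}$; $\ell^2=\ell^2(\Sigma,m)=\{\omega\in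 F:\sum_\Sigma m\omega^2<\infty\}$ with its natural inner product. Coboundary operator: a linear map $\delta:F\to F$ with $\delta\delta=0$ such that $\theta(\tau,\sigma):=\delta 1_\tau(\sigma)\in\{-1,0,1\}$, $\theta(\tau,\sigma)\neq0$ iff $\tau\prec\sigma$, and $\delta\omega(\sigma)=\sum_{\tau\prec\sigma}\omega(\tau)\theta(\tau,\sigma)$. Boundary operator: $\partial:F^1\to F$, $\partial\omega(\rho)=\frac1{m(\rho)}\sum_{\tau\succ\rho}m(\tau)\omega(\tau)\theta(\rho,\tau)$. $\Delta^+_c$, $\Delta^-_c$, $\Delta^H_c$ are the operators in $\ell^2$ with domain $F^c$ acting as $\partial\delta$, $\delta\partial$, $(\delta+\partial)^2=\partial\delta+\delta\partial$, respectively (if $\Sigma$ is locally finite or $m$ is balanced these map $F^c$ into $\ell^2$). Pseudo metrics: for $v,v'\in\Sigma_0$ write $v\sim v'$ if $v\ne v'$ and $\{v,v'\}\in\Sigma_1$. Set $$d^\circ(v,v')=\inf_{v=v_0\sim\dots\sim v_n=v'}\sum_{k=0}^{n-1}w^\circ(v_k,v_{k+1}),$$ where the infimum over the empty set is $\infty$, $w^\circ(x,x)=0$ (so $d^\circ(v,v)=0$) and, for $x\sim x'$ (with the convention $0^{-1/2}=\infty$), $$w^+(x,x')=\inf_{\tau\cap\{x,x'\}\neq\varnothing}\Big(\frac{\dim(\tau)+1}{m(\tau)}\sum_{\sigma\succ\tau}m(\sigma)\Big)^{-1/2},$$ $$w^-(x,x')=\inf_{\tau\cap\{x,x'\}\neq\varnothing}\frac12\Big(\sum_{\tau'\ne\tau:\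 \tau\cap\tau'\prec\tau,\ \tau\cap\tau'\prec\tau'}\frac{m(\tau')}{m(\tau\cap\tau')}\Big)^{-1/2},$$ $$w^H(x,x')=\tfrac1{\sqrt2}\min\{w^+(x,x'),w^-(x,x')\}.$$ *)

theory Defs
  imports "HOL-Analysis.Analysis"
begin

section \<open>Weighted simplicial complexes\<close>

text \<open>Every \<open>v \<in> V\<close> is required to be a vertex of the complex, so that \<open>V\<close> is identified
  with the set of 0-simplices.\<close>

definition abstract_complex :: "'v set \<Rightarrow> 'v set set \<Rightarrow> bool" where
  "abstract_complex V S \<longleftrightarrow>
     countable V \<and>
     (\<forall>\<tau>\<in>S. finite \<tau> \<and> \<tau> \<subseteq> V) \<and>
     (\<forall>\<tau>\<in>S. \<forall>\<rho>. \<rho> \<subseteq> \<tau> \<longrightarrow> \<rho> \<in> S) \<and>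
     (\<forall>v\<in>V. {v} \<in> S)"

definition sdim :: "'v set \<Rightarrow> int" where
  "sdim \<tau> = int (card \<tau>) - 1"

definition simplices :: "'v set set \<Rightarrow> int \<Rightarrow> 'v set set" where
  "simplices S k = {\<tau> \<in> S. sdim \<tau> = k}"

definition weight :: "'v set set \<Rightarrow> ('v set \<Rightarrow> real) \<Rightarrow> bool" where
  "weight S m \<longleftrightarrow> (\<forall>\<tau>\<in>S. m \<tau> > 0)"

text \<open>The complex proper: the empty simplex is kept only if the vertices have finite total
  weight. Below, \<open>S\<close> always stands for a set of this form.\<close>

definition reduced_complex :: "'v set set \<Rightarrow> ('v set \<Rightarrow> real) \<Rightarrow> 'v set set" where
  "reduced_complex S m = (if m summable_on simplices S 0 then S else S - {{}})"

definition face :: "'v set set \<Rightarrow> 'v set \<Rightarrow> 'v set \<Rightarrow> bool" where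
  "face S \<tau> \<sigma> \<longleftrightarrow> \<tau> \<in> S \<and> \<sigma> \<in> S \<and> \<tau> \<subseteq> \<sigma> \<and> card (\<sigma> - \<tau>) = 1"

definition locally_summable :: "'v set set \<Rightarrow> ('v set \<Rightarrow> real) \<Rightarrow> bool" where
  "locally_summable S m \<longleftrightarrow> (\<forall>\<tau>\<in>S. m summable_on {\<sigma>. face S \<tau> \<sigma>})"

definition balanced :: "'v set set \<Rightarrow> ('v set \<Rightarrow> real) \<Rightarrow> bool" where
  "balanced S m \<longleftrightarrow> bdd_above {m \<sigma> / m \<tau> |\<tau> \<sigma>. face S \<tau> \<sigma>}"

definition locally_finite :: "'v set set \<Rightarrow> bool" where
  "locally_finite S \<longleftrightarrow> (\<forall>\<tau>\<in>S. \<tau> \<noteq> {} \<longrightarrow> finite {\<sigma>. face S \<tau> \<sigma>})"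


section \<open>Function spaces\<close>

text \<open>A function on \<open>S\<close> is encoded as a function on all sets that vanishes off \<open>S\<close>.\<close>

definition fun_space :: "'v set set \<Rightarrow> ('v set \<Rightarrow> real) set" where
  "fun_space S = {\<omega>. \<forall>\<tau>. \<tau> \<notin> S \<longrightarrow> \<omega> \<tau> = 0}"

definition fin_supp :: "'v set set \<Rightarrow> ('v set \<Rightarrow> real) set" where
  "fin_supp S = {\<omega> \<in> fun_space S. finite {\<tau>. \<omega> \<tau> \<noteq> 0}}"

definition F1_space :: "'v set set \<Rightarrow> ('v set \<Rightarrow> real) \<Rightarrow> ('v set \<Rightarrow> real) set" where
  "F1_space S m = {\<omega> \<in> fun_space S. \<forall>\<tau>\<in>S. (\<lambda>\<sigma>. m \<sigma> * \<bar>\<omega> \<sigma>\<bar>) summable_on {\<sigma>. face S \<tau> \<sigma>}}"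

definition l2_space :: "'v set set \<Rightarrow> ('v set \<Rightarrow> real) \<Rightarrow> ('v set \<Rightarrow> real) set" where
  "l2_space S m = {\<omega> \<in> fun_space S. (\<lambda>\<sigma>. m \<sigma> * (\<omega> \<sigma>)\<^sup>2) summable_on S}"

definition l2_inner ::
  "'v set set \<Rightarrow> ('v set \<Rightarrow> real) \<Rightarrow> ('v set \<Rightarrow> real) \<Rightarrow> ('v set \<Rightarrow> real) \<Rightarrow> real" where
  "l2_inner S m \<omega> \<eta> = (\<Sum>\<^sub>\<infinity>\<sigma>\<in>S. m \<sigma> * \<omega> \<sigma> * \<eta> \<sigma>)"


section \<open>Coboundary, boundary and Laplacians\<close>

type_synonym 'v fun_op = "('v set \<Rightarrow> real) \<Rightarrow> ('v set \<Rightarrow> real)"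

definition theta :: "'v fun_op \<Rightarrow> 'v set \<Rightarrow> 'v set \<Rightarrow> real" where
  "theta \<delta> \<tau> \<sigma> = \<delta> (indicator {\<tau>}) \<sigma>"

definition coboundary_operator :: "'v set set \<Rightarrow> 'v fun_op \<Rightarrow> bool" where
  "coboundary_operator S \<delta> \<longleftrightarrow>
     \<delta> \<in> fun_space S \<rightarrow> fun_space S \<and>
     (\<forall>\<omega>\<in>fun_space S. \<forall>\<eta>\<in>fun_space S. \<delta> (\<lambda>\<tau>. \<omega> \<tau> + \<eta> \<tau>) = (\<lambda>\<tau>. \<delta> \<omega> \<tau> + \<delta> \<eta> \<tau>)) \<and>
     (\<forall>c. \<forall>\<omega>\<in>fun_space S. \<delta> (\<lambda>\<tau>. c * \<omega> \<tau>) = (\<lambda>\<tau>. c * \<delta> \<omega> \<tau>)) \<and>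
     (\<forall>\<omega>\<in>fun_space S. \<delta> (\<delta> \<omega>) = (\<lambda>_. 0)) \<and>
     (\<forall>\<tau>\<in>S. \<forall>\<sigma>\<in>S. theta \<delta> \<tau> \<sigma> \<in> {-1, 0, 1} \<and> (theta \<delta> \<tau> \<sigma> \<noteq> 0 \<longleftrightarrow> face S \<tau> \<sigma>)) \<and>
     (\<forall>\<omega>\<in>fun_space S. \<forall>\<sigma>\<in>S. \<delta> \<omega> \<sigma> = (\<Sum>\<tau> | face S \<tau> \<sigma>. \<omega> \<tau> * theta \<delta> \<tau> \<sigma>))"

text \<open>Meaningful on \<^term>\<open>F1_space S m\<close>, where the series converges absolutely.\<close>

definition boundary :: "'v set set \<Rightarrow> ('v set \<Rightarrow> real) \<Rightarrow> 'v fun_op \<Rightarrow> 'v fun_op" where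
  "boundary S m \<delta> \<omega> = (\<lambda>\<rho>. if \<rho> \<in> S
     then 1 / m \<rho> * (\<Sum>\<^sub>\<infinity>\<tau>\<in>{\<tau>. face S \<rho> \<tau>}. m \<tau> * \<omega> \<tau> * theta \<delta> \<rho> \<tau>) else 0)"

text \<open>The series in \<^term>\<open>boundary\<close> converge absolutely wherever the Laplacians below use them:
  both finitely supported functions and their coboundaries lie in \<^term>\<open>F1_space S m\<close>.\<close>

lemma fin_supp_subset_F1: "fin_supp S \<subseteq> F1_space S m"
proof
  fix \<omega> assume w: "\<omega> \<in> fin_supp S"
  have "(\<lambda>\<sigma>. m \<sigma> * \<bar>\<omega> \<sigma>\<bar>) summable_on A" for A
  proof (rule finite_nonzero_values_imp_summable_on)
    show "finite {\<sigma> \<in> A. m \<sigma> * \<bar>\<omega> \<sigma>\<bar> \<noteq> 0}"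
      using w by (auto simp: fin_supp_def elim!: rev_finite_subset)
  qed
  then show "\<omega> \<in> F1_space S m"
    using w by (auto simp: F1_space_def fin_supp_def)
qed

lemma coboundary_fin_supp_in_F1:
  assumes S: "\<forall>\<tau>\<in>S. finite \<tau>" and m: "weight S m" and ls: "locally_summable S m"
    and d: "coboundary_operator S \<delta>" and w: "\<omega> \<in> fin_supp S"
  shows "\<delta> \<omega> \<in> F1_space S m"
proof -
  define C where "C = (\<Sum>\<tau> | \<omega> \<tau> \<noteq> 0. \<bar>\<omega> \<tau>\<bar>)"
  have wF: "\<omega> \<in> fun_space S" and fin: "finite {\<tau>. \<omega> \<tau> \<noteq> 0}"
    using w by (auto simp: fin_supp_def)
  have bound: "\<bar>\<delta> \<omega> \<sigma>\<bar> \<le> C" if "\<sigma> \<in> S" for \<sigma>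
  proof -
    have finf: "finite {\<tau>. face S \<tau> \<sigma>}"
      using S that by (auto simp: face_def intro: finite_subset[of _ "Pow \<sigma>"])
    have th: "\<bar>theta \<delta> \<tau> \<sigma>\<bar> \<le> 1" if "face S \<tau> \<sigma>" for \<tau>
    proof -
      have "theta \<delta> \<tau> \<sigma> \<in> {-1, 0, 1}"
        using d that by (auto simp: coboundary_operator_def face_def)
      then show ?thesis by auto
    qed
    have "\<bar>\<delta> \<omega> \<sigma>\<bar> = \<bar>\<Sum>\<tau> | face S \<tau> \<sigma>. \<omega> \<tau> * theta \<delta> \<tau> \<sigma>\<bar>"
      using d wF that by (auto simp: coboundary_operator_def)
    also have "\<dots> \<le> (\<Sum>\<tau> | face S \<tau> \<sigma>. \<bar>\<omega> \<tau> * theta \<delta> \<tau> \<sigma>\<bar>)"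
      by (rule sum_abs)
    also have "\<dots> \<le> (\<Sum>\<tau> | face S \<tau> \<sigma>. \<bar>\<omega> \<tau>\<bar>)"
      by (rule sum_mono) (use th in \<open>auto simp: abs_mult intro: mult_left_le\<close>)
    also have "\<dots> = (\<Sum>\<tau> \<in> {\<tau>. face S \<tau> \<sigma>} \<inter> {\<tau>. \<omega> \<tau> \<noteq> 0}. \<bar>\<omega> \<tau>\<bar>)"
      by (rule sum.mono_neutral_right) (use finf in auto)
    also have "\<dots> \<le> C"
      unfolding C_def by (rule sum_mono2) (use fin in auto)
    finally show ?thesis .
  qed
  have "(\<lambda>\<sigma>. m \<sigma> * \<bar>\<delta> \<omega> \<sigma>\<bar>) summable_on {\<sigma>. face S \<tau> \<sigma>}" if "\<tau> \<in> S" for \<tau>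
  proof (rule summable_on_comparison_test)
    show "(\<lambda>\<sigma>. C * m \<sigma>) summable_on {\<sigma>. face S \<tau> \<sigma>}"
      using ls that by (auto simp: locally_summable_def intro: summable_on_cmult_right)
    fix \<sigma> assume "\<sigma> \<in> {\<sigma>. face S \<tau> \<sigma>}"
    then have "\<sigma> \<in> S" by (simp add: face_def)
    then have "m \<sigma> > 0" using m by (simp add: weight_def)
    then show "m \<sigma> * \<bar>\<delta> \<omega> \<sigma>\<bar> \<le> C * m \<sigma>" "0 \<le> m \<sigma> * \<bar>\<delta> \<omega> \<sigma>\<bar>"
      using bound[OF \<open>\<sigma> \<in> S\<close>] by (simp_all add: mult.commute mult_right_mono)
  qed
  moreover have "\<delta> \<omega> \<in> fun_space S"
    using d wF by (auto simp: coboundary_operator_def)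
  ultimately show ?thesis by (simp add: F1_space_def)
qed

datatype laplace_type = Upper | Lower | Hodge

definition dirac :: "'v set set \<Rightarrow> ('v set \<Rightarrow> real) \<Rightarrow> 'v fun_op \<Rightarrow> 'v fun_op" where
  "dirac S m \<delta> \<omega> = (\<lambda>\<tau>. \<delta> \<omega> \<tau> + boundary S m \<delta> \<omega> \<tau>)"

fun laplacian ::
  "'v set set \<Rightarrow> ('v set \<Rightarrow> real) \<Rightarrow> 'v fun_op \<Rightarrow> laplace_type \<Rightarrow> 'v fun_op" where
  "laplacian S m \<delta> Upper \<omega> = boundary S m \<delta> (\<delta> \<omega>)"
| "laplacian S m \<delta> Lower \<omega> = \<delta> (boundary S m \<delta> \<omega>)"
| "laplacian S m \<delta> Hodge \<omega> = dirac S m \<delta> (dirac S m \<delta> \<omega>)"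


section \<open>Path pseudo metrics\<close>

text \<open>\<open>x\<close> to the power \<open>-1/2\<close>, with value \<open>\<infinity>\<close> at \<open>0\<close> and \<open>0\<close> at \<open>\<infinity>\<close>.\<close>

definition inv_sqrt :: "ennreal \<Rightarrow> ennreal" where
  "inv_sqrt x = (if x = 0 then \<infinity> else if x = \<infinity> then 0 else ennreal (enn2real x powr (-1/2)))"

definition w_upper :: "'v set set \<Rightarrow> ('v set \<Rightarrow> real) \<Rightarrow> 'v \<Rightarrow> 'v \<Rightarrow> ennreal" where
  "w_upper S m x x' = (INF \<tau>\<in>{\<tau>\<in>S. \<tau> \<inter> {x, x'} \<noteq> {}}.
     inv_sqrt (ennreal (real_of_int (sdim \<tau> + 1) / m \<tau>) *
               (\<Sum>\<^sub>\<infinity>\<sigma>\<in>{\<sigma>. face S \<tau> \<sigma>}. ennreal (m \<sigma>))))"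

definition w_lower :: "'v set set \<Rightarrow> ('v set \<Rightarrow> real) \<Rightarrow> 'v \<Rightarrow> 'v \<Rightarrow> ennreal" where
  "w_lower S m x x' = (INF \<tau>\<in>{\<tau>\<in>S. \<tau> \<inter> {x, x'} \<noteq> {}}.
     ennreal (1/2) *
     inv_sqrt (\<Sum>\<^sub>\<infinity>\<tau>'\<in>{\<tau>'. \<tau>' \<noteq> \<tau> \<and> face S (\<tau> \<inter> \<tau>') \<tau> \<and> face S (\<tau> \<inter> \<tau>') \<tau>'}.
       ennreal (m \<tau>' / m (\<tau> \<inter> \<tau>'))))"

fun edge_length ::
  "'v set set \<Rightarrow> ('v set \<Rightarrow> real) \<Rightarrow> laplace_type \<Rightarrow> 'v \<Rightarrow> 'v \<Rightarrow> ennreal" where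
  "edge_length S m Upper x x' = (if x = x' then 0 else w_upper S m x x')"
| "edge_length S m Lower x x' = (if x = x' then 0 else w_lower S m x x')"
| "edge_length S m Hodge x x' = (if x = x' then 0 else
     ennreal (1 / sqrt 2) * min (w_upper S m x x') (w_lower S m x x'))"

definition adjacent :: "'v set set \<Rightarrow> 'v \<Rightarrow> 'v \<Rightarrow> bool" where
  "adjacent S v v' \<longleftrightarrow> v \<noteq> v' \<and> {v, v'} \<in> simplices S 1"

definition path_metric ::
  "'v set set \<Rightarrow> ('v set \<Rightarrow> real) \<Rightarrow> laplace_type \<Rightarrow> 'v \<Rightarrow> 'v \<Rightarrow> ennreal" where
  "path_metric S m c v v' =
     Inf {(\<Sum>k<n. edge_length S m c (p k) (p (Suc k))) |n p.
            p 0 = v \<and> p n = v' \<and> (\<forall>k<n. adjacent S (p k) (p (Suc k)))}"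

definition path_ball ::
  "'v set set \<Rightarrow> ('v set \<Rightarrow> real) \<Rightarrow> laplace_type \<Rightarrow> 'v \<Rightarrow> real \<Rightarrow> 'v set" where
  "path_ball S m c v r = {v'. {v'} \<in> simplices S 0 \<and> path_metric S m c v v' \<le> ennreal r}"


section \<open>Essential self-adjointness\<close>

text \<open>The Hilbert space is given by its carrier \<open>H\<close> and its inner product \<open>ip\<close>; an
  unbounded operator is treated through its graph \<open>G \<subseteq> H \<times> H\<close>.\<close>

definition ip_norm :: "('a \<Rightarrow> 'a \<Rightarrow> real) \<Rightarrow> 'a \<Rightarrow> real" where
  "ip_norm ip x = sqrt (ip x x)"

definition dense_subset :: "'a::minus set \<Rightarrow> ('a \<Rightarrow> 'a \<Rightarrow> real) \<Rightarrow> 'a set \<Rightarrow> bool" where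
  "dense_subset H ip D \<longleftrightarrow> D \<subseteq> H \<and> (\<forall>x\<in>H. \<forall>e>0. \<exists>y\<in>D. ip_norm ip (x - y) < e)"

definition op_graph :: "'a set \<Rightarrow> ('a \<Rightarrow> 'a) \<Rightarrow> ('a \<times> 'a) set" where
  "op_graph D T = {(x, T x) |x. x \<in> D}"

definition graph_closure ::
  "'a::minus set \<Rightarrow> ('a \<Rightarrow> 'a \<Rightarrow> real) \<Rightarrow> ('a \<times> 'a) set \<Rightarrow> ('a \<times> 'a) set" where
  "graph_closure H ip G = {(x, y) \<in> H \<times> H.
     \<forall>e>0. \<exists>(x', y')\<in>G. ip_norm ip (x - x') < e \<and> ip_norm ip (y - y') < e}"

definition adjoint_graph ::
  "'a set \<Rightarrow> ('a \<Rightarrow> 'a \<Rightarrow> real) \<Rightarrow> ('a \<times> 'a) set \<Rightarrow> ('a \<times> 'a) set" where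
  "adjoint_graph H ip G = {(u, w) \<in> H \<times> H. \<forall>(x, y)\<in>G. ip y u = ip x w}"

definition self_adjoint :: "'a::minus set \<Rightarrow> ('a \<Rightarrow> 'a \<Rightarrow> real) \<Rightarrow> ('a \<times> 'a) set \<Rightarrow> bool" where
  "self_adjoint H ip G \<longleftrightarrow>
     single_valued G \<and> dense_subset H ip (Domain G) \<and> adjoint_graph H ip G = G"

text \<open>\<open>T\<close> with domain \<open>D\<close> is a densely defined closable operator in \<open>H\<close> whose closure is
  self-adjoint. Closability is the single-valuedness of the closed graph.\<close>

definition essentially_self_adjoint ::
  "'a::minus set \<Rightarrow> ('a \<Rightarrow> 'a \<Rightarrow> real) \<Rightarrow> 'a set \<Rightarrow> ('a \<Rightarrow> 'a) \<Rightarrow> bool" where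
  "essentially_self_adjoint H ip D T \<longleftrightarrow>
     dense_subset H ip D \<and> T \<in> D \<rightarrow> H \<and>
     self_adjoint H ip (graph_closure H ip (op_graph D T))"

end

theory Submission
  imports Defs "HOL-Library.Function_Algebras"
begin

text \<open>A symmetric, nonnegative, densely defined operator \<open>T\<close> is essentially self-adjoint as soon as
  \<open>T\<^sup>* u = - u\<close> has only the trivial solution. Each of the three Laplacians is given on \<open>F\<^sup>c\<close> by a
  symmetric positive semidefinite matrix \<open>L\<close>. Testing \<open>T\<^sup>* u = - u\<close> against \<open>\<eta>\<^sup>2 u\<close>, where \<open>\<eta>\<close> is a finitely
  supported cutoff, and writing \<open>(\<eta>\<^sup>2 + \<eta>'\<^sup>2) / 2 = \<eta> \<eta>' + (\<eta> - \<eta>')\<^sup>2 / 2\<close> gives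
  \<open>\<parallel>\<eta> u\<parallel>\<^sup>2 \<le> 1/2 \<Sum> \<bar>L(\<tau>, \<tau>')\<bar> \<bar>u(\<tau>)\<bar> \<bar>u(\<tau>')\<bar> (\<eta>(\<tau>) - \<eta>(\<tau>'))\<^sup>2\<close>.
  For \<open>\<eta>(\<tau>)\<close> the minimum over the vertices of \<open>\<tau>\<close> of a function that is \<open>\<epsilon>\<close>-Lipschitz for the path metric,
  Schur's test bounds the right-hand side by a multiple of \<open>\<epsilon>\<^sup>2 \<parallel>u\<parallel>\<^sup>2\<close>: the edge weights are
  defined so that exactly the row sums appear. Finiteness of balls makes \<open>\<eta>\<close> finitely supported, because
  the minimum is nonzero only if all vertices of \<open>\<tau>\<close> lie in a ball. The empty simplex
  couples vertices at arbitrary distance in the lower Laplacian and is treated separately, using that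
  it belongs to the complex only if the vertices have finite total mass.\<close>

section \<open>A criterion for essential self-adjointness\<close>

text \<open>The scalars are real, so the point -1 replaces the usual pair of imaginary points: for
  \<open>T\<close> nonnegative, \<open>T + 1\<close> is bounded below, and a trivial kernel of its
  adjoint makes its range dense. A solution \<open>u\<close> of the deficiency equation is known
  only to lie in \<open>l2_space\<close>; nothing is known about its coboundary or boundary, and the
  equation may be tested against finitely supported functions alone. Hence the cutoff must have
  finite support, while \<open>u\<close> itself never enters the quadratic form. The minimum over
  vertices is preferred to the maximum because a maximum is nonzero on every simplex that merely
  meets a ball, and there may be infinitely many of these when \<Sigma> is not locally finite. The
  matrix couples only simplices that differ by the exchange of one vertex, so the variation of the
  cutoff across a nonzero entry is controlled by its values at two vertices. Since the error is
  quadratic in \<epsilon> and \<epsilon> is chosen after \<open>u\<close>, one cutoff for each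
  simplex and each tolerance is enough.\<close>

instantiation "fun" :: (type, real_vector) real_vector
begin

text \<open>The pointwise vector space structure lets \<open>subspace\<close> and its lemmas apply
  to sets of functions such as \<open>fin_supp\<close> and \<open>l2_space\<close>.\<close>

definition scaleR_fun_def: "c *\<^sub>R f = (\<lambda>x. c *\<^sub>R f x)"

instance
  by standard (auto simp: scaleR_fun_def fun_eq_iff algebra_simps)

end

lemma scaleR_apply [simp]: "(c *\<^sub>R f) x = c *\<^sub>R f x"
  by (simp add: scaleR_fun_def)

text \<open>A Hilbert space on a carrier set, because \<open>l2_space S m\<close> is only a part of
  the function type and varies with \<open>S\<close> and \<open>m\<close>. Symmetry and homogeneity
  are asked of all arguments, as infinite sums satisfy them unconditionally; additivity needs
  membership, as a family that is not summable has sum 0.\<close>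

locale hilbert_carrier =
  fixes H :: "'b::real_vector set" and ip :: "'b \<Rightarrow> 'b \<Rightarrow> real"
  assumes subspace: "subspace H"
    and ip_commute: "ip x y = ip y x"
    and ip_add_left: "\<lbrakk>x \<in> H; y \<in> H; z \<in> H\<rbrakk> \<Longrightarrow> ip (x + y) z = ip x z + ip y z"
    and ip_scaleR_left: "ip (r *\<^sub>R x) y = r * ip x y"
    and ip_ge_0: "x \<in> H \<Longrightarrow> 0 \<le> ip x x"
    and ip_eq_0D: "x \<in> H \<Longrightarrow> ip x x = 0 \<Longrightarrow> x = 0"
    and complete: "\<lbrakk>\<And>n. X n \<in> H; \<And>e. 0 < e \<Longrightarrow> \<exists>M. \<forall>i\<ge>M. \<forall>j\<ge>M. ip_norm ip (X i - X j) < e\<rbrakk>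
      \<Longrightarrow> \<exists>x\<in>H. (\<lambda>n. ip_norm ip (X n - x)) \<longlonglongrightarrow> 0"
begin

abbreviation nrm :: "'b \<Rightarrow> real" where "nrm \<equiv> ip_norm ip"

lemmas H_add [intro] = subspace_add[OF subspace]
lemmas H_diff [intro] = subspace_diff[OF subspace]
lemmas H_scale [intro] = subspace_scale[OF subspace]
lemmas H_0 [intro] = subspace_0[OF subspace]

lemma ip_add_right: "\<lbrakk>x \<in> H; y \<in> H; z \<in> H\<rbrakk> \<Longrightarrow> ip z (x + y) = ip z x + ip z y"
  by (metis ip_commute ip_add_left)

lemma ip_scaleR_right: "ip y (r *\<^sub>R x) = r * ip y x"
  by (metis ip_commute ip_scaleR_left)

lemma ip_diff_left: "\<lbrakk>x \<in> H; y \<in> H; z \<in> H\<rbrakk> \<Longrightarrow> ip (x - y) z = ip x z - ip y z"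
  using ip_add_left[of "x - y" y z] by (auto simp: H_diff)

lemma ip_diff_right: "\<lbrakk>x \<in> H; y \<in> H; z \<in> H\<rbrakk> \<Longrightarrow> ip z (x - y) = ip z x - ip z y"
  by (metis ip_commute ip_diff_left)

lemmas ip_algebra = ip_add_left ip_add_right ip_diff_left ip_diff_right ip_scaleR_left
  ip_scaleR_right H_add H_diff H_scale

lemma nrm_power2: "x \<in> H \<Longrightarrow> (nrm x)\<^sup>2 = ip x x"
  by (simp add: ip_norm_def ip_ge_0)

lemma nrm_ge_0: "x \<in> H \<Longrightarrow> 0 \<le> nrm x"
  by (simp add: ip_norm_def ip_ge_0)

lemma nrm_eq_0D: "x \<in> H \<Longrightarrow> nrm x = 0 \<Longrightarrow> x = 0"
  by (simp add: ip_norm_def ip_eq_0D)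

lemma ip_0_left: "ip 0 x = 0"
  using ip_scaleR_left[of 0 0 x] by simp

lemma nrm_0: "nrm 0 = 0"
  by (simp add: ip_norm_def ip_0_left)

lemma nrm_scaleR: "x \<in> H \<Longrightarrow> nrm (r *\<^sub>R x) = \<bar>r\<bar> * nrm x"
  by (simp add: ip_norm_def ip_scaleR_left ip_scaleR_right real_sqrt_mult flip: mult.assoc)

lemma nrm_minus_commute: "x \<in> H \<Longrightarrow> y \<in> H \<Longrightarrow> nrm (x - y) = nrm (y - x)"
  using nrm_scaleR[of "x - y" "-1"] by (simp add: H_diff)

lemma Cauchy_Schwarz:
  assumes "x \<in> H" "y \<in> H"
  shows "\<bar>ip x y\<bar> \<le> nrm x * nrm y"
proof (cases "ip y y = 0")
  case True
  then have "y = 0" by (rule ip_eq_0D[OF assms(2)])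
  then show ?thesis by (simp add: nrm_0 ip_0_left ip_commute[of x 0])
next
  case False
  then have pos: "ip y y > 0" using ip_ge_0[OF assms(2)] by simp
  define t where "t = ip x y / ip y y"
  have "0 \<le> ip (x - t *\<^sub>R y) (x - t *\<^sub>R y)"
    by (rule ip_ge_0) (use assms in auto)
  also have "\<dots> = ip x x - 2 * t * ip x y + t * t * ip y y"
    using assms by (simp add: ip_algebra ip_commute[of y x] algebra_simps)
  also have "\<dots> = ip x x - (ip x y)\<^sup>2 / ip y y"
    using pos by (simp add: t_def field_simps power2_eq_square)
  finally have "(ip x y)\<^sup>2 / ip y y \<le> ip x x" by simp
  then have "(ip x y)\<^sup>2 \<le> ip x x * ip y y"
    using pos by (simp add: pos_divide_le_eq)
  also have "\<dots> = (nrm x * nrm y)\<^sup>2"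
    using assms by (simp add: power_mult_distrib nrm_power2)
  finally show ?thesis
    using nrm_ge_0 assms by (simp add: abs_le_square_iff[symmetric] abs_mult)
qed

lemma nrm_triangle:
  assumes "x \<in> H" "y \<in> H"
  shows "nrm (x + y) \<le> nrm x + nrm y"
proof (rule power2_le_imp_le)
  have "(nrm (x + y))\<^sup>2 = (nrm x)\<^sup>2 + 2 * ip x y + (nrm y)\<^sup>2"
    using assms by (simp add: nrm_power2 ip_algebra ip_commute[of y x])
  also have "\<dots> \<le> (nrm x + nrm y)\<^sup>2"
    using Cauchy_Schwarz[OF assms] by (simp add: power2_sum)
  finally show "(nrm (x + y))\<^sup>2 \<le> (nrm x + nrm y)\<^sup>2" .
qed (use nrm_ge_0 assms in auto)

lemma nrm_triangle_sub:
  assumes "x \<in> H" "y \<in> H" "z \<in> H"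
  shows "nrm (x - z) \<le> nrm (x - y) + nrm (y - z)"
  using nrm_triangle[of "x - y" "y - z"] assms by auto

lemma ip_tendsto:
  assumes X: "\<And>n. X n \<in> H" and "x \<in> H" "y \<in> H" and lim: "(\<lambda>n. nrm (X n - x)) \<longlonglongrightarrow> 0"
  shows "(\<lambda>n. ip (X n) y) \<longlonglongrightarrow> ip x y"
proof (rule LIM_zero_cancel, rule Lim_null_comparison)
  show "\<forall>\<^sub>F n in sequentially. norm (ip (X n) y - ip x y) \<le> nrm (X n - x) * nrm y"
    using Cauchy_Schwarz[of "X _ - x" y] assms by (auto simp: ip_algebra)
  show "(\<lambda>n. nrm (X n - x) * nrm y) \<longlonglongrightarrow> 0"
    using tendsto_mult_right[OF lim, of "nrm y"] by simp
qed

text \<open>Approximants within \<open>inverse (Suc n)\<close> turn the epsilon form of the closure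
  into sequences, to which \<open>complete\<close> and the continuity of \<open>ip\<close> can be
  applied.\<close>

lemma mem_graph_closure_iff:
  assumes "D \<subseteq> H" "T \<in> D \<rightarrow> H"
  shows "(x, y) \<in> graph_closure H ip (op_graph D T) \<longleftrightarrow> x \<in> H \<and> y \<in> H \<and>
    (\<exists>X. (\<forall>n. X n \<in> D) \<and> (\<lambda>n. nrm (X n - x)) \<longlonglongrightarrow> 0 \<and> (\<lambda>n. nrm (T (X n) - y)) \<longlonglongrightarrow> 0)"
    (is "_ \<longleftrightarrow> ?R")
proof
  assume L: "(x, y) \<in> graph_closure H ip (op_graph D T)"
  then have xy: "x \<in> H" "y \<in> H" by (auto simp: graph_closure_def)
  have "\<exists>a\<in>D. nrm (x - a) < e \<and> nrm (y - T a) < e" if "e > 0" for e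
    using L that by (auto simp: graph_closure_def op_graph_def)
  then have "\<forall>n. \<exists>a. a \<in> D \<and> nrm (x - a) < inverse (real (Suc n)) \<and> nrm (y - T a) < inverse (real (Suc n))"
    by (metis inverse_positive_iff_positive of_nat_0_less_iff zero_less_Suc)
  then obtain X where X: "\<And>n. X n \<in> D" "\<And>n. nrm (x - X n) < inverse (real (Suc n))"
    "\<And>n. nrm (y - T (X n)) < inverse (real (Suc n))"
    by metis
  have mem: "X n \<in> H" "T (X n) \<in> H" for n
    using X(1)[of n] assms by auto
  have "(\<lambda>n. nrm (X n - x)) \<longlonglongrightarrow> 0"
  proof (rule Lim_null_comparison[OF _ LIMSEQ_inverse_real_of_nat], rule always_eventually, rule allI)
    show "norm (nrm (X n - x)) \<le> inverse (real (Suc n))" for n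
      using X(2)[of n] nrm_minus_commute[OF mem(1)[of n] xy(1)] nrm_ge_0[of "X n - x"] mem xy
      by (simp add: H_diff)
  qed
  moreover have "(\<lambda>n. nrm (T (X n) - y)) \<longlonglongrightarrow> 0"
  proof (rule Lim_null_comparison[OF _ LIMSEQ_inverse_real_of_nat], rule always_eventually, rule allI)
    show "norm (nrm (T (X n) - y)) \<le> inverse (real (Suc n))" for n
      using X(3)[of n] nrm_minus_commute[OF mem(2)[of n] xy(2)] nrm_ge_0[of "T (X n) - y"] mem xy
      by (simp add: H_diff)
  qed
  ultimately show ?R using X(1) xy by blast
next
  assume ?R
  then obtain X where X: "x \<in> H" "y \<in> H" "\<And>n. X n \<in> D" "(\<lambda>n. nrm (X n - x)) \<longlonglongrightarrow> 0"
    "(\<lambda>n. nrm (T (X n) - y)) \<longlonglongrightarrow> 0" by blast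
  have mem: "X n \<in> H" "T (X n) \<in> H" for n
    using X(3)[of n] assms by auto
  have "\<exists>a\<in>D. nrm (x - a) < e \<and> nrm (y - T a) < e" if e: "e > 0" for e
  proof -
    have "\<forall>\<^sub>F n in sequentially. nrm (X n - x) < e \<and> nrm (T (X n) - y) < e"
      using order_tendstoD(2)[OF X(4) e] order_tendstoD(2)[OF X(5) e] by eventually_elim auto
    then obtain n where "nrm (X n - x) < e \<and> nrm (T (X n) - y) < e"
      using eventually_happens'[OF sequentially_bot] by blast
    then show ?thesis using X mem nrm_minus_commute by metis
  qed
  then show "(x, y) \<in> graph_closure H ip (op_graph D T)"
    using X by (auto simp: graph_closure_def op_graph_def)
qed

text \<open>A minimizing sequence for the distance from \<open>y\<close> to \<open>R\<close> is Cauchy by the parallelogram law,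
  and \<open>y\<close> minus its limit is orthogonal to \<open>R\<close>.\<close>

lemma dense_if_trivial_complement:
  assumes R: "subspace R" "R \<subseteq> H" and perp: "\<And>z. \<lbrakk>z \<in> H; \<And>r. r \<in> R \<Longrightarrow> ip r z = 0\<rbrakk> \<Longrightarrow> z = 0"
    and y: "y \<in> H"
  shows "\<exists>X. (\<forall>n. X n \<in> R) \<and> (\<lambda>n. nrm (X n - y)) \<longlonglongrightarrow> 0"
proof -
  define d where "d = (INF r\<in>R. ip (y - r) (y - r))"
  have R0: "0 \<in> R" and Radd: "\<And>a b. a \<in> R \<Longrightarrow> b \<in> R \<Longrightarrow> a + b \<in> R"
    and Rsc: "\<And>a r. a \<in> R \<Longrightarrow> r *\<^sub>R a \<in> R"
    using R by (auto simp: subspace_def)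
  have bdd: "bdd_below ((\<lambda>r. ip (y - r) (y - r)) ` R)"
    using R y by (intro bdd_belowI[of _ 0]) (auto intro!: ip_ge_0)
  have dle: "d \<le> ip (y - r) (y - r)" if "r \<in> R" for r
    unfolding d_def by (rule cINF_lower[OF bdd that])
  have "\<exists>r\<in>R. ip (y - r) (y - r) < d + e" if "e > 0" for e
    using cINF_less_iff[OF _ bdd, of "d + e"] R0 that unfolding d_def by auto
  then have "\<forall>n. \<exists>r. r \<in> R \<and> ip (y - r) (y - r) < d + inverse (real (Suc n))"
    by (metis inverse_positive_iff_positive of_nat_0_less_iff zero_less_Suc)
  then obtain X where X: "\<And>n. X n \<in> R" "\<And>n. ip (y - X n) (y - X n) < d + inverse (real (Suc n))"
    by metis
  have XH: "X n \<in> H" for n using X R by auto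
  have par: "(nrm (X i - X j))\<^sup>2 \<le> 2 * inverse (real (Suc i)) + 2 * inverse (real (Suc j))" for i j
  proof -
    define s where "s = (1/2) *\<^sub>R (X i + X j)"
    have sR: "s \<in> R" unfolding s_def by (intro Rsc Radd X)
    \<comment> \<open>The midpoint \<open>s\<close> lies in \<open>R\<close>, so the last term is at
      least \<open>4 * d\<close> and cancels the two contributions \<open>2 * d\<close>; only the
      excesses over \<open>d\<close> remain.\<close>
    have "(nrm (X i - X j))\<^sup>2
        = 2 * ip (y - X i) (y - X i) + 2 * ip (y - X j) (y - X j) - 4 * ip (y - s) (y - s)"
      unfolding s_def using XH[of i] XH[of j] y
      by (simp add: nrm_power2 ip_algebra ip_commute algebra_simps)
    then show ?thesis using X(2)[of i] X(2)[of j] dle[OF sR] by linarith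
  qed
  have "\<exists>M. \<forall>i\<ge>M. \<forall>j\<ge>M. nrm (X i - X j) < e" if e: "e > 0" for e
  proof -
    obtain M where M: "inverse (real (Suc M)) < e\<^sup>2 / 4"
      using reals_Archimedean[of "e\<^sup>2 / 4"] e by auto
    have "nrm (X i - X j) < e" if "i \<ge> M" "j \<ge> M" for i j
    proof (rule power2_less_imp_less)
      have "inverse (real (Suc i)) \<le> inverse (real (Suc M))" "inverse (real (Suc j)) \<le> inverse (real (Suc M))"
        using that by (auto intro!: le_imp_inverse_le)
      then show "(nrm (X i - X j))\<^sup>2 < e\<^sup>2" using par[of i j] M by linarith
    qed (use e in auto)
    then show ?thesis by blast
  qed
  from complete[OF XH this] obtain z where z: "z \<in> H" "(\<lambda>n. nrm (X n - z)) \<longlonglongrightarrow> 0" by blast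
  have "y - z = 0"
  proof (rule perp)
    show "y - z \<in> H" using y z by auto
    fix r assume r: "r \<in> R"
    have rH: "r \<in> H" using r R by auto
    \<comment> \<open>\<open>X n\<close> is only nearly minimizing, so orthogonality holds up to an
      error: moving by the optimal step \<open>t\<close> along \<open>r\<close> stays in
      \<open>R\<close> and can lower the squared distance by at most
      \<open>inverse (Suc n)\<close>.\<close>
    have est: "\<bar>ip r y - ip r (X n)\<bar> \<le> nrm r * sqrt (inverse (real (Suc n)))" for n
    proof (cases "ip r r = 0")
      case True
      then have "r = 0" by (rule ip_eq_0D[OF rH])
      then show ?thesis by (simp add: ip_0_left nrm_0)
    next
      case False
      then have pos: "ip r r > 0" using ip_ge_0[OF rH] by simp
      define q where "q = ip r y - ip r (X n)"
      define t where "t = q / ip r r"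
      have "d \<le> ip (y - (X n + t *\<^sub>R r)) (y - (X n + t *\<^sub>R r))"
        by (intro dle Radd Rsc X r)
      also have "\<dots> = ip (y - X n) (y - X n) - 2 * t * q + t * t * ip r r"
        using XH[of n] rH y unfolding q_def
        by (simp add: ip_algebra ip_commute algebra_simps)
      also have "\<dots> = ip (y - X n) (y - X n) - q\<^sup>2 / ip r r"
        using pos by (simp add: t_def field_simps power2_eq_square)
      finally have "q\<^sup>2 / ip r r \<le> inverse (real (Suc n))" using X(2)[of n] by linarith
      then have "q\<^sup>2 \<le> ip r r * inverse (real (Suc n))"
        using pos by (simp add: pos_divide_le_eq mult.commute)
      then have "sqrt (q\<^sup>2) \<le> sqrt (ip r r * inverse (real (Suc n)))" by (rule real_sqrt_le_mono)
      then show ?thesis by (simp add: q_def ip_norm_def real_sqrt_mult)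
    qed
    have "(\<lambda>n. ip r y - ip r (X n)) \<longlonglongrightarrow> 0"
    proof (rule Lim_null_comparison)
      show "\<forall>\<^sub>F n in sequentially. norm (ip r y - ip r (X n)) \<le> nrm r * sqrt (inverse (real (Suc n)))"
        using est by auto
      show "(\<lambda>n. nrm r * sqrt (inverse (real (Suc n)))) \<longlonglongrightarrow> 0"
        using tendsto_mult_left[OF tendsto_real_sqrt[OF LIMSEQ_inverse_real_of_nat], of "nrm r"] by simp
    qed
    moreover have "(\<lambda>n. ip r y - ip r (X n)) \<longlonglongrightarrow> ip r y - ip r z"
      using ip_tendsto[OF XH z(1) rH z(2)] by (intro tendsto_intros) (simp add: ip_commute[of r])
    ultimately have "ip r y - ip r z = 0" using LIMSEQ_unique by blast
    then show "ip r (y - z) = 0" using rH y z by (simp add: ip_algebra)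
  qed
  then show ?thesis using X z by auto
qed

text \<open>By \<open>defic\<close> nothing is orthogonal to the range of \<open>T + 1\<close>, so
  this range is dense. By \<open>pos\<close>, \<open>T + 1\<close> does not shrink norms, so the
  closure of \<open>T\<close>, plus 1, is onto. Given an adjoint pair \<open>(u, w)\<close>, solving
  for \<open>u + w\<close> yields a pair of the closure, and injectivity of the adjoint plus 1 shows
  that it is \<open>(u, w)\<close>.\<close>

theorem essentially_self_adjointI:
  assumes D: "subspace D" "dense_subset H ip D" and TH: "T \<in> D \<rightarrow> H"
    and T_add: "\<And>x y. x \<in> D \<Longrightarrow> y \<in> D \<Longrightarrow> T (x + y) = T x + T y"
    and T_scale: "\<And>r x. x \<in> D \<Longrightarrow> T (r *\<^sub>R x) = r *\<^sub>R T x"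
    and sym: "\<And>x y. x \<in> D \<Longrightarrow> y \<in> D \<Longrightarrow> ip (T x) y = ip x (T y)"
    and pos: "\<And>x. x \<in> D \<Longrightarrow> 0 \<le> ip (T x) x"
    and defic: "\<And>u. \<lbrakk>u \<in> H; \<And>x. x \<in> D \<Longrightarrow> ip (T x) u = - ip x u\<rbrakk> \<Longrightarrow> u = 0"
  shows "essentially_self_adjoint H ip D T"
proof -
  have DH: "D \<subseteq> H" using D by (auto simp: dense_subset_def)
  have Dd: "x - y \<in> D" "T (x - y) = T x - T y" if "x \<in> D" "y \<in> D" for x y
  proof -
    show "x - y \<in> D" using D that by (simp add: subspace_diff)
    then show "T (x - y) = T x - T y" using T_add[of "x - y" y] that by simp
  qed
  define G C where "G = op_graph D T" and "C = graph_closure H ip G"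
  have Ciff: "(x, y) \<in> C \<longleftrightarrow> x \<in> H \<and> y \<in> H \<and>
    (\<exists>X. (\<forall>n. X n \<in> D) \<and> (\<lambda>n. nrm (X n - x)) \<longlonglongrightarrow> 0 \<and> (\<lambda>n. nrm (T (X n) - y)) \<longlonglongrightarrow> 0)" for x y
    unfolding C_def G_def by (rule mem_graph_closure_iff[OF DH TH])
  have Aiff: "(u, w) \<in> adjoint_graph H ip G \<longleftrightarrow> u \<in> H \<and> w \<in> H \<and> (\<forall>a\<in>D. ip (T a) u = ip a w)" for u w
    by (auto simp: adjoint_graph_def G_def op_graph_def)
  have GC: "(a, T a) \<in> C" if "a \<in> D" for a
    unfolding Ciff using that DH TH by (auto intro!: exI[of _ "\<lambda>_. a"] simp: nrm_0)
  \<comment> \<open>By continuity of \<open>ip\<close>, an adjoint relation tested on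
    \<open>D\<close> persists on the closure, so \<open>T\<close> and its closure have the same
    adjoint.\<close>
  have ext: "ip y u = ip x w" if xy: "(x, y) \<in> C" and uw: "u \<in> H" "w \<in> H" "\<forall>a\<in>D. ip (T a) u = ip a w" for x y u w
  proof -
    obtain X where X: "x \<in> H" "y \<in> H" "\<And>n. X n \<in> D" "(\<lambda>n. nrm (X n - x)) \<longlonglongrightarrow> 0"
      "(\<lambda>n. nrm (T (X n) - y)) \<longlonglongrightarrow> 0" using xy unfolding Ciff by blast
    have mem: "X n \<in> H" "T (X n) \<in> H" for n using X(3)[of n] DH TH by auto
    have "(\<lambda>n. ip (T (X n)) u) \<longlonglongrightarrow> ip y u" by (rule ip_tendsto) (use mem X uw in auto)
    moreover have "(\<lambda>n. ip (X n) w) \<longlonglongrightarrow> ip x w" by (rule ip_tendsto) (use mem X uw in auto)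
    moreover have "ip (T (X n)) u = ip (X n) w" for n using uw X by auto
    ultimately show ?thesis using LIMSEQ_unique by (metis (no_types, lifting) ext)
  qed
  have CA: "C \<subseteq> adjoint_graph H ip G"
  proof clarify
    fix x y assume xy: "(x, y) \<in> C"
    have "ip (T a) x = ip a y" if "a \<in> D" for a
    proof -
      have "a \<in> H" "T a \<in> H" using that DH TH by auto
      then have "ip y a = ip x (T a)" using ext[OF xy] sym that ip_commute by metis
      then show ?thesis by (simp add: ip_commute)
    qed
    then show "(x, y) \<in> adjoint_graph H ip G" using xy by (auto simp: Aiff Ciff)
  qed
  have AC: "adjoint_graph H ip G \<subseteq> C"
  proof clarify
    fix u w assume "(u, w) \<in> adjoint_graph H ip G"
    then have uw: "u \<in> H" "w \<in> H" "\<And>a. a \<in> D \<Longrightarrow> ip (T a) u = ip a w" by (auto simp: Aiff)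
    define R where "R = (\<lambda>a. T a + a) ` D"
    have RH: "R \<subseteq> H" using DH TH by (auto simp: R_def)
    have Rsub: "subspace R"
    proof (rule subspaceI)
      show "0 \<in> R" unfolding R_def
        using subspace_0[OF D(1)] T_scale[of 0 0] by (intro image_eqI[of _ _ 0]) auto
      show "x + y \<in> R" if "x \<in> R" "y \<in> R" for x y
      proof -
        from that obtain a b where "a \<in> D" "b \<in> D" "x = T a + a" "y = T b + b" by (auto simp: R_def)
        then show ?thesis unfolding R_def
          by (intro image_eqI[of _ _ "a + b"]) (auto simp: T_add intro: subspace_add[OF D(1)])
      qed
      show "r *\<^sub>R x \<in> R" if "x \<in> R" for r x
      proof -
        from that obtain a where "a \<in> D" "x = T a + a" by (auto simp: R_def)
        then show ?thesis unfolding R_def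
          by (intro image_eqI[of _ _ "r *\<^sub>R a"])
             (auto simp: T_scale scaleR_right_distrib intro: subspace_scale[OF D(1)])
      qed
    qed
    have perp: "z = 0" if z: "z \<in> H" "\<And>r. r \<in> R \<Longrightarrow> ip r z = 0" for z
    proof (rule defic[OF z(1)])
      fix x assume x: "x \<in> D"
      have "T x \<in> H" "x \<in> H" using x DH TH by auto
      then show "ip (T x) z = - ip x z"
        using z(2)[of "T x + x"] z(1) x by (auto simp: R_def ip_algebra)
    qed
    obtain Y where "\<And>n. Y n \<in> R" and Yl: "(\<lambda>n. nrm (Y n - (u + w))) \<longlonglongrightarrow> 0"
      using dense_if_trivial_complement[OF Rsub RH perp, of "u + w"] uw by blast
    then have "\<forall>n. \<exists>a. a \<in> D \<and> Y n = T a + a" by (auto simp: R_def)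
    then obtain X where X: "\<And>n. X n \<in> D" "\<And>n. Y n = T (X n) + X n" by metis
    have mem: "X n \<in> H" "T (X n) \<in> H" "Y n \<in> H" for n
      using X(1)[of n] DH TH by (auto simp: X(2))
    \<comment> \<open>Pairing \<open>Y i - Y j\<close> with \<open>X i - X j\<close> leaves the
      squared norm of \<open>X i - X j\<close> plus a term that \<open>pos\<close> allows to be
      dropped. Preimages of a Cauchy sequence under \<open>T + 1\<close> are thus Cauchy.\<close>
    have coer: "nrm (X i - X j) \<le> nrm (Y i - Y j)" for i j
    proof -
      have d: "X i - X j \<in> D" "T (X i - X j) = T (X i) - T (X j)" using Dd X by auto
      have "nrm (X i - X j) * nrm (X i - X j) = ip (X i - X j) (X i - X j)"
        using nrm_power2[of "X i - X j"] mem by (simp add: power2_eq_square H_diff)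
      also have "\<dots> \<le> ip (T (X i - X j)) (X i - X j) + ip (X i - X j) (X i - X j)"
        using pos[OF d(1)] by simp
      also have "\<dots> = ip (T (X i - X j) + (X i - X j)) (X i - X j)"
        using d mem by (subst ip_add_left) (auto simp: H_diff)
      also have "\<dots> = ip (Y i - Y j) (X i - X j)"
        by (simp add: d X(2) algebra_simps)
      also have "\<dots> \<le> nrm (Y i - Y j) * nrm (X i - X j)"
        using Cauchy_Schwarz[of "Y i - Y j" "X i - X j"] mem by (simp add: H_diff)
      finally show ?thesis
        using nrm_ge_0[of "X i - X j"] nrm_ge_0[of "Y i - Y j"] mem
        by (metis H_diff mult_le_cancel_right order_antisym_conv linorder_not_le)
    qed
    have uwH: "u + w \<in> H" using uw by auto
    have "\<exists>M. \<forall>i\<ge>M. \<forall>j\<ge>M. nrm (X i - X j) < e" if e: "e > 0" for e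
    proof -
      have "\<forall>\<^sub>F n in sequentially. nrm (Y n - (u + w)) < e / 2"
        using order_tendstoD(2)[OF Yl, of "e / 2"] e by simp
      then obtain M where M: "\<And>n. n \<ge> M \<Longrightarrow> nrm (Y n - (u + w)) < e / 2"
        by (auto simp: eventually_sequentially)
      have "nrm (X i - X j) < e" if "i \<ge> M" "j \<ge> M" for i j
        using coer[of i j] nrm_triangle_sub[OF mem(3)[of i] uwH mem(3)[of j]] M[OF that(1)] M[OF that(2)]
          nrm_minus_commute[OF uwH mem(3)[of j]] by linarith
      then show ?thesis by blast
    qed
    from complete[OF mem(1) this] obtain x where x: "x \<in> H" "(\<lambda>n. nrm (X n - x)) \<longlonglongrightarrow> 0" by blast
    have Tl: "(\<lambda>n. nrm (T (X n) - (u + w - x))) \<longlonglongrightarrow> 0"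
    proof (rule Lim_null_comparison)
      show "\<forall>\<^sub>F n in sequentially. norm (nrm (T (X n) - (u + w - x))) \<le> nrm (Y n - (u + w)) + nrm (X n - x)"
      proof (rule always_eventually, rule allI)
        fix n
        have "nrm ((Y n - (u + w)) + (x - X n)) \<le> nrm (Y n - (u + w)) + nrm (x - X n)"
          by (rule nrm_triangle) (use mem uwH x in auto)
        moreover have "(Y n - (u + w)) + (x - X n) = T (X n) - (u + w - x)"
          by (simp add: X(2))
        moreover have "T (X n) - (u + w - x) \<in> H" using mem uwH x by auto
        ultimately show "norm (nrm (T (X n) - (u + w - x))) \<le> nrm (Y n - (u + w)) + nrm (X n - x)"
          using nrm_minus_commute[OF x(1) mem(1)] nrm_ge_0 by simp
      qed
      show "(\<lambda>n. nrm (Y n - (u + w)) + nrm (X n - x)) \<longlonglongrightarrow> 0"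
        using tendsto_add[OF Yl x(2)] by simp
    qed
    have xC: "(x, u + w - x) \<in> C"
      unfolding Ciff using x uwH X Tl by auto
    \<comment> \<open>Both \<open>(u, w)\<close> and \<open>(x, u + w - x)\<close> are adjoint pairs
      whose components add up to \<open>u + w\<close>; their difference therefore solves the
      deficiency equation.\<close>
    have "u - x = 0"
    proof (rule defic)
      show "u - x \<in> H" using uw x by auto
      fix a assume a: "a \<in> D"
      have aH: "a \<in> H" "T a \<in> H" using a DH TH by auto
      have "ip (T a) x = ip a (u + w - x)"
        using subsetD[OF CA xC] a by (auto simp: Aiff)
      then show "ip (T a) (u - x) = - ip a (u - x)"
        using uw(3)[OF a] uw(1,2) x(1) aH by (simp add: ip_algebra)
    qed
    then show "(u, w) \<in> C" using xC by simp
  qed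
  have eq: "C = adjoint_graph H ip G" using CA AC by blast
  have "adjoint_graph H ip C = C"
  proof (rule subset_antisym)
    have "G \<subseteq> C" using GC by (auto simp: G_def op_graph_def)
    then show "adjoint_graph H ip C \<subseteq> C"
      unfolding eq[unfolded C_def] by (auto simp: adjoint_graph_def eq)
    show "C \<subseteq> adjoint_graph H ip C"
    proof clarify
      fix u w assume "(u, w) \<in> C"
      then have uw: "u \<in> H" "w \<in> H" "\<forall>a\<in>D. ip (T a) u = ip a w" by (auto simp: eq Aiff)
      then show "(u, w) \<in> adjoint_graph H ip C"
        using ext[OF _ uw] by (auto simp: adjoint_graph_def)
    qed
  qed
  moreover have "dense_subset H ip (Domain C)"
  proof -
    have "Domain C \<subseteq> H" by (auto simp: Ciff)
    moreover have "D \<subseteq> Domain C" using GC by blast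
    ultimately show ?thesis using D(2) unfolding dense_subset_def by blast
  qed
  moreover have "single_valued C"
  proof (rule single_valuedI)
    fix x y z assume "(x, y) \<in> C" "(x, z) \<in> C"
    then have *: "y \<in> H" "z \<in> H" "\<And>a. a \<in> D \<Longrightarrow> ip a (y - z) = 0"
      using DH by (auto simp: eq Aiff ip_diff_right)
    define e where "e = y - z"
    have eH: "e \<in> H" using * by (auto simp: e_def)
    \<comment> \<open>Two values of the closure at one point differ by a vector \<open>e\<close>
      orthogonal to \<open>D\<close>; subtracting an approximant \<open>a\<close> in
      \<open>D\<close> on the left does not change \<open>ip e e\<close>.\<close>
    have "nrm e \<le> r" if r: "r > 0" for r
    proof -
      obtain a where a: "a \<in> D" "nrm (e - a) < r"
        using D(2) eH r unfolding dense_subset_def by blast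
      have aH: "a \<in> H" using a DH by auto
      have "nrm e * nrm e = ip e e" using nrm_power2[OF eH] by (simp add: power2_eq_square)
      also have "\<dots> = ip (e - a) e" using *(3)[OF a(1)] eH aH by (simp add: ip_diff_left e_def)
      also have "\<dots> \<le> nrm (e - a) * nrm e" using Cauchy_Schwarz[of "e - a" e] eH aH by (simp add: H_diff)
      finally show ?thesis using a(2) nrm_ge_0[OF eH]
        by (smt (verit) mult_right_less_imp_less mult_strict_right_mono r)
    qed
    then have "nrm e = 0" using nrm_ge_0[OF eH]
      by (metis dense_ge nle_le)
    then show "y = z" using nrm_eq_0D[OF eH] by (simp add: e_def)
  qed
  ultimately show ?thesis
    using D(2) TH unfolding essentially_self_adjoint_def self_adjoint_def C_def G_def by simp
qed

end


section \<open>Weighted square-summable functions\<close>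

lemma l2_prod_summable:
  assumes m: "weight S m" and x: "x \<in> l2_space S m" and y: "y \<in> l2_space S m"
  shows "(\<lambda>\<sigma>. m \<sigma> * x \<sigma> * y \<sigma>) summable_on S"
proof (rule abs_summable_summable, rule Infinite_Sum.abs_summable_on_comparison_test)
  have "(\<lambda>\<sigma>. m \<sigma> * (x \<sigma>)\<^sup>2 + m \<sigma> * (y \<sigma>)\<^sup>2) summable_on S"
    using x y by (intro summable_on_add) (auto simp: l2_space_def)
  then show "(\<lambda>\<sigma>. norm (m \<sigma> * (x \<sigma>)\<^sup>2 + m \<sigma> * (y \<sigma>)\<^sup>2)) summable_on S"
    by (rule iffD1[OF summable_on_iff_abs_summable_on_real])
  show "norm (m \<sigma> * x \<sigma> * y \<sigma>) \<le> norm (m \<sigma> * (x \<sigma>)\<^sup>2 + m \<sigma> * (y \<sigma>)\<^sup>2)" if "\<sigma> \<in> S" for \<sigma>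
  proof -
    have pos: "m \<sigma> > 0" using m that by (auto simp: weight_def)
    have "\<bar>x \<sigma> * y \<sigma>\<bar> \<le> (x \<sigma>)\<^sup>2 + (y \<sigma>)\<^sup>2"
    proof -
      have "0 \<le> \<bar>x \<sigma>\<bar> * \<bar>y \<sigma>\<bar>" by simp
      then show ?thesis
        using sum_squares_bound[of "\<bar>x \<sigma>\<bar>" "\<bar>y \<sigma>\<bar>"] unfolding abs_mult power2_abs by linarith
    qed
    then have "m \<sigma> * \<bar>x \<sigma> * y \<sigma>\<bar> \<le> m \<sigma> * ((x \<sigma>)\<^sup>2 + (y \<sigma>)\<^sup>2)"
      using pos by (intro mult_left_mono) auto
    moreover have "0 \<le> m \<sigma> * ((x \<sigma>)\<^sup>2 + (y \<sigma>)\<^sup>2)" using pos by simp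
    ultimately show ?thesis using pos by (simp add: abs_mult algebra_simps)
  qed
qed

lemma l2_inner_self: "l2_inner S m x x = (\<Sum>\<^sub>\<infinity>\<sigma>\<in>S. m \<sigma> * (x \<sigma>)\<^sup>2)"
  by (simp add: l2_inner_def power2_eq_square mult.assoc)

lemma subspace_fun_space: "subspace (fun_space S)"
  by (auto simp: subspace_def fun_space_def)

lemma subspace_l2:
  assumes m: "weight S m"
  shows "subspace (l2_space S m)"
proof (rule subspaceI)
  show "0 \<in> l2_space S m" by (auto simp: l2_space_def fun_space_def)
next
  fix x y assume x: "x \<in> l2_space S m" and y: "y \<in> l2_space S m"
  have "(\<lambda>\<sigma>. m \<sigma> * ((x + y) \<sigma>)\<^sup>2) summable_on S"
  proof (rule summable_on_comparison_test)
    show "(\<lambda>\<sigma>. 2 * (m \<sigma> * (x \<sigma>)\<^sup>2) + 2 * (m \<sigma> * (y \<sigma>)\<^sup>2)) summable_on S"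
      using x y by (intro summable_on_add summable_on_cmult_right) (auto simp: l2_space_def)
    fix \<sigma> assume "\<sigma> \<in> S"
    then have pos: "m \<sigma> > 0" using m by (auto simp: weight_def)
    have "((x + y) \<sigma>)\<^sup>2 \<le> 2 * (x \<sigma>)\<^sup>2 + 2 * (y \<sigma>)\<^sup>2"
      using sum_squares_bound[of "x \<sigma>" "y \<sigma>"] by (simp add: power2_sum)
    then have "m \<sigma> * ((x + y) \<sigma>)\<^sup>2 \<le> m \<sigma> * (2 * (x \<sigma>)\<^sup>2 + 2 * (y \<sigma>)\<^sup>2)"
      using pos by (intro mult_left_mono) auto
    then show "m \<sigma> * ((x + y) \<sigma>)\<^sup>2 \<le> 2 * (m \<sigma> * (x \<sigma>)\<^sup>2) + 2 * (m \<sigma> * (y \<sigma>)\<^sup>2)"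
      by (simp add: algebra_simps)
    show "0 \<le> m \<sigma> * ((x + y) \<sigma>)\<^sup>2" using pos by simp
  qed
  then show "x + y \<in> l2_space S m"
    using x y by (auto simp: l2_space_def intro: subspace_add[OF subspace_fun_space])
next
  fix c x assume x: "x \<in> l2_space S m"
  have "(\<lambda>\<sigma>. c\<^sup>2 * (m \<sigma> * (x \<sigma>)\<^sup>2)) summable_on S"
    using x by (intro summable_on_cmult_right) (auto simp: l2_space_def)
  then show "c *\<^sub>R x \<in> l2_space S m"
    using x by (auto simp: l2_space_def power_mult_distrib mult_ac intro: subspace_scale[OF subspace_fun_space])
qed

text \<open>A Fatou argument. Each coordinate converges because \<open>m \<sigma>\<close> is
  positive. A bound on finite partial sums for \<open>X i - X j\<close> survives the limit in
  \<open>j\<close>, and uniformity in the finite set makes it a bound for the whole series.\<close>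

lemma l2_complete:
  fixes X :: "nat \<Rightarrow> 'v set \<Rightarrow> real"
  assumes m: "weight S m" and X: "\<And>n. X n \<in> l2_space S m"
    and Cauchy: "\<And>e. 0 < e \<Longrightarrow> \<exists>M. \<forall>i\<ge>M. \<forall>j\<ge>M. ip_norm (l2_inner S m) (X i - X j) < e"
  shows "\<exists>x\<in>l2_space S m. (\<lambda>n. ip_norm (l2_inner S m) (X n - x)) \<longlonglongrightarrow> 0"
proof -
  let ?N = "ip_norm (l2_inner S m)"
  have mpos: "m \<sigma> > 0" if "\<sigma> \<in> S" for \<sigma> using m that by (auto simp: weight_def)
  have nn: "0 \<le> m \<sigma> * (x \<sigma>)\<^sup>2" if "\<sigma> \<in> S" for \<sigma> x using mpos[OF that] by simp
  have N2: "(?N x)\<^sup>2 = (\<Sum>\<^sub>\<infinity>\<sigma>\<in>S. m \<sigma> * (x \<sigma>)\<^sup>2)" for x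
    unfolding ip_norm_def l2_inner_self by (intro real_sqrt_pow2 infsum_nonneg nn)
  have N0: "0 \<le> ?N x" for x
    unfolding ip_norm_def l2_inner_self by (intro real_sqrt_ge_zero infsum_nonneg nn)
  have fin_le: "(\<Sum>\<sigma>\<in>F. m \<sigma> * ((X i - X j) \<sigma>)\<^sup>2) \<le> (?N (X i - X j))\<^sup>2"
    if "finite F" "F \<subseteq> S" for F i j
    unfolding N2 using that subspace_diff[OF subspace_l2[OF m] X X]
    by (intro finite_sum_le_infsum nn) (auto simp: l2_space_def)
  have conv: "convergent (\<lambda>n. X n \<sigma>)" for \<sigma>
  proof (cases "\<sigma> \<in> S")
    case False
    then have "X n \<sigma> = 0" for n using X[of n] by (auto simp: l2_space_def fun_space_def)
    then show ?thesis by (simp add: convergent_const)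
  next
    case True
    have "Cauchy (\<lambda>n. X n \<sigma>)"
    proof (rule CauchyI')
      fix e :: real assume e: "e > 0"
      then have "sqrt (m \<sigma>) * e > 0" using mpos[OF True] by simp
      from Cauchy[OF this] obtain M where M: "\<forall>i\<ge>M. \<forall>j\<ge>M. ?N (X i - X j) < sqrt (m \<sigma>) * e" by blast
      have "dist (X i \<sigma>) (X j \<sigma>) < e" if "i \<ge> M" "j > i" for i j
      proof -
        have "m \<sigma> * ((X i - X j) \<sigma>)\<^sup>2 \<le> (?N (X i - X j))\<^sup>2" using fin_le[of "{\<sigma>}" i j] True by simp
        also have "\<dots> < (sqrt (m \<sigma>) * e)\<^sup>2"
          using M that N0 by (intro power_strict_mono) auto
        also have "\<dots> = m \<sigma> * e\<^sup>2" using mpos[OF True] by (simp add: power_mult_distrib)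
        finally have "((X i - X j) \<sigma>)\<^sup>2 < e\<^sup>2" using mpos[OF True] by simp
        then have "\<bar>(X i - X j) \<sigma>\<bar> < e"
          using e by (metis abs_of_pos power2_abs power2_less_imp_less less_imp_le)
        then show ?thesis by (simp add: dist_real_def)
      qed
      then show "\<exists>M. \<forall>i\<ge>M. \<forall>j>i. dist (X i \<sigma>) (X j \<sigma>) < e" by blast
    qed
    then show ?thesis by (simp add: Cauchy_convergent_iff)
  qed
  define z where "z \<sigma> = lim (\<lambda>n. X n \<sigma>)" for \<sigma>
  have lim: "(\<lambda>n. X n \<sigma>) \<longlonglongrightarrow> z \<sigma>" for \<sigma>
    using conv unfolding z_def by (simp add: convergent_LIMSEQ_iff)
  have zF: "z \<in> fun_space S"
  proof (unfold fun_space_def, clarify)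
    fix \<sigma> assume "\<sigma> \<notin> S"
    then have "X n \<sigma> = 0" for n using X[of n] by (auto simp: l2_space_def fun_space_def)
    then show "z \<sigma> = 0" using LIMSEQ_unique[OF lim[of \<sigma>]] by simp
  qed
  have close: "X i - z \<in> l2_space S m \<and> ?N (X i - z) \<le> e"
    if e: "e > 0" and M: "\<forall>i\<ge>M. \<forall>j\<ge>M. ?N (X i - X j) < e" and i: "i \<ge> M" for e M i
  proof -
    have fin: "(\<Sum>\<sigma>\<in>F. m \<sigma> * ((X i - z) \<sigma>)\<^sup>2) \<le> e\<^sup>2" if F: "finite F" "F \<subseteq> S" for F
    proof (rule LIMSEQ_le_const2)
      show "(\<lambda>j. \<Sum>\<sigma>\<in>F. m \<sigma> * ((X i - X j) \<sigma>)\<^sup>2) \<longlonglongrightarrow> (\<Sum>\<sigma>\<in>F. m \<sigma> * ((X i - z) \<sigma>)\<^sup>2)"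
        unfolding minus_apply by (intro tendsto_intros lim)
      have "(\<Sum>\<sigma>\<in>F. m \<sigma> * ((X i - X j) \<sigma>)\<^sup>2) \<le> e\<^sup>2" if "j \<ge> M" for j
        by (rule order_trans[OF fin_le[OF F] power_mono[OF less_imp_le N0]]) (use M i that in auto)
      then show "\<exists>N. \<forall>n\<ge>N. (\<Sum>\<sigma>\<in>F. m \<sigma> * ((X i - X n) \<sigma>)\<^sup>2) \<le> e\<^sup>2" by blast
    qed
    have sm: "(\<lambda>\<sigma>. m \<sigma> * ((X i - z) \<sigma>)\<^sup>2) summable_on S"
    proof (rule nonneg_bdd_above_summable_on[OF nn])
      show "bdd_above (sum (\<lambda>\<sigma>. m \<sigma> * ((X i - z) \<sigma>)\<^sup>2) ` {F. F \<subseteq> S \<and> finite F})"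
        by (rule bdd_aboveI2) (use fin in blast)
    qed
    then have "X i - z \<in> l2_space S m"
      using X[of i] zF by (auto simp: l2_space_def intro: subspace_diff[OF subspace_fun_space])
    moreover have "(?N (X i - z))\<^sup>2 \<le> e\<^sup>2"
      unfolding N2 by (rule infsum_le_finite_sums[OF sm fin])
    then have "?N (X i - z) \<le> e" by (rule power2_le_imp_le) (use e in simp)
    ultimately show ?thesis by simp
  qed
  have zl: "z \<in> l2_space S m"
  proof -
    obtain M where "\<forall>i\<ge>M. \<forall>j\<ge>M. ?N (X i - X j) < 1" using Cauchy[of 1] by auto
    from close[OF _ this, of M] have "X M - z \<in> l2_space S m" by simp
    from subspace_diff[OF subspace_l2[OF m] X[of M] this] show ?thesis by simp
  qed
  moreover have "(\<lambda>n. ?N (X n - z)) \<longlonglongrightarrow> 0"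
  proof (rule LIMSEQ_I)
    fix r :: real assume r: "r > 0"
    then obtain M where M: "\<forall>i\<ge>M. \<forall>j\<ge>M. ?N (X i - X j) < r / 2" using Cauchy[of "r/2"] by auto
    have "norm (?N (X i - z) - 0) < r" if "i \<ge> M" for i
      using close[OF _ M that] r N0[of "X i - z"] by simp
    then show "\<exists>M. \<forall>n\<ge>M. norm (?N (X n - z) - 0) < r" by blast
  qed
  ultimately show ?thesis by blast
qed

lemma hilbert_carrier_l2:
  assumes m: "weight S m"
  shows "hilbert_carrier (l2_space S m) (l2_inner S m)"
proof
  have nn: "0 \<le> m \<sigma> * (x \<sigma>)\<^sup>2" if "\<sigma> \<in> S" for \<sigma> x using m that by (auto simp: weight_def less_imp_le)
  show "subspace (l2_space S m)" by (rule subspace_l2[OF m])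
  show "l2_inner S m x y = l2_inner S m y x" for x y
    by (simp add: l2_inner_def mult_ac)
  show "l2_inner S m (x + y) z = l2_inner S m x z + l2_inner S m y z"
    if "x \<in> l2_space S m" "y \<in> l2_space S m" "z \<in> l2_space S m" for x y z
    unfolding l2_inner_def using that
    by (subst infsum_add[symmetric]) (auto intro: l2_prod_summable[OF m] simp: distrib_left distrib_right)
  show "l2_inner S m (r *\<^sub>R x) y = r * l2_inner S m x y" for r x y
    unfolding l2_inner_def by (subst infsum_cmult_right'[symmetric]) (simp add: mult_ac)
  show "0 \<le> l2_inner S m x x" for x
    unfolding l2_inner_self by (intro infsum_nonneg nn)
  show "x = 0" if x: "x \<in> l2_space S m" and "l2_inner S m x x = 0" for x
  proof
    fix \<sigma>
    show "x \<sigma> = 0 \<sigma>"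
    proof (cases "\<sigma> \<in> S")
      case True
      have "m \<sigma> * (x \<sigma>)\<^sup>2 = 0"
        by (rule nonneg_infsum_le_0D[of "\<lambda>\<sigma>. m \<sigma> * (x \<sigma>)\<^sup>2" S])
           (use that True nn in \<open>auto simp: l2_inner_self l2_space_def\<close>)
      then show ?thesis using True m by (auto simp: weight_def)
    qed (use x in \<open>auto simp: l2_space_def fun_space_def\<close>)
  qed
  show "\<exists>x\<in>l2_space S m. (\<lambda>n. ip_norm (l2_inner S m) (X n - x)) \<longlonglongrightarrow> 0"
    if "\<And>n. X n \<in> l2_space S m"
      "\<And>e. 0 < e \<Longrightarrow> \<exists>M. \<forall>i\<ge>M. \<forall>j\<ge>M. ip_norm (l2_inner S m) (X i - X j) < e" for X
    by (rule l2_complete[OF m that])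
qed

lemma subspace_fin_supp: "subspace (fin_supp S)"
proof (rule subspaceI)
  show "0 \<in> fin_supp S" by (auto simp: fin_supp_def fun_space_def)
  show "x + y \<in> fin_supp S" if "x \<in> fin_supp S" "y \<in> fin_supp S" for x y
    using that by (auto simp: fin_supp_def fun_space_def
      intro: finite_subset[of _ "{\<tau>. x \<tau> \<noteq> 0} \<union> {\<tau>. y \<tau> \<noteq> 0}"])
  show "c *\<^sub>R x \<in> fin_supp S" if "x \<in> fin_supp S" for c x
    using that by (auto simp: fin_supp_def fun_space_def intro: rev_finite_subset)
qed

lemma fin_supp_subset_l2: "fin_supp S \<subseteq> l2_space S m"
  unfolding fin_supp_def l2_space_def
  by (auto intro!: finite_nonzero_values_imp_summable_on elim!: rev_finite_subset)

lemma restrict_in_fin_supp: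
  assumes "finite F" "F \<subseteq> S"
  shows "(\<lambda>\<sigma>. if \<sigma> \<in> F then x \<sigma> else 0) \<in> fin_supp S"
  using assms by (auto simp: fin_supp_def fun_space_def intro: rev_finite_subset)

lemma l2_inner_fin_supp:
  assumes "finite F" "F \<subseteq> S" "\<And>\<sigma>. \<sigma> \<notin> F \<Longrightarrow> x \<sigma> = 0"
  shows "l2_inner S m x y = (\<Sum>\<sigma>\<in>F. m \<sigma> * x \<sigma> * y \<sigma>)"
  unfolding l2_inner_def
  by (subst infsum_finite[OF assms(1), symmetric], rule infsum_cong_neutral) (use assms in auto)

text \<open>The truncation \<open>y\<close> agrees with \<open>x\<close> on its support, so
  \<open>y\<close> has the same inner product with \<open>x\<close> as with itself, and the squared
  error is the tail of the norm series.\<close>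

lemma dense_fin_supp:
  assumes m: "weight S m"
  shows "dense_subset (l2_space S m) (l2_inner S m) (fin_supp S)"
  unfolding dense_subset_def
proof (intro conjI ballI allI impI fin_supp_subset_l2)
  fix x and e :: real assume x: "x \<in> l2_space S m" and e: "e > 0"
  have "((\<lambda>\<sigma>. m \<sigma> * (x \<sigma>)\<^sup>2) has_sum l2_inner S m x x) S"
    using x unfolding l2_inner_self by (auto simp: l2_space_def)
  from has_sum_finite_approximation[OF this, of "e\<^sup>2 / 2"] e
  obtain F where F: "finite F" "F \<subseteq> S" "dist (\<Sum>\<sigma>\<in>F. m \<sigma> * (x \<sigma>)\<^sup>2) (l2_inner S m x x) \<le> e\<^sup>2 / 2"
    by auto
  define y where "y = (\<lambda>\<sigma>. if \<sigma> \<in> F then x \<sigma> else 0)"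
  have y: "y \<in> fin_supp S" unfolding y_def by (rule restrict_in_fin_supp[OF F(1,2)])
  then have yl: "y \<in> l2_space S m" using fin_supp_subset_l2 by blast
  interpret hilbert_carrier "l2_space S m" "l2_inner S m" by (rule hilbert_carrier_l2[OF m])
  have "l2_inner S m y z = (\<Sum>\<sigma>\<in>F. m \<sigma> * y \<sigma> * z \<sigma>)" for z
    by (rule l2_inner_fin_supp[OF F(1,2)]) (simp add: y_def)
  then have "l2_inner S m y x = (\<Sum>\<sigma>\<in>F. m \<sigma> * (x \<sigma>)\<^sup>2)" "l2_inner S m y y = (\<Sum>\<sigma>\<in>F. m \<sigma> * (x \<sigma>)\<^sup>2)"
    by (simp_all add: y_def power2_eq_square mult.assoc)
  then have "(nrm (x - y))\<^sup>2 = l2_inner S m x x - (\<Sum>\<sigma>\<in>F. m \<sigma> * (x \<sigma>)\<^sup>2)"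
    using x yl by (simp add: nrm_power2 ip_algebra ip_commute[of x y])
  also have "\<dots> < e\<^sup>2" using F(3) zero_less_power[OF e, of 2] unfolding dist_real_def by linarith
  finally have "nrm (x - y) < e" using e by (simp add: power2_less_imp_less)
  then show "\<exists>y\<in>fin_supp S. nrm (x - y) < e" using y by blast
qed

text \<open>On the right, the whole factor \<open>(\<eta> \<tau>)\<^sup>2\<close> sits in one
  argument. Symmetry of \<open>L\<close> shares it between both; the form at \<open>\<eta> u\<close>
  that splits off is dropped by \<open>psd\<close>. Diagonal terms of the error vanish, so only
  off-diagonal entries of \<open>L\<close> have to be computed later.\<close>

lemma form_cutoff_lower_bound:
  fixes L :: "'a \<Rightarrow> 'a \<Rightarrow> real"
  assumes "finite F"
    and sym: "\<And>\<tau> \<tau>'. \<tau> \<in> F \<Longrightarrow> \<tau>' \<in> F \<Longrightarrow> L \<tau> \<tau>' = L \<tau>' \<tau>"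
    and psd: "\<And>\<phi>. 0 \<le> (\<Sum>\<tau>\<in>F. \<Sum>\<tau>'\<in>F. L \<tau> \<tau>' * \<phi> \<tau> * \<phi> \<tau>')"
  shows "- (\<Sum>\<tau>\<in>F. \<Sum>\<tau>'\<in>F. \<bar>L \<tau> \<tau>'\<bar> * \<bar>u \<tau>\<bar> * \<bar>u \<tau>'\<bar> * (\<eta> \<tau> - \<eta> \<tau>')\<^sup>2) / 2
    \<le> (\<Sum>\<tau>\<in>F. \<Sum>\<tau>'\<in>F. L \<tau> \<tau>' * ((\<eta> \<tau>)\<^sup>2 * u \<tau>) * u \<tau>')"
proof -
  let ?A = "\<Sum>\<tau>\<in>F. \<Sum>\<tau>'\<in>F. L \<tau> \<tau>' * ((\<eta> \<tau>)\<^sup>2 * u \<tau>) * u \<tau>'"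
  let ?P = "\<Sum>\<tau>\<in>F. \<Sum>\<tau>'\<in>F. L \<tau> \<tau>' * (\<eta> \<tau> * u \<tau>) * (\<eta> \<tau>' * u \<tau>')"
  let ?E = "\<Sum>\<tau>\<in>F. \<Sum>\<tau>'\<in>F. L \<tau> \<tau>' * u \<tau> * u \<tau>' * (\<eta> \<tau> - \<eta> \<tau>')\<^sup>2"
  have "?A = (\<Sum>\<tau>\<in>F. \<Sum>\<tau>'\<in>F. L \<tau>' \<tau> * ((\<eta> \<tau>')\<^sup>2 * u \<tau>') * u \<tau>)"
    by (rule sum.swap)
  also have "\<dots> = (\<Sum>\<tau>\<in>F. \<Sum>\<tau>'\<in>F. L \<tau> \<tau>' * ((\<eta> \<tau>')\<^sup>2 * u \<tau>') * u \<tau>)"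
    by (intro sum.cong refl) (simp add: sym)
  finally have "2 * ?A = ?A + (\<Sum>\<tau>\<in>F. \<Sum>\<tau>'\<in>F. L \<tau> \<tau>' * ((\<eta> \<tau>')\<^sup>2 * u \<tau>') * u \<tau>)" by simp
  also have "\<dots> = 2 * ?P + ?E"
    unfolding sum_distrib_left sum.distrib[symmetric]
    by (intro sum.cong refl) (simp add: power2_eq_square algebra_simps)
  finally have "2 * ?A = 2 * ?P + ?E" .
  moreover have "0 \<le> ?P" by (rule psd)
  moreover have "- ?E \<le> (\<Sum>\<tau>\<in>F. \<Sum>\<tau>'\<in>F. \<bar>L \<tau> \<tau>'\<bar> * \<bar>u \<tau>\<bar> * \<bar>u \<tau>'\<bar> * (\<eta> \<tau> - \<eta> \<tau>')\<^sup>2)"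
    unfolding sum_negf[symmetric]
  proof (intro sum_mono)
    fix \<tau> \<tau>'
    have "- (L \<tau> \<tau>' * u \<tau> * u \<tau>' * (\<eta> \<tau> - \<eta> \<tau>')\<^sup>2) \<le> \<bar>L \<tau> \<tau>' * u \<tau> * u \<tau>' * (\<eta> \<tau> - \<eta> \<tau>')\<^sup>2\<bar>"
      by linarith
    then show "- (L \<tau> \<tau>' * u \<tau> * u \<tau>' * (\<eta> \<tau> - \<eta> \<tau>')\<^sup>2)
        \<le> \<bar>L \<tau> \<tau>'\<bar> * \<bar>u \<tau>\<bar> * \<bar>u \<tau>'\<bar> * (\<eta> \<tau> - \<eta> \<tau>')\<^sup>2"
      by (simp add: abs_mult)
  qed
  ultimately show ?thesis by linarith
qed

text \<open>Testing \<open>T\<^sup>* u = - u\<close> against \<open>\<eta>\<^sup>2 u\<close> bounds \<open>\<parallel>\<eta> u\<parallel>\<^sup>2\<close> by the commutator error of the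
  cutoff \<open>\<eta>\<close>. Since \<open>T (\<eta>\<^sup>2 u)\<close> lies in \<open>\<ell>\<^sup>2\<close>, the pairing with \<open>u\<close> is a limit of finite sums,
  so only finite sections of the matrix occur.\<close>

theorem matrix_operator_essentially_self_adjoint:
  assumes m: "weight S m" and T: "T \<in> fin_supp S \<rightarrow> l2_space S m"
    and kernel: "\<And>\<phi> F \<tau>'. \<lbrakk>finite F; F \<subseteq> S; \<And>\<sigma>. \<sigma> \<notin> F \<Longrightarrow> \<phi> \<sigma> = 0; \<tau>' \<in> S\<rbrakk>
      \<Longrightarrow> m \<tau>' * T \<phi> \<tau>' = (\<Sum>\<tau>\<in>F. \<phi> \<tau> * L \<tau> \<tau>')"
    and sym: "\<And>\<tau> \<tau>'. \<tau> \<in> S \<Longrightarrow> \<tau>' \<in> S \<Longrightarrow> L \<tau> \<tau>' = L \<tau>' \<tau>"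
    and psd: "\<And>F \<phi>. finite F \<Longrightarrow> F \<subseteq> S \<Longrightarrow> 0 \<le> (\<Sum>\<tau>\<in>F. \<Sum>\<tau>'\<in>F. L \<tau> \<tau>' * \<phi> \<tau> * \<phi> \<tau>')"
    and cutoff: "\<And>u \<tau>0 e. \<lbrakk>u \<in> l2_space S m; \<tau>0 \<in> S; e > 0\<rbrakk> \<Longrightarrow>
      \<exists>\<eta>. \<eta> \<tau>0 = 1 \<and> finite {\<tau>\<in>S. \<eta> \<tau> \<noteq> 0} \<and> (\<forall>F. finite F \<longrightarrow> F \<subseteq> S \<longrightarrow>
        (\<Sum>\<tau>\<in>F. \<Sum>\<tau>'\<in>F. \<bar>L \<tau> \<tau>'\<bar> * \<bar>u \<tau>\<bar> * \<bar>u \<tau>'\<bar> * (\<eta> \<tau> - \<eta> \<tau>')\<^sup>2) \<le> e)"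
  shows "essentially_self_adjoint (l2_space S m) (l2_inner S m) (fin_supp S) T"
proof -
  interpret hilbert_carrier "l2_space S m" "l2_inner S m" by (rule hilbert_carrier_l2[OF m])
  have mpos: "m \<sigma> > 0" if "\<sigma> \<in> S" for \<sigma> using m that by (auto simp: weight_def)
  have supp: "finite {\<sigma>. \<phi> \<sigma> \<noteq> 0}" "{\<sigma>. \<phi> \<sigma> \<noteq> 0} \<subseteq> S" if "\<phi> \<in> fin_supp S" for \<phi>
    using that by (auto simp: fin_supp_def fun_space_def)
  have Tz: "T \<phi> \<sigma> = 0" if "\<phi> \<in> fin_supp S" "\<sigma> \<notin> S" for \<phi> \<sigma>
    using T that by (auto simp: l2_space_def fun_space_def)
  have T_eqI: "T \<phi> = \<psi>" if "\<phi> \<in> fin_supp S" "\<And>\<sigma>. \<sigma> \<notin> S \<Longrightarrow> \<psi> \<sigma> = 0"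
    "\<And>\<sigma>. \<sigma> \<in> S \<Longrightarrow> m \<sigma> * T \<phi> \<sigma> = m \<sigma> * \<psi> \<sigma>" for \<phi> \<psi>
  proof
    show "T \<phi> \<sigma> = \<psi> \<sigma>" for \<sigma>
      using that(2,3)[of \<sigma>] Tz[OF that(1), of \<sigma>] mpos[of \<sigma>] by (cases "\<sigma> \<in> S") auto
  qed
  have form: "l2_inner S m (T \<phi>) \<psi> = (\<Sum>\<tau>\<in>F. \<Sum>\<tau>'\<in>F. L \<tau> \<tau>' * \<phi> \<tau> * \<psi> \<tau>')"
    if "finite F" "F \<subseteq> S" "\<And>\<sigma>. \<sigma> \<notin> F \<Longrightarrow> \<phi> \<sigma> = 0" "\<And>\<sigma>. \<sigma> \<notin> F \<Longrightarrow> \<psi> \<sigma> = 0" for F \<phi> \<psi>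
  proof -
    have "l2_inner S m (T \<phi>) \<psi> = (\<Sum>\<tau>'\<in>F. m \<tau>' * \<psi> \<tau>' * T \<phi> \<tau>')"
      unfolding ip_commute[of "T \<phi>"] by (rule l2_inner_fin_supp[OF that(1,2,4)])
    also have "\<dots> = (\<Sum>\<tau>'\<in>F. \<psi> \<tau>' * (\<Sum>\<tau>\<in>F. \<phi> \<tau> * L \<tau> \<tau>'))"
      using that(2) by (intro sum.cong refl) (auto simp flip: kernel[of F \<phi>, OF that(1-3)])
    also have "\<dots> = (\<Sum>\<tau>'\<in>F. \<Sum>\<tau>\<in>F. L \<tau> \<tau>' * \<phi> \<tau> * \<psi> \<tau>')"
      by (simp add: sum_distrib_left mult_ac)
    also have "\<dots> = (\<Sum>\<tau>\<in>F. \<Sum>\<tau>'\<in>F. L \<tau> \<tau>' * \<phi> \<tau> * \<psi> \<tau>')"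
      by (rule sum.swap)
    finally show ?thesis .
  qed
  show ?thesis
  proof (rule essentially_self_adjointI[OF subspace_fin_supp dense_fin_supp[OF m] T])
    fix x y assume x: "x \<in> fin_supp S" and y: "y \<in> fin_supp S"
    define F where "F = {\<sigma>. x \<sigma> \<noteq> 0} \<union> {\<sigma>. y \<sigma> \<noteq> 0}"
    have F: "finite F" "F \<subseteq> S" using supp x y by (auto simp: F_def)
    have out: "\<And>\<sigma>. \<sigma> \<notin> F \<Longrightarrow> x \<sigma> = 0" "\<And>\<sigma>. \<sigma> \<notin> F \<Longrightarrow> y \<sigma> = 0" "\<And>\<sigma>. \<sigma> \<notin> F \<Longrightarrow> (x + y) \<sigma> = 0"
      by (auto simp: F_def)
    show "T (x + y) = T x + T y"
    proof (rule T_eqI)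
      show "x + y \<in> fin_supp S" using x y subspace_add[OF subspace_fin_supp] by blast
      show "m \<sigma> * T (x + y) \<sigma> = m \<sigma> * (T x + T y) \<sigma>" if "\<sigma> \<in> S" for \<sigma>
        using kernel[of F x, OF F out(1) that] kernel[of F y, OF F out(2) that] kernel[of F "x + y", OF F out(3) that]
        by (simp add: algebra_simps sum.distrib)
    qed (simp add: Tz x y)
    have "l2_inner S m (T x) y = (\<Sum>\<tau>\<in>F. \<Sum>\<tau>'\<in>F. L \<tau> \<tau>' * x \<tau> * y \<tau>')"
      by (rule form[of F x y, OF F out(1,2)])
    also have "\<dots> = (\<Sum>\<tau>'\<in>F. \<Sum>\<tau>\<in>F. L \<tau> \<tau>' * x \<tau> * y \<tau>')"
      by (rule sum.swap)
    also have "\<dots> = (\<Sum>\<tau>'\<in>F. \<Sum>\<tau>\<in>F. L \<tau>' \<tau> * y \<tau>' * x \<tau>)"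
    proof (intro sum.cong refl)
      fix \<tau>' \<tau> assume "\<tau>' \<in> F" "\<tau> \<in> F"
      then have "L \<tau> \<tau>' = L \<tau>' \<tau>" using sym F by blast
      then show "L \<tau> \<tau>' * x \<tau> * y \<tau>' = L \<tau>' \<tau> * y \<tau>' * x \<tau>" by simp
    qed
    also have "\<dots> = l2_inner S m (T y) x"
      by (rule form[of F y x, OF F out(2,1), symmetric])
    finally show "l2_inner S m (T x) y = l2_inner S m x (T y)" by (simp add: ip_commute)
  next
    fix r x assume x: "x \<in> fin_supp S"
    have out: "\<And>\<sigma>. \<sigma> \<notin> {\<sigma>. x \<sigma> \<noteq> 0} \<Longrightarrow> x \<sigma> = 0" "\<And>\<sigma>. \<sigma> \<notin> {\<sigma>. x \<sigma> \<noteq> 0} \<Longrightarrow> (r *\<^sub>R x) \<sigma> = 0"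
      by auto
    show "T (r *\<^sub>R x) = r *\<^sub>R T x"
    proof (rule T_eqI)
      show "r *\<^sub>R x \<in> fin_supp S" using x subspace_scale[OF subspace_fin_supp] by blast
      show "m \<sigma> * T (r *\<^sub>R x) \<sigma> = m \<sigma> * (r *\<^sub>R T x) \<sigma>" if "\<sigma> \<in> S" for \<sigma>
        using kernel[of "{\<sigma>. x \<sigma> \<noteq> 0}" x, OF supp[OF x] out(1) that]
          kernel[of "{\<sigma>. x \<sigma> \<noteq> 0}" "r *\<^sub>R x", OF supp[OF x] out(2) that]
        by (simp add: sum_distrib_left mult_ac)
    qed (simp add: Tz x)
    show "0 \<le> l2_inner S m (T x) x"
    proof -
      have "l2_inner S m (T x) x = (\<Sum>\<tau>\<in>{\<sigma>. x \<sigma> \<noteq> 0}. \<Sum>\<tau>'\<in>{\<sigma>. x \<sigma> \<noteq> 0}. L \<tau> \<tau>' * x \<tau> * x \<tau>')"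
        by (rule form[OF supp[OF x]]) auto
      then show ?thesis using psd[OF supp[OF x]] by simp
    qed
  next
    fix u assume u: "u \<in> l2_space S m" and def: "\<And>x. x \<in> fin_supp S \<Longrightarrow> l2_inner S m (T x) u = - l2_inner S m x u"
    show "u = 0"
    proof
      fix \<tau>0
      show "u \<tau>0 = 0 \<tau>0"
      proof (cases "\<tau>0 \<in> S")
        case False
        then show ?thesis using u by (simp add: l2_space_def fun_space_def)
      next
        case True
        \<comment> \<open>Of the squared norm of \<open>\<eta> u\<close> only the term at
          \<open>\<tau>0\<close> is kept, where \<open>\<eta>\<close> is 1. The cutoff may depend on
          \<open>\<tau>0\<close> and \<open>e\<close>, so no limit of cutoffs is taken.\<close>
        have "m \<tau>0 * (u \<tau>0)\<^sup>2 \<le> e" if e: "e > 0" for e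
        proof -
          obtain \<eta> where \<eta>: "\<eta> \<tau>0 = 1" "finite {\<tau>\<in>S. \<eta> \<tau> \<noteq> 0}"
            and err: "\<And>F. finite F \<Longrightarrow> F \<subseteq> S \<Longrightarrow>
              (\<Sum>\<tau>\<in>F. \<Sum>\<tau>'\<in>F. \<bar>L \<tau> \<tau>'\<bar> * \<bar>u \<tau>\<bar> * \<bar>u \<tau>'\<bar> * (\<eta> \<tau> - \<eta> \<tau>')\<^sup>2) \<le> e"
            using cutoff[OF u True e] by blast
          define N where "N = {\<tau>\<in>S. \<eta> \<tau> \<noteq> 0}"
          define \<phi> where "\<phi> = (\<lambda>\<tau>. (\<eta> \<tau>)\<^sup>2 * u \<tau>)"
          have N: "finite N" "N \<subseteq> S" "\<tau>0 \<in> N" using \<eta> True by (auto simp: N_def)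
          have out: "\<phi> \<sigma> = 0" if "\<sigma> \<notin> N" for \<sigma>
            using that u by (auto simp: \<phi>_def N_def l2_space_def fun_space_def)
          have \<phi>: "\<phi> \<in> fin_supp S"
            using out N by (auto simp: fin_supp_def fun_space_def intro: rev_finite_subset[of N])
          have T\<phi>: "T \<phi> \<in> l2_space S m" using T \<phi> by blast
          have "m \<tau>0 * (u \<tau>0)\<^sup>2 = m \<tau>0 * \<phi> \<tau>0 * u \<tau>0"
            by (simp add: \<phi>_def \<eta> power2_eq_square)
          also have "\<dots> \<le> (\<Sum>\<tau>\<in>N. m \<tau> * \<phi> \<tau> * u \<tau>)"
          proof (rule member_le_sum[OF N(3) _ N(1)])
            fix \<tau> assume "\<tau> \<in> N - {\<tau>0}"
            then have "m \<tau> > 0" using mpos N by auto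
            then have "0 \<le> m \<tau> * ((\<eta> \<tau>)\<^sup>2 * (u \<tau>)\<^sup>2)" by simp
            then show "0 \<le> m \<tau> * \<phi> \<tau> * u \<tau>" by (simp add: \<phi>_def power2_eq_square mult_ac)
          qed
          also have "\<dots> = l2_inner S m \<phi> u"
            by (rule l2_inner_fin_supp[OF N(1,2) out, symmetric])
          also have "\<dots> = - l2_inner S m (T \<phi>) u" using def[OF \<phi>] by simp
          also have "- l2_inner S m (T \<phi>) u \<le> e"
          proof -
            have lim: "((\<lambda>F. \<Sum>\<tau>\<in>F. m \<tau> * T \<phi> \<tau> * u \<tau>) \<longlongrightarrow> l2_inner S m (T \<phi>) u) (finite_subsets_at_top S)"
              using has_sum_infsum[OF l2_prod_summable[OF m T\<phi> u]]
              unfolding has_sum_def l2_inner_def .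
            \<comment> \<open>For finite \<open>F\<close> containing \<open>N\<close>,
              \<open>kernel\<close> may sum over \<open>F\<close> itself, so both indices range over
              the same set and the section is square, as \<open>psd\<close> requires. Such
              \<open>F\<close> are eventually all finite subsets.\<close>
            have "- e \<le> (\<Sum>\<tau>'\<in>F. m \<tau>' * T \<phi> \<tau>' * u \<tau>')" if F: "finite F" "F \<subseteq> S" "N \<subseteq> F" for F
            proof -
              have "(\<Sum>\<tau>'\<in>F. m \<tau>' * T \<phi> \<tau>' * u \<tau>') = (\<Sum>\<tau>'\<in>F. (\<Sum>\<tau>\<in>F. \<phi> \<tau> * L \<tau> \<tau>') * u \<tau>')"
                using F out by (intro sum.cong refl, subst kernel[of F \<phi>]) auto
              also have "\<dots> = (\<Sum>\<tau>'\<in>F. \<Sum>\<tau>\<in>F. L \<tau> \<tau>' * ((\<eta> \<tau>)\<^sup>2 * u \<tau>) * u \<tau>')"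
                by (simp add: \<phi>_def sum_distrib_left mult_ac)
              also have "\<dots> = (\<Sum>\<tau>\<in>F. \<Sum>\<tau>'\<in>F. L \<tau> \<tau>' * ((\<eta> \<tau>)\<^sup>2 * u \<tau>) * u \<tau>')"
                by (rule sum.swap)
              also have "\<dots> \<ge> - (\<Sum>\<tau>\<in>F. \<Sum>\<tau>'\<in>F. \<bar>L \<tau> \<tau>'\<bar> * \<bar>u \<tau>\<bar> * \<bar>u \<tau>'\<bar> * (\<eta> \<tau> - \<eta> \<tau>')\<^sup>2) / 2"
                by (intro form_cutoff_lower_bound F psd sym) (use F in auto)
              finally show ?thesis using err[OF F(1,2)] e by linarith
            qed
            then have "- e \<le> l2_inner S m (T \<phi>) u"
              by (intro tendsto_lowerbound[OF lim] finite_subsets_at_top_neq_bot)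
                 (use N in \<open>auto simp: eventually_finite_subsets_at_top\<close>)
            then show ?thesis by linarith
          qed
          finally show ?thesis .
        qed
        then have "m \<tau>0 * (u \<tau>0)\<^sup>2 \<le> 0" by (rule dense_ge)
        then show ?thesis using mpos[OF True] by (simp add: mult_le_0_iff)
      qed
    qed
  qed
qed


section \<open>Matrices of the Laplacians\<close>

lemma has_sum_sum:
  fixes f :: "'i \<Rightarrow> 'a \<Rightarrow> 'b::topological_comm_monoid_add"
  assumes "\<And>i. i \<in> I \<Longrightarrow> (f i has_sum s i) A"
  shows "((\<lambda>x. \<Sum>i\<in>I. f i x) has_sum (\<Sum>i\<in>I. s i)) A"
  using assms by (induction I rule: infinite_finite_induct) (auto intro: has_sum_add)

lemma sum_fun_apply: "(\<Sum>i\<in>I. f i) x = (\<Sum>i\<in>I. f i x)"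
  for f :: "'i \<Rightarrow> 'a \<Rightarrow> 'b::comm_monoid_add"
  by (induction I rule: infinite_finite_induct) auto

lemma faceD: "face S \<tau> \<sigma> \<Longrightarrow> \<tau> \<in> S \<and> \<sigma> \<in> S \<and> \<tau> \<subseteq> \<sigma>"
  by (simp add: face_def)

lemma face_insertE:
  assumes "face S \<tau> \<sigma>"
  obtains x where "x \<notin> \<tau>" "\<sigma> = insert x \<tau>"
proof -
  obtain x where "\<sigma> - \<tau> = {x}" using assms by (auto simp: face_def card_1_singleton_iff)
  then have "x \<notin> \<tau>" "\<sigma> = insert x \<tau>" using faceD[OF assms] by auto
  then show ?thesis by (rule that)
qed

text \<open>The vertex that \<open>\<sigma>\<close> adds to one facet must belong to the other, as
  otherwise the facets coincide. Coupled simplices thus exchange a single vertex over their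
  intersection, the situation of \<open>simplex_cutoff_diff\<close>.\<close>

lemma common_cofaceE:
  assumes "face S \<tau> \<sigma>" "face S \<tau>' \<sigma>" "\<tau> \<noteq> \<tau>'"
  obtains x x' where "\<tau> = insert x (\<tau> \<inter> \<tau>')" "\<tau>' = insert x' (\<tau> \<inter> \<tau>')" "x \<noteq> x'" "\<sigma> = \<tau> \<union> \<tau>'"
    "x \<in> \<tau>" "x' \<in> \<tau>'"
proof -
  obtain x' where x': "x' \<notin> \<tau>" "\<sigma> = insert x' \<tau>" using assms(1) by (rule face_insertE)
  obtain x where x: "x \<notin> \<tau>'" "\<sigma> = insert x \<tau>'" using assms(2) by (rule face_insertE)
  have neq: "x \<noteq> x'" using x x' assms(3) by (metis insert_ident)
  have sub: "\<tau> \<subseteq> insert x \<tau>'" "\<tau>' \<subseteq> insert x' \<tau>" "x \<in> insert x' \<tau>" "x' \<in> insert x \<tau>'"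
    using x(2) x'(2) by blast+
  have mem: "x \<in> \<tau>" "x' \<in> \<tau>'" using sub(3,4) neq by auto
  show ?thesis
  proof (rule that[of x x'])
    show "\<tau> = insert x (\<tau> \<inter> \<tau>')" using sub(1) mem by blast
    show "\<tau>' = insert x' (\<tau> \<inter> \<tau>')" using sub(2) mem by blast
    show "\<sigma> = \<tau> \<union> \<tau>'" using x'(2) mem sub(2) by blast
  qed (fact neq mem)+
qed

lemma common_faceE:
  assumes "face S \<rho> \<tau>" "face S \<rho> \<tau>'" "\<tau> \<noteq> \<tau>'"
  obtains x x' where "\<tau> = insert x (\<tau> \<inter> \<tau>')" "\<tau>' = insert x' (\<tau> \<inter> \<tau>')" "x \<noteq> x'" "\<rho> = \<tau> \<inter> \<tau>'"
    "x \<in> \<tau>" "x' \<in> \<tau>'"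
proof -
  obtain x where x: "x \<notin> \<rho>" "\<tau> = insert x \<rho>" using assms(1) by (rule face_insertE)
  obtain x' where x': "x' \<notin> \<rho>" "\<tau>' = insert x' \<rho>" using assms(2) by (rule face_insertE)
  have neq: "x \<noteq> x'" using x x' assms(3) by auto
  have "\<rho> = \<tau> \<inter> \<tau>'" using x x' neq by auto
  then show ?thesis using x x' neq by (intro that[of x x']) simp_all
qed

text \<open>\<open>subsimplex\<close> leaves out the empty face because the reduced complex may have
  lost it.\<close>

locale weighted_complex =
  fixes S :: "'v set set" and m :: "'v set \<Rightarrow> real" and \<delta> :: "'v fun_op"
  assumes finite_simplex: "\<tau> \<in> S \<Longrightarrow> finite \<tau>"
    and subsimplex: "\<lbrakk>\<tau> \<in> S; \<rho> \<subseteq> \<tau>; \<rho> \<noteq> {}\<rbrakk> \<Longrightarrow> \<rho> \<in> S"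
    and weight: "weight S m"
    and coboundary: "coboundary_operator S \<delta>"
    and locally_summable: "locally_summable S m"
begin

lemma m_pos: "\<tau> \<in> S \<Longrightarrow> m \<tau> > 0"
  using weight by (simp add: weight_def)

lemma m_nonneg: "\<tau> \<in> S \<Longrightarrow> m \<tau> \<ge> 0"
  using m_pos by force

lemma finite_faces: "\<sigma> \<in> S \<Longrightarrow> finite {\<tau>. face S \<tau> \<sigma>}"
  using finite_simplex by (auto simp: face_def intro: finite_subset[of _ "Pow \<sigma>"])

abbreviation "\<theta> \<equiv> theta \<delta>"

lemma theta_cases:
  assumes "\<tau> \<in> S" "\<sigma> \<in> S"
  shows "\<theta> \<tau> \<sigma> \<in> {-1, 0, 1}" "\<theta> \<tau> \<sigma> \<noteq> 0 \<longleftrightarrow> face S \<tau> \<sigma>"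
  using coboundary assms unfolding coboundary_operator_def by blast+

lemma theta_eq_0: "\<lbrakk>\<tau> \<in> S; \<sigma> \<in> S; \<not> face S \<tau> \<sigma>\<rbrakk> \<Longrightarrow> \<theta> \<tau> \<sigma> = 0"
  using theta_cases(2) by blast

lemma abs_theta: "\<lbrakk>\<tau> \<in> S; \<sigma> \<in> S\<rbrakk> \<Longrightarrow> \<bar>\<theta> \<tau> \<sigma>\<bar> = (if face S \<tau> \<sigma> then 1 else 0)"
  using theta_cases[of \<tau> \<sigma>] by auto

lemma indicator_in_fun_space: "\<tau> \<in> S \<Longrightarrow> indicator {\<tau>} \<in> fun_space S"
  by (auto simp: fun_space_def indicator_def)

lemma \<delta>_fun_space: "\<omega> \<in> fun_space S \<Longrightarrow> \<delta> \<omega> \<in> fun_space S"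
  using coboundary unfolding coboundary_operator_def by blast

lemma \<delta>_add: "\<lbrakk>\<omega> \<in> fun_space S; \<eta> \<in> fun_space S\<rbrakk> \<Longrightarrow> \<delta> (\<omega> + \<eta>) = \<delta> \<omega> + \<delta> \<eta>"
  using coboundary unfolding coboundary_operator_def plus_fun_def by blast

lemma \<delta>_\<delta>: "\<omega> \<in> fun_space S \<Longrightarrow> \<delta> (\<delta> \<omega>) = 0"
  using coboundary unfolding coboundary_operator_def zero_fun_def by blast

lemma \<delta>_apply: "\<lbrakk>\<omega> \<in> fun_space S; \<sigma> \<in> S\<rbrakk> \<Longrightarrow> \<delta> \<omega> \<sigma> = (\<Sum>\<tau> | face S \<tau> \<sigma>. \<omega> \<tau> * \<theta> \<tau> \<sigma>)"
  using coboundary unfolding coboundary_operator_def by blast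

lemma theta_fun_space: "\<tau> \<in> S \<Longrightarrow> \<theta> \<tau> \<in> fun_space S"
  using \<delta>_fun_space[OF indicator_in_fun_space] by (simp add: theta_def[abs_def])

lemma \<delta>_apply_finite:
  assumes F: "finite F" "F \<subseteq> S" "\<And>\<tau>. \<tau> \<notin> F \<Longrightarrow> \<omega> \<tau> = 0" and \<sigma>: "\<sigma> \<in> S"
  shows "\<delta> \<omega> \<sigma> = (\<Sum>\<tau>\<in>F. \<omega> \<tau> * \<theta> \<tau> \<sigma>)"
proof -
  have "\<omega> \<in> fun_space S" using F by (auto simp: fun_space_def)
  then have "\<delta> \<omega> \<sigma> = (\<Sum>\<tau> | face S \<tau> \<sigma>. \<omega> \<tau> * \<theta> \<tau> \<sigma>)" by (rule \<delta>_apply[OF _ \<sigma>])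
  also have "\<dots> = (\<Sum>\<tau>\<in>F. \<omega> \<tau> * \<theta> \<tau> \<sigma>)"
  proof (rule sum.mono_neutral_cong[OF F(1) finite_faces[OF \<sigma>]])
    show "\<omega> \<tau> * \<theta> \<tau> \<sigma> = 0" if "\<tau> \<in> F - {\<tau>. face S \<tau> \<sigma>}" for \<tau>
      using theta_eq_0[of \<tau> \<sigma>] that F \<sigma> by auto
  qed (use F in auto)
  finally show ?thesis .
qed

lemma \<delta>_fin_supp_eq:
  assumes F: "finite F" "F \<subseteq> S" "\<And>\<tau>. \<tau> \<notin> F \<Longrightarrow> \<omega> \<tau> = 0"
  shows "\<delta> \<omega> = (\<Sum>\<tau>\<in>F. \<omega> \<tau> *\<^sub>R \<theta> \<tau>)"
proof
  fix \<sigma>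
  have "\<omega> \<in> fun_space S" using F by (auto simp: fun_space_def)
  then have "\<delta> \<omega> \<sigma> = 0" if "\<sigma> \<notin> S" using \<delta>_fun_space that by (auto simp: fun_space_def)
  moreover have "\<theta> \<tau> \<sigma> = 0" if "\<sigma> \<notin> S" "\<tau> \<in> F" for \<tau>
    using theta_fun_space[of \<tau>] F that by (auto simp: fun_space_def)
  ultimately show "\<delta> \<omega> \<sigma> = (\<Sum>\<tau>\<in>F. \<omega> \<tau> *\<^sub>R \<theta> \<tau>) \<sigma>"
    using \<delta>_apply_finite[of F \<omega> \<sigma>, OF F] by (cases "\<sigma> \<in> S") (auto simp: sum_fun_apply)
qed

lemma cofaces_summable: "\<tau> \<in> S \<Longrightarrow> m summable_on {\<sigma>. face S \<tau> \<sigma>}"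
  using locally_summable by (simp add: locally_summable_def)

text \<open>The factor \<open>\<theta> \<tau> \<sigma>\<close> confines the sum to the cofaces of
  \<open>\<tau>\<close>, where each term is dominated by \<open>m \<sigma>\<close>; local
  summability applies.\<close>

lemma theta_summable:
  assumes "\<tau> \<in> S" "\<tau>' \<in> S"
  shows "(\<lambda>\<sigma>. m \<sigma> * \<theta> \<tau> \<sigma> * \<theta> \<tau>' \<sigma>) summable_on S"
proof -
  have "(\<lambda>\<sigma>. m \<sigma> * \<theta> \<tau> \<sigma> * \<theta> \<tau>' \<sigma>) summable_on {\<sigma>. face S \<tau> \<sigma>}"
  proof (rule abs_summable_summable, rule summable_on_comparison_test[OF cofaces_summable[OF assms(1)]])
    fix \<sigma> assume "\<sigma> \<in> {\<sigma>. face S \<tau> \<sigma>}"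
    then have "\<sigma> \<in> S" "face S \<tau> \<sigma>" by (auto simp: face_def)
    then show "norm (m \<sigma> * \<theta> \<tau> \<sigma> * \<theta> \<tau>' \<sigma>) \<le> m \<sigma>"
      using m_nonneg[of \<sigma>] abs_theta[of \<tau> \<sigma>] abs_theta[of \<tau>' \<sigma>] assms by (auto simp: abs_mult)
  qed auto
  then show ?thesis
    by (rule summable_on_cong_neutral[THEN iffD1, rotated -1])
       (use assms theta_eq_0 in \<open>auto simp: face_def\<close>)
qed

text \<open>\<open>\<theta> \<tau>\<close> is the coboundary of the indicator of
  \<open>\<tau>\<close>; its squared norm is the total mass of the cofaces of
  \<open>\<tau>\<close>.\<close>

lemma theta_l2:
  assumes "\<tau> \<in> S"
  shows "\<theta> \<tau> \<in> l2_space S m"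
  using theta_summable[OF assms assms] theta_fun_space[OF assms]
  by (simp add: l2_space_def power2_eq_square mult.assoc)

lemma \<delta>_fin_supp_l2:
  assumes "\<omega> \<in> fin_supp S"
  shows "\<delta> \<omega> \<in> l2_space S m"
proof -
  have F: "finite {\<tau>. \<omega> \<tau> \<noteq> 0}" "{\<tau>. \<omega> \<tau> \<noteq> 0} \<subseteq> S"
    using assms by (auto simp: fin_supp_def fun_space_def)
  show ?thesis
    unfolding \<delta>_fin_supp_eq[OF F, of \<omega>, simplified]
    by (intro subspace_sum[OF subspace_l2[OF weight]] subspace_scale[OF subspace_l2[OF weight]] theta_l2)
       (use F in auto)
qed

section \<open>The boundary operator on finitely supported functions\<close>

lemma boundary_apply_finite:
  assumes F: "finite F" "F \<subseteq> S" "\<And>\<tau>. \<tau> \<notin> F \<Longrightarrow> \<omega> \<tau> = 0" and \<rho>: "\<rho> \<in> S"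
  shows "boundary S m \<delta> \<omega> \<rho> = (\<Sum>\<tau>\<in>F. m \<tau> * \<omega> \<tau> * \<theta> \<rho> \<tau>) / m \<rho>"
proof -
  have "(\<Sum>\<^sub>\<infinity>\<tau>\<in>{\<tau>. face S \<rho> \<tau>}. m \<tau> * \<omega> \<tau> * \<theta> \<rho> \<tau>) = (\<Sum>\<tau>\<in>F. m \<tau> * \<omega> \<tau> * \<theta> \<rho> \<tau>)"
    by (subst infsum_finite[OF F(1), symmetric], rule infsum_cong_neutral)
       (use F theta_eq_0 \<rho> in auto)
  then show ?thesis using \<rho> by (simp add: boundary_def)
qed

text \<open>A simplex has finitely many faces, although it may have infinitely many cofaces; the
  boundary therefore preserves finite support, which the coboundary need not do.\<close>

lemma boundary_fin_supp:
  assumes "\<omega> \<in> fin_supp S"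
  shows "boundary S m \<delta> \<omega> \<in> fin_supp S"
proof -
  define F where "F = {\<tau>. \<omega> \<tau> \<noteq> 0}"
  have F: "finite F" "F \<subseteq> S" "\<And>\<tau>. \<tau> \<notin> F \<Longrightarrow> \<omega> \<tau> = 0"
    using assms by (auto simp: fin_supp_def fun_space_def F_def)
  have "{\<rho>. boundary S m \<delta> \<omega> \<rho> \<noteq> 0} \<subseteq> (\<Union>\<tau>\<in>F. {\<rho>. face S \<rho> \<tau>})"
  proof clarify
    fix \<rho> assume nz: "boundary S m \<delta> \<omega> \<rho> \<noteq> 0"
    then have \<rho>: "\<rho> \<in> S" by (auto simp: boundary_def split: if_splits)
    have "(\<Sum>\<tau>\<in>F. m \<tau> * \<omega> \<tau> * \<theta> \<rho> \<tau>) \<noteq> 0"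
      using nz boundary_apply_finite[OF F \<rho>] by auto
    then obtain \<tau> where "\<tau> \<in> F" "\<theta> \<rho> \<tau> \<noteq> 0"
      by (metis (no_types, lifting) mult_eq_0_iff sum.neutral)
    then show "\<rho> \<in> (\<Union>\<tau>\<in>F. {\<rho>. face S \<rho> \<tau>})" using theta_eq_0 \<rho> F by blast
  qed
  then have "finite {\<rho>. boundary S m \<delta> \<omega> \<rho> \<noteq> 0}"
    by (rule finite_subset) (use F finite_faces in auto)
  then show ?thesis by (auto simp: fin_supp_def fun_space_def boundary_def)
qed

lemma boundary_add:
  assumes "\<omega> \<in> F1_space S m" "\<eta> \<in> F1_space S m"
  shows "boundary S m \<delta> (\<omega> + \<eta>) = boundary S m \<delta> \<omega> + boundary S m \<delta> \<eta>"
proof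
  fix \<rho>
  show "boundary S m \<delta> (\<omega> + \<eta>) \<rho> = (boundary S m \<delta> \<omega> + boundary S m \<delta> \<eta>) \<rho>"
  proof (cases "\<rho> \<in> S")
    case True
    have sm: "(\<lambda>\<tau>. m \<tau> * \<omega> \<tau> * \<theta> \<rho> \<tau>) summable_on {\<tau>. face S \<rho> \<tau>}" if "\<omega> \<in> F1_space S m" for \<omega>
    proof (rule abs_summable_summable, rule summable_on_comparison_test)
      show "(\<lambda>\<tau>. m \<tau> * \<bar>\<omega> \<tau>\<bar>) summable_on {\<tau>. face S \<rho> \<tau>}"
        using that True by (auto simp: F1_space_def)
      fix \<tau> assume "\<tau> \<in> {\<tau>. face S \<rho> \<tau>}"
      then show "norm (m \<tau> * \<omega> \<tau> * \<theta> \<rho> \<tau>) \<le> m \<tau> * \<bar>\<omega> \<tau>\<bar>"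
        using abs_theta[OF True, of \<tau>] m_nonneg[of \<tau>] by (auto simp: abs_mult face_def)
    qed auto
    have "(\<Sum>\<^sub>\<infinity>\<tau>\<in>{\<tau>. face S \<rho> \<tau>}. m \<tau> * (\<omega> + \<eta>) \<tau> * \<theta> \<rho> \<tau>)
      = (\<Sum>\<^sub>\<infinity>\<tau>\<in>{\<tau>. face S \<rho> \<tau>}. m \<tau> * \<omega> \<tau> * \<theta> \<rho> \<tau>) + (\<Sum>\<^sub>\<infinity>\<tau>\<in>{\<tau>. face S \<rho> \<tau>}. m \<tau> * \<eta> \<tau> * \<theta> \<rho> \<tau>)"
      by (subst infsum_add[symmetric, OF sm[OF assms(1)] sm[OF assms(2)]]) (simp add: distrib_left distrib_right)
    then show ?thesis using True by (simp add: boundary_def distrib_left)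
  qed (simp add: boundary_def)
qed

lemma theta_theta:
  assumes "\<pi> \<in> S" "\<sigma> \<in> S"
  shows "(\<Sum>\<rho> | face S \<rho> \<sigma>. \<theta> \<pi> \<rho> * \<theta> \<rho> \<sigma>) = 0"
proof -
  have "(\<Sum>\<rho> | face S \<rho> \<sigma>. \<theta> \<pi> \<rho> * \<theta> \<rho> \<sigma>) = \<delta> (\<delta> (indicator {\<pi>})) \<sigma>"
    using \<delta>_apply[OF theta_fun_space[OF assms(1)] assms(2)] by (simp add: theta_def[abs_def])
  then show ?thesis using \<delta>_\<delta>[OF indicator_in_fun_space[OF assms(1)]] by simp
qed

text \<open>The transpose of \<open>\<delta>_\<delta>\<close>: after exchanging two finite sums, the
  coefficient of \<open>m \<tau> * \<omega> \<tau>\<close> is the twofold coboundary of the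
  indicator of \<open>\<pi>\<close> at \<open>\<tau>\<close>, which \<open>theta_theta\<close>
  annihilates.\<close>

lemma boundary_boundary:
  assumes "\<omega> \<in> fin_supp S"
  shows "boundary S m \<delta> (boundary S m \<delta> \<omega>) = 0"
proof
  fix \<pi>
  show "boundary S m \<delta> (boundary S m \<delta> \<omega>) \<pi> = 0 \<pi>"
  proof (cases "\<pi> \<in> S")
    case True
    define F where "F = {\<tau>. \<omega> \<tau> \<noteq> 0}"
    have F: "finite F" "F \<subseteq> S" "\<And>\<tau>. \<tau> \<notin> F \<Longrightarrow> \<omega> \<tau> = 0"
      using assms by (auto simp: fin_supp_def fun_space_def F_def)
    \<comment> \<open>All faces of members of \<open>F\<close> are included, even those where the
      boundary of \<open>\<omega>\<close> vanishes by cancellation, because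
      \<open>theta_theta\<close> needs the sum over every face of \<open>\<tau>\<close>.\<close>
    define R where "R = (\<Union>\<tau>\<in>F. {\<rho>. face S \<rho> \<tau>}) \<union> {\<rho>. boundary S m \<delta> \<omega> \<rho> \<noteq> 0}"
    have R: "finite R" "R \<subseteq> S" "\<And>\<rho>. \<rho> \<notin> R \<Longrightarrow> boundary S m \<delta> \<omega> \<rho> = 0"
      using boundary_fin_supp[OF assms] F finite_faces
      by (auto simp: R_def face_def fin_supp_def fun_space_def)
    have "(\<Sum>\<rho>\<in>R. m \<rho> * boundary S m \<delta> \<omega> \<rho> * \<theta> \<pi> \<rho>) = (\<Sum>\<rho>\<in>R. \<Sum>\<tau>\<in>F. m \<tau> * \<omega> \<tau> * (\<theta> \<pi> \<rho> * \<theta> \<rho> \<tau>))"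
    proof (rule sum.cong[OF refl])
      fix \<rho> assume "\<rho> \<in> R"
      then have "\<rho> \<in> S" "m \<rho> > 0" using R m_pos by auto
      then have "m \<rho> * boundary S m \<delta> \<omega> \<rho> * \<theta> \<pi> \<rho> = (\<Sum>\<tau>\<in>F. m \<tau> * \<omega> \<tau> * \<theta> \<rho> \<tau>) * \<theta> \<pi> \<rho>"
        using boundary_apply_finite[of F \<omega> \<rho>, OF F] by simp
      also have "\<dots> = (\<Sum>\<tau>\<in>F. m \<tau> * \<omega> \<tau> * (\<theta> \<pi> \<rho> * \<theta> \<rho> \<tau>))"
        unfolding sum_distrib_right by (intro sum.cong refl) simp
      finally show "m \<rho> * boundary S m \<delta> \<omega> \<rho> * \<theta> \<pi> \<rho> = (\<Sum>\<tau>\<in>F. m \<tau> * \<omega> \<tau> * (\<theta> \<pi> \<rho> * \<theta> \<rho> \<tau>))" .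
    qed
    also have "\<dots> = (\<Sum>\<tau>\<in>F. \<Sum>\<rho>\<in>R. m \<tau> * \<omega> \<tau> * (\<theta> \<pi> \<rho> * \<theta> \<rho> \<tau>))"
      by (rule sum.swap)
    also have "\<dots> = (\<Sum>\<tau>\<in>F. m \<tau> * \<omega> \<tau> * (\<Sum>\<rho>\<in>R. \<theta> \<pi> \<rho> * \<theta> \<rho> \<tau>))"
      by (simp only: sum_distrib_left)
    also have "\<dots> = (\<Sum>\<tau>\<in>F. m \<tau> * \<omega> \<tau> * (\<Sum>\<rho> | face S \<rho> \<tau>. \<theta> \<pi> \<rho> * \<theta> \<rho> \<tau>))"
    proof (rule sum.cong[OF refl], rule arg_cong[where f = "\<lambda>s. m _ * \<omega> _ * s"])
      fix \<tau> assume \<tau>: "\<tau> \<in> F"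
      show "(\<Sum>\<rho>\<in>R. \<theta> \<pi> \<rho> * \<theta> \<rho> \<tau>) = (\<Sum>\<rho> | face S \<rho> \<tau>. \<theta> \<pi> \<rho> * \<theta> \<rho> \<tau>)"
      proof (rule sum.mono_neutral_right[OF R(1)])
        show "{\<rho>. face S \<rho> \<tau>} \<subseteq> R" using \<tau> by (auto simp: R_def)
        have "\<theta> \<rho> \<tau> = 0" if "\<rho> \<in> R - {\<rho>. face S \<rho> \<tau>}" for \<rho>
          using theta_eq_0[of \<rho> \<tau>] that \<tau> R(2) F(2) by auto
        then show "\<forall>\<rho>\<in>R - {\<rho>. face S \<rho> \<tau>}. \<theta> \<pi> \<rho> * \<theta> \<rho> \<tau> = 0" by simp
      qed
    qed
    also have "\<dots> = 0"
    proof (rule sum.neutral, rule ballI)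
      fix \<tau> assume "\<tau> \<in> F"
      then have "(\<Sum>\<rho> | face S \<rho> \<tau>. \<theta> \<pi> \<rho> * \<theta> \<rho> \<tau>) = 0"
        using F(2) by (intro theta_theta[OF True]) auto
      then show "m \<tau> * \<omega> \<tau> * (\<Sum>\<rho> | face S \<rho> \<tau>. \<theta> \<pi> \<rho> * \<theta> \<rho> \<tau>) = 0" by simp
    qed
    finally show ?thesis using boundary_apply_finite[of R "boundary S m \<delta> \<omega>" \<pi>, OF R True] by simp
  qed (simp add: boundary_def)
qed

text \<open>The two square terms vanish. Splitting \<open>boundary\<close> over the sum of
  coboundary and boundary of \<open>\<omega>\<close> needs both summands in \<open>F1_space\<close>,
  and local summability puts the coboundary there.\<close>

lemma laplacian_Hodge:
  assumes "\<omega> \<in> fin_supp S"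
  shows "laplacian S m \<delta> Hodge \<omega> = laplacian S m \<delta> Upper \<omega> + laplacian S m \<delta> Lower \<omega>"
proof -
  have dirac: "dirac S m \<delta> \<omega> = \<delta> \<omega> + boundary S m \<delta> \<omega>" for \<omega>
    by (simp add: dirac_def plus_fun_def)
  have \<omega>: "\<omega> \<in> fun_space S" and b: "boundary S m \<delta> \<omega> \<in> fin_supp S"
    using assms boundary_fin_supp by (auto simp: fin_supp_def)
  have b1: "boundary S m \<delta> \<omega> \<in> fun_space S" "boundary S m \<delta> \<omega> \<in> F1_space S m"
    using b fin_supp_subset_F1 by (auto simp: fin_supp_def)
  have "\<delta> \<omega> \<in> F1_space S m"
    by (rule coboundary_fin_supp_in_F1[OF _ weight locally_summable coboundary assms])
       (simp add: finite_simplex)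
  then show ?thesis
    by (simp only: laplacian.simps dirac \<delta>_add boundary_add \<delta>_fun_space \<omega> b1 \<delta>_\<delta>
      boundary_boundary[OF assms] add_0_left add_0_right add.commute)
qed

end

section \<open>Laplacian kernels: positivity, off-diagonal entries, square-summable columns\<close>

context weighted_complex
begin

text \<open>The Gram matrix of the coboundaries of indicators. The factor \<open>m \<tau>'\<close>
  in front of the Laplacian at \<open>\<tau>'\<close> is absorbed, which makes the matrix
  symmetric.\<close>

definition upper_kernel :: "'v set \<Rightarrow> 'v set \<Rightarrow> real" where
  "upper_kernel \<tau> \<tau>' = (\<Sum>\<^sub>\<infinity>\<sigma>\<in>S. m \<sigma> * \<theta> \<tau> \<sigma> * \<theta> \<tau>' \<sigma>)"

text \<open>The Gram matrix of the boundaries of indicators: the boundary of the indicator of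
  \<open>\<tau>\<close> has the value \<open>m \<tau> * \<theta> \<rho> \<tau> / m \<rho>\<close> at
  \<open>\<rho>\<close>.\<close>

definition lower_kernel :: "'v set \<Rightarrow> 'v set \<Rightarrow> real" where
  "lower_kernel \<tau> \<tau>' = (\<Sum>\<rho> | face S \<rho> \<tau> \<and> face S \<rho> \<tau>'. m \<tau> * m \<tau>' / m \<rho> * \<theta> \<rho> \<tau> * \<theta> \<rho> \<tau>')"

lemma upper_kernel_commute: "upper_kernel \<tau> \<tau>' = upper_kernel \<tau>' \<tau>"
  by (simp add: upper_kernel_def mult_ac)

lemma lower_kernel_commute: "lower_kernel \<tau> \<tau>' = lower_kernel \<tau>' \<tau>"
  by (simp add: lower_kernel_def mult_ac conj_commute)

lemma upper_kernel_has_sum: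
  assumes "\<tau> \<in> S" "\<tau>' \<in> S"
  shows "((\<lambda>\<sigma>. m \<sigma> * \<theta> \<tau> \<sigma> * \<theta> \<tau>' \<sigma>) has_sum upper_kernel \<tau> \<tau>') S"
  unfolding upper_kernel_def by (rule has_sum_infsum[OF theta_summable[OF assms]])

lemma lower_kernel_eq:
  assumes R: "finite R" "R \<subseteq> S" "\<And>\<rho>. face S \<rho> \<tau> \<Longrightarrow> face S \<rho> \<tau>' \<Longrightarrow> \<rho> \<in> R" and S: "\<tau> \<in> S" "\<tau>' \<in> S"
  shows "lower_kernel \<tau> \<tau>' = (\<Sum>\<rho>\<in>R. m \<tau> * m \<tau>' / m \<rho> * \<theta> \<rho> \<tau> * \<theta> \<rho> \<tau>')"
  unfolding lower_kernel_def
proof (rule sum.mono_neutral_left[OF R(1)])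
  show "{\<rho>. face S \<rho> \<tau> \<and> face S \<rho> \<tau>'} \<subseteq> R" using R by blast
  show "\<forall>\<rho>\<in>R - {\<rho>. face S \<rho> \<tau> \<and> face S \<rho> \<tau>'}. m \<tau> * m \<tau>' / m \<rho> * \<theta> \<rho> \<tau> * \<theta> \<rho> \<tau>' = 0"
  proof
    fix \<rho> assume "\<rho> \<in> R - {\<rho>. face S \<rho> \<tau> \<and> face S \<rho> \<tau>'}"
    then have "\<theta> \<rho> \<tau> = 0 \<or> \<theta> \<rho> \<tau>' = 0" using theta_eq_0 R(2) S by blast
    then show "m \<tau> * m \<tau>' / m \<rho> * \<theta> \<rho> \<tau> * \<theta> \<rho> \<tau>' = 0" by auto
  qed
qed

lemma laplacian_Upper_kernel:
  assumes F: "finite F" "F \<subseteq> S" "\<And>\<tau>. \<tau> \<notin> F \<Longrightarrow> \<phi> \<tau> = 0" and \<tau>': "\<tau>' \<in> S"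
  shows "m \<tau>' * laplacian S m \<delta> Upper \<phi> \<tau>' = (\<Sum>\<tau>\<in>F. \<phi> \<tau> * upper_kernel \<tau> \<tau>')"
proof -
  have "((\<lambda>\<sigma>. \<Sum>\<tau>\<in>F. \<phi> \<tau> * (m \<sigma> * \<theta> \<tau> \<sigma> * \<theta> \<tau>' \<sigma>)) has_sum (\<Sum>\<tau>\<in>F. \<phi> \<tau> * upper_kernel \<tau> \<tau>')) S"
    by (intro has_sum_sum has_sum_cmult_right upper_kernel_has_sum) (use F \<tau>' in auto)
  then have *: "(\<Sum>\<tau>\<in>F. \<phi> \<tau> * upper_kernel \<tau> \<tau>') = (\<Sum>\<^sub>\<infinity>\<sigma>\<in>S. \<Sum>\<tau>\<in>F. \<phi> \<tau> * (m \<sigma> * \<theta> \<tau> \<sigma> * \<theta> \<tau>' \<sigma>))"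
    by (simp add: infsumI)
  have "(\<Sum>\<^sub>\<infinity>\<sigma>\<in>{\<sigma>. face S \<tau>' \<sigma>}. m \<sigma> * \<delta> \<phi> \<sigma> * \<theta> \<tau>' \<sigma>)
    = (\<Sum>\<^sub>\<infinity>\<sigma>\<in>S. \<Sum>\<tau>\<in>F. \<phi> \<tau> * (m \<sigma> * \<theta> \<tau> \<sigma> * \<theta> \<tau>' \<sigma>))"
  proof (rule infsum_cong_neutral)
    fix \<sigma> assume "\<sigma> \<in> S - {\<sigma>. face S \<tau>' \<sigma>}"
    then have "\<theta> \<tau>' \<sigma> = 0" using theta_eq_0 \<tau>' by blast
    then show "(\<Sum>\<tau>\<in>F. \<phi> \<tau> * (m \<sigma> * \<theta> \<tau> \<sigma> * \<theta> \<tau>' \<sigma>)) = 0" by simp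
  next
    fix \<sigma> assume "\<sigma> \<in> {\<sigma>. face S \<tau>' \<sigma>} \<inter> S"
    then have "\<delta> \<phi> \<sigma> = (\<Sum>\<tau>\<in>F. \<phi> \<tau> * \<theta> \<tau> \<sigma>)" using \<delta>_apply_finite[of F \<phi> \<sigma>, OF F] by simp
    then show "m \<sigma> * \<delta> \<phi> \<sigma> * \<theta> \<tau>' \<sigma> = (\<Sum>\<tau>\<in>F. \<phi> \<tau> * (m \<sigma> * \<theta> \<tau> \<sigma> * \<theta> \<tau>' \<sigma>))"
      by (simp add: sum_distrib_left sum_distrib_right mult_ac)
  qed (auto simp: face_def)
  then show ?thesis using * m_pos[OF \<tau>'] \<tau>' by (simp add: boundary_def)
qed

lemma laplacian_Lower_kernel:
  assumes F: "finite F" "F \<subseteq> S" "\<And>\<tau>. \<tau> \<notin> F \<Longrightarrow> \<phi> \<tau> = 0" and \<tau>': "\<tau>' \<in> S"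
  shows "m \<tau>' * laplacian S m \<delta> Lower \<phi> \<tau>' = (\<Sum>\<tau>\<in>F. \<phi> \<tau> * lower_kernel \<tau> \<tau>')"
proof -
  let ?R = "{\<rho>. face S \<rho> \<tau>'}"
  have R: "finite ?R" "?R \<subseteq> S" using finite_faces[OF \<tau>'] by (auto simp: face_def)
  have "boundary S m \<delta> \<phi> \<in> fun_space S" by (auto simp: fun_space_def boundary_def)
  then have "m \<tau>' * laplacian S m \<delta> Lower \<phi> \<tau>' = m \<tau>' * (\<Sum>\<rho>\<in>?R. boundary S m \<delta> \<phi> \<rho> * \<theta> \<rho> \<tau>')"
    by (simp add: \<delta>_apply[OF _ \<tau>'])
  also have "\<dots> = (\<Sum>\<rho>\<in>?R. \<Sum>\<tau>\<in>F. \<phi> \<tau> * (m \<tau> * m \<tau>' / m \<rho> * \<theta> \<rho> \<tau> * \<theta> \<rho> \<tau>'))"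
    unfolding sum_distrib_left
  proof (rule sum.cong[OF refl])
    fix \<rho> assume "\<rho> \<in> ?R"
    then have "\<rho> \<in> S" using R by auto
    then have "m \<tau>' * (boundary S m \<delta> \<phi> \<rho> * \<theta> \<rho> \<tau>') = m \<tau>' * ((\<Sum>\<tau>\<in>F. m \<tau> * \<phi> \<tau> * \<theta> \<rho> \<tau>) / m \<rho> * \<theta> \<rho> \<tau>')"
      using boundary_apply_finite[of F \<phi> \<rho>, OF F] by simp
    also have "\<dots> = (\<Sum>\<tau>\<in>F. \<phi> \<tau> * (m \<tau> * m \<tau>' / m \<rho> * \<theta> \<rho> \<tau> * \<theta> \<rho> \<tau>'))"
      unfolding sum_distrib_left sum_distrib_right sum_divide_distrib
      by (intro sum.cong refl) (simp add: field_simps)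
    finally show "m \<tau>' * (boundary S m \<delta> \<phi> \<rho> * \<theta> \<rho> \<tau>')
      = (\<Sum>\<tau>\<in>F. \<phi> \<tau> * (m \<tau> * m \<tau>' / m \<rho> * \<theta> \<rho> \<tau> * \<theta> \<rho> \<tau>'))" .
  qed
  also have "\<dots> = (\<Sum>\<tau>\<in>F. \<Sum>\<rho>\<in>?R. \<phi> \<tau> * (m \<tau> * m \<tau>' / m \<rho> * \<theta> \<rho> \<tau> * \<theta> \<rho> \<tau>'))"
    by (rule sum.swap)
  also have "\<dots> = (\<Sum>\<tau>\<in>F. \<phi> \<tau> * lower_kernel \<tau> \<tau>')"
  proof (rule sum.cong[OF refl])
    fix \<tau> assume "\<tau> \<in> F"
    then have "lower_kernel \<tau> \<tau>' = (\<Sum>\<rho>\<in>?R. m \<tau> * m \<tau>' / m \<rho> * \<theta> \<rho> \<tau> * \<theta> \<rho> \<tau>')"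
      using F(2) \<tau>' by (intro lower_kernel_eq R) auto
    then show "(\<Sum>\<rho>\<in>?R. \<phi> \<tau> * (m \<tau> * m \<tau>' / m \<rho> * \<theta> \<rho> \<tau> * \<theta> \<rho> \<tau>')) = \<phi> \<tau> * lower_kernel \<tau> \<tau>'"
      by (simp only: sum_distrib_left)
  qed
  finally show ?thesis .
qed

text \<open>The form is the squared norm of the coboundary of \<open>\<phi>\<close> restricted to
  \<open>F\<close>.\<close>

lemma upper_kernel_psd:
  assumes F: "finite F" "F \<subseteq> S"
  shows "0 \<le> (\<Sum>\<tau>\<in>F. \<Sum>\<tau>'\<in>F. upper_kernel \<tau> \<tau>' * \<phi> \<tau> * \<phi> \<tau>')"
proof -
  have "((\<lambda>\<sigma>. \<Sum>\<tau>\<in>F. \<Sum>\<tau>'\<in>F. m \<sigma> * \<theta> \<tau> \<sigma> * \<theta> \<tau>' \<sigma> * (\<phi> \<tau> * \<phi> \<tau>')) has_sum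
      (\<Sum>\<tau>\<in>F. \<Sum>\<tau>'\<in>F. upper_kernel \<tau> \<tau>' * (\<phi> \<tau> * \<phi> \<tau>'))) S"
    by (intro has_sum_sum has_sum_cmult_left upper_kernel_has_sum) (use F in auto)
  then have "0 \<le> (\<Sum>\<tau>\<in>F. \<Sum>\<tau>'\<in>F. upper_kernel \<tau> \<tau>' * (\<phi> \<tau> * \<phi> \<tau>'))"
  proof (rule has_sum_nonneg)
    fix \<sigma> assume "\<sigma> \<in> S"
    have "(\<Sum>\<tau>\<in>F. \<Sum>\<tau>'\<in>F. m \<sigma> * \<theta> \<tau> \<sigma> * \<theta> \<tau>' \<sigma> * (\<phi> \<tau> * \<phi> \<tau>')) = m \<sigma> * (\<Sum>\<tau>\<in>F. \<theta> \<tau> \<sigma> * \<phi> \<tau>)\<^sup>2"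
      by (simp add: power2_eq_square sum_product sum_distrib_left mult_ac)
    then show "0 \<le> (\<Sum>\<tau>\<in>F. \<Sum>\<tau>'\<in>F. m \<sigma> * \<theta> \<tau> \<sigma> * \<theta> \<tau>' \<sigma> * (\<phi> \<tau> * \<phi> \<tau>'))"
      using m_nonneg[OF \<open>\<sigma> \<in> S\<close>] by simp
  qed
  then show ?thesis by (simp add: mult.assoc)
qed

text \<open>The form is the squared norm of the boundary of \<open>\<phi>\<close> restricted to
  \<open>F\<close>. The set \<open>R\<close> collects the faces of all members of \<open>F\<close>,
  so that the sum over faces no longer depends on the pair and can be moved outside.\<close>

lemma lower_kernel_psd:
  assumes F: "finite F" "F \<subseteq> S"
  shows "0 \<le> (\<Sum>\<tau>\<in>F. \<Sum>\<tau>'\<in>F. lower_kernel \<tau> \<tau>' * \<phi> \<tau> * \<phi> \<tau>')"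
proof -
  define R where "R = (\<Union>\<tau>\<in>F. {\<rho>. face S \<rho> \<tau>})"
  have R: "finite R" "R \<subseteq> S" using F finite_faces by (auto simp: R_def face_def)
  have "(\<Sum>\<tau>\<in>F. \<Sum>\<tau>'\<in>F. lower_kernel \<tau> \<tau>' * \<phi> \<tau> * \<phi> \<tau>')
      = (\<Sum>\<tau>\<in>F. \<Sum>\<tau>'\<in>F. \<Sum>\<rho>\<in>R. (m \<tau> * \<theta> \<rho> \<tau> * \<phi> \<tau>) * (m \<tau>' * \<theta> \<rho> \<tau>' * \<phi> \<tau>') / m \<rho>)"
  proof (intro sum.cong refl)
    fix \<tau> \<tau>' assume *: "\<tau> \<in> F" "\<tau>' \<in> F"
    have "lower_kernel \<tau> \<tau>' = (\<Sum>\<rho>\<in>R. m \<tau> * m \<tau>' / m \<rho> * \<theta> \<rho> \<tau> * \<theta> \<rho> \<tau>')"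
      by (rule lower_kernel_eq[OF R]) (use * F in \<open>auto simp: R_def\<close>)
    then have "lower_kernel \<tau> \<tau>' * \<phi> \<tau> * \<phi> \<tau>'
        = (\<Sum>\<rho>\<in>R. m \<tau> * m \<tau>' / m \<rho> * \<theta> \<rho> \<tau> * \<theta> \<rho> \<tau>' * \<phi> \<tau> * \<phi> \<tau>')"
      by (simp only: sum_distrib_right)
    also have "\<dots> = (\<Sum>\<rho>\<in>R. (m \<tau> * \<theta> \<rho> \<tau> * \<phi> \<tau>) * (m \<tau>' * \<theta> \<rho> \<tau>' * \<phi> \<tau>') / m \<rho>)"
      by (intro sum.cong refl) (simp add: mult_ac)
    finally show "lower_kernel \<tau> \<tau>' * \<phi> \<tau> * \<phi> \<tau>'
        = (\<Sum>\<rho>\<in>R. (m \<tau> * \<theta> \<rho> \<tau> * \<phi> \<tau>) * (m \<tau>' * \<theta> \<rho> \<tau>' * \<phi> \<tau>') / m \<rho>)" .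
  qed
  also have "\<dots> = (\<Sum>\<tau>\<in>F. \<Sum>\<rho>\<in>R. \<Sum>\<tau>'\<in>F. (m \<tau> * \<theta> \<rho> \<tau> * \<phi> \<tau>) * (m \<tau>' * \<theta> \<rho> \<tau>' * \<phi> \<tau>') / m \<rho>)"
    by (intro sum.cong refl sum.swap)
  also have "\<dots> = (\<Sum>\<rho>\<in>R. \<Sum>\<tau>\<in>F. \<Sum>\<tau>'\<in>F. (m \<tau> * \<theta> \<rho> \<tau> * \<phi> \<tau>) * (m \<tau>' * \<theta> \<rho> \<tau>' * \<phi> \<tau>') / m \<rho>)"
    by (rule sum.swap)
  also have "\<dots> = (\<Sum>\<rho>\<in>R. (\<Sum>\<tau>\<in>F. m \<tau> * \<theta> \<rho> \<tau> * \<phi> \<tau>)\<^sup>2 / m \<rho>)"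
    unfolding power2_eq_square sum_product sum_divide_distrib by simp
  also have "0 \<le> \<dots>"
    by (intro sum_nonneg divide_nonneg_nonneg m_nonneg) (use R in auto)
  finally show ?thesis .
qed

text \<open>By \<open>common_cofaceE\<close> the series has at most one nonzero term, so no
  cancellation occurs and the absolute value merely removes the signs.\<close>

lemma upper_kernel_off_diagonal:
  assumes "\<tau> \<in> S" "\<tau>' \<in> S" "\<tau> \<noteq> \<tau>'"
  shows "\<bar>upper_kernel \<tau> \<tau>'\<bar>
    = (if face S \<tau> (\<tau> \<union> \<tau>') \<and> face S \<tau>' (\<tau> \<union> \<tau>') then m (\<tau> \<union> \<tau>') else 0)"
proof -
  have only: "\<sigma> = \<tau> \<union> \<tau>'" if "face S \<tau> \<sigma>" "face S \<tau>' \<sigma>" for \<sigma>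
    using common_cofaceE[OF that assms(3)] by metis
  define B where "B = {\<sigma>. \<sigma> = \<tau> \<union> \<tau>' \<and> face S \<tau> \<sigma> \<and> face S \<tau>' \<sigma>}"
  have "B = (if face S \<tau> (\<tau> \<union> \<tau>') \<and> face S \<tau>' (\<tau> \<union> \<tau>') then {\<tau> \<union> \<tau>'} else {})"
    by (auto simp: B_def)
  moreover have "finite B" by (auto simp: B_def)
  moreover have "upper_kernel \<tau> \<tau>' = (\<Sum>\<sigma>\<in>B. m \<sigma> * \<theta> \<tau> \<sigma> * \<theta> \<tau>' \<sigma>)"
    unfolding upper_kernel_def infsum_finite[OF \<open>finite B\<close>, symmetric]
  proof (rule infsum_cong_neutral)
    fix \<sigma> assume "\<sigma> \<in> S - B"
    then have "\<theta> \<tau> \<sigma> = 0 \<or> \<theta> \<tau>' \<sigma> = 0" using theta_eq_0 assms only unfolding B_def by blast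
    then show "m \<sigma> * \<theta> \<tau> \<sigma> * \<theta> \<tau>' \<sigma> = 0" by auto
  qed (auto simp: B_def face_def)
  moreover have "\<bar>m (\<tau> \<union> \<tau>') * \<theta> \<tau> (\<tau> \<union> \<tau>') * \<theta> \<tau>' (\<tau> \<union> \<tau>')\<bar> = m (\<tau> \<union> \<tau>')"
    if "face S \<tau> (\<tau> \<union> \<tau>') \<and> face S \<tau>' (\<tau> \<union> \<tau>')"
  proof -
    have "\<tau> \<union> \<tau>' \<in> S" using that by (auto simp: face_def)
    then show ?thesis using that abs_theta assms m_nonneg by (simp add: abs_mult)
  qed
  ultimately show ?thesis by simp
qed

lemma lower_kernel_off_diagonal:
  assumes "\<tau> \<in> S" "\<tau>' \<in> S" "\<tau> \<noteq> \<tau>'"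
  shows "\<bar>lower_kernel \<tau> \<tau>'\<bar>
    = (if face S (\<tau> \<inter> \<tau>') \<tau> \<and> face S (\<tau> \<inter> \<tau>') \<tau>' then m \<tau> * m \<tau>' / m (\<tau> \<inter> \<tau>') else 0)"
proof -
  have only: "\<rho> = \<tau> \<inter> \<tau>'" if "face S \<rho> \<tau>" "face S \<rho> \<tau>'" for \<rho>
    using common_faceE[OF that assms(3)] by metis
  then have "{\<rho>. face S \<rho> \<tau> \<and> face S \<rho> \<tau>'}
      = (if face S (\<tau> \<inter> \<tau>') \<tau> \<and> face S (\<tau> \<inter> \<tau>') \<tau>' then {\<tau> \<inter> \<tau>'} else {})"
    by auto
  moreover have "\<bar>m \<tau> * m \<tau>' / m (\<tau> \<inter> \<tau>') * \<theta> (\<tau> \<inter> \<tau>') \<tau> * \<theta> (\<tau> \<inter> \<tau>') \<tau>'\<bar> = m \<tau> * m \<tau>' / m (\<tau> \<inter> \<tau>')"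
    if "face S (\<tau> \<inter> \<tau>') \<tau> \<and> face S (\<tau> \<inter> \<tau>') \<tau>'"
  proof -
    have "\<tau> \<inter> \<tau>' \<in> S" using that by (auto simp: face_def)
    then show ?thesis using that abs_theta assms m_nonneg by (simp add: abs_mult)
  qed
  ultimately show ?thesis by (simp add: lower_kernel_def)
qed

definition upper_neighbours :: "'v set \<Rightarrow> 'v set set" where
  "upper_neighbours \<tau> = {\<tau>'. \<tau>' \<noteq> \<tau> \<and> face S \<tau> (\<tau> \<union> \<tau>') \<and> face S \<tau>' (\<tau> \<union> \<tau>')}"

lemma upper_kernel_eq_0:
  assumes "\<tau> \<in> S" "\<tau>' \<in> S" "\<tau>' \<noteq> \<tau>" "\<tau>' \<notin> upper_neighbours \<tau>"
  shows "upper_kernel \<tau> \<tau>' = 0"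
  using upper_kernel_off_diagonal[OF assms(1,2)] assms(3,4)
  unfolding upper_neighbours_def by (metis (mono_tags, lifting) abs_eq_0 mem_Collect_eq)

text \<open>A coface \<open>\<sigma>\<close> of \<open>\<tau>\<close> has exactly \<open>card \<tau>\<close> facets other than \<open>\<tau>\<close>.\<close>

lemma sum_upper_neighbours_le:
  assumes \<tau>: "\<tau> \<in> S" and F: "finite F" "F \<subseteq> upper_neighbours \<tau>"
  shows "(\<Sum>\<tau>'\<in>F. m (\<tau> \<union> \<tau>')) \<le> card \<tau> * (\<Sum>\<sigma>\<in>(\<union>) \<tau> ` F. m \<sigma>)"
proof -
  have "(\<Sum>\<tau>'\<in>F. m (\<tau> \<union> \<tau>')) = (\<Sum>\<sigma>\<in>(\<union>) \<tau> ` F. \<Sum>\<tau>'\<in>{\<tau>'\<in>F. \<tau> \<union> \<tau>' = \<sigma>}. m (\<tau> \<union> \<tau>'))"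
    by (rule sum.image_gen[OF F(1)])
  also have "\<dots> \<le> (\<Sum>\<sigma>\<in>(\<union>) \<tau> ` F. card \<tau> * m \<sigma>)"
  proof (rule sum_mono)
    fix \<sigma> assume "\<sigma> \<in> (\<union>) \<tau> ` F"
    then have \<sigma>: "face S \<tau> \<sigma>" using F by (auto simp: upper_neighbours_def)
    have "{\<tau>'\<in>F. \<tau> \<union> \<tau>' = \<sigma>} \<subseteq> (\<lambda>y. \<sigma> - {y}) ` \<tau>"
    proof
      fix \<tau>' assume "\<tau>' \<in> {\<tau>'\<in>F. \<tau> \<union> \<tau>' = \<sigma>}"
      then have u: "\<tau> \<union> \<tau>' = \<sigma>" and "face S \<tau>' \<sigma>" using F by (auto simp: upper_neighbours_def)
      from this(2) obtain y where y: "y \<notin> \<tau>'" "\<sigma> = insert y \<tau>'" by (rule face_insertE)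
      then have "y \<in> \<tau>" "\<tau>' = \<sigma> - {y}" using u by auto
      then show "\<tau>' \<in> (\<lambda>y. \<sigma> - {y}) ` \<tau>" by blast
    qed
    then have "card {\<tau>'\<in>F. \<tau> \<union> \<tau>' = \<sigma>} \<le> card ((\<lambda>y. \<sigma> - {y}) ` \<tau>)"
      using finite_simplex[OF \<tau>] by (intro card_mono) auto
    also have "\<dots> \<le> card \<tau>" by (rule card_image_le[OF finite_simplex[OF \<tau>]])
    finally have "real (card {\<tau>'\<in>F. \<tau> \<union> \<tau>' = \<sigma>}) * m \<sigma> \<le> card \<tau> * m \<sigma>"
      using \<sigma> m_nonneg by (intro mult_right_mono) (auto simp: face_def)
    moreover have "(\<Sum>\<tau>'\<in>{\<tau>'\<in>F. \<tau> \<union> \<tau>' = \<sigma>}. m (\<tau> \<union> \<tau>')) = real (card {\<tau>'\<in>F. \<tau> \<union> \<tau>' = \<sigma>}) * m \<sigma>"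
      by simp
    ultimately show "(\<Sum>\<tau>'\<in>{\<tau>'\<in>F. \<tau> \<union> \<tau>' = \<sigma>}. m (\<tau> \<union> \<tau>')) \<le> card \<tau> * m \<sigma>" by simp
  qed
  finally show ?thesis by (simp add: sum_distrib_left)
qed

text \<open>This says that the upper Laplacian of an indicator is square summable. Under local
  finiteness the column has finitely many nonzero entries. Under balance, the entry for a common
  coface \<sigma> contributes m(\<sigma>) times the ratio of m(\<sigma>) to the weight of the
  neighbour; the ratio is bounded and the masses are summable by local summability.\<close>

lemma upper_kernel_column_summable:
  assumes fb: "locally_finite S \<or> balanced S m" and \<tau>: "\<tau> \<in> S"
  shows "(\<lambda>\<tau>'. (upper_kernel \<tau> \<tau>')\<^sup>2 / m \<tau>') summable_on S"
  using fb
proof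
  assume lf: "locally_finite S"
  have "finite (insert \<tau> (upper_neighbours \<tau>))"
  proof (cases "\<tau> = {}")
    \<comment> \<open>\<open>locally_finite\<close> is silent about the empty simplex. It has no
      upper neighbours, since its union with \<tau>' is \<tau>' and
      \<open>face S \<tau>' \<tau>'\<close> never holds.\<close>
    case True
    have "\<tau>' = {}" if "\<tau>' \<in> upper_neighbours \<tau>" for \<tau>'
      using that True by (auto simp: upper_neighbours_def face_def)
    then show ?thesis by (metis finite.emptyI finite_insert finite_subset subsetI insertI1)
  next
    case False
    have "upper_neighbours \<tau> \<subseteq> (\<Union>\<sigma>\<in>{\<sigma>. face S \<tau> \<sigma>}. {\<rho>. face S \<rho> \<sigma>})"
      by (auto simp: upper_neighbours_def)
    moreover have "finite (\<Union>\<sigma>\<in>{\<sigma>. face S \<tau> \<sigma>}. {\<rho>. face S \<rho> \<sigma>})"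
      using lf False \<tau> finite_faces by (auto simp: locally_finite_def face_def)
    ultimately show ?thesis using finite_subset by auto
  qed
  moreover have "{\<tau>' \<in> S. (upper_kernel \<tau> \<tau>')\<^sup>2 / m \<tau>' \<noteq> 0} \<subseteq> insert \<tau> (upper_neighbours \<tau>)"
    using upper_kernel_eq_0[OF \<tau>] by auto
  ultimately show ?thesis
    by (intro finite_nonzero_values_imp_summable_on) (rule finite_subset)
next
  assume "balanced S m"
  then obtain C where C: "\<And>\<tau> \<sigma>. face S \<tau> \<sigma> \<Longrightarrow> m \<sigma> / m \<tau> \<le> C"
    unfolding balanced_def bdd_above_def by blast
  define M where "M = (\<Sum>\<^sub>\<infinity>\<sigma>\<in>{\<sigma>. face S \<tau> \<sigma>}. m \<sigma>)"
  \<comment> \<open>The absolute value guards against a negative upper bound \<open>C\<close>,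
    possible when no face relation exists at all.\<close>
  define b where "b = (upper_kernel \<tau> \<tau>)\<^sup>2 / m \<tau> + \<bar>C\<bar> * (card \<tau> * M)"
  have nn: "0 \<le> (upper_kernel \<tau> \<tau>')\<^sup>2 / m \<tau>'" if "\<tau>' \<in> S" for \<tau>'
    using m_nonneg[OF that] by simp
  have bound: "(\<Sum>\<tau>'\<in>F. (upper_kernel \<tau> \<tau>')\<^sup>2 / m \<tau>') \<le> b" if F: "finite F" "F \<subseteq> S" for F
  proof -
    define F' where "F' = F \<inter> upper_neighbours \<tau>"
    have F': "finite F'" "F' \<subseteq> upper_neighbours \<tau>" "F' \<subseteq> S" using F by (auto simp: F'_def)
    have z: "upper_kernel \<tau> \<tau>' = 0" if "\<tau>' \<in> F" "\<tau>' \<notin> insert \<tau> F'" for \<tau>'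
      using upper_kernel_eq_0[OF \<tau>, of \<tau>'] that F by (auto simp: F'_def)
    have nin: "\<tau> \<notin> F'" by (auto simp: F'_def upper_neighbours_def)
    have "(\<Sum>\<tau>'\<in>F. (upper_kernel \<tau> \<tau>')\<^sup>2 / m \<tau>') = (\<Sum>\<tau>'\<in>F \<inter> insert \<tau> F'. (upper_kernel \<tau> \<tau>')\<^sup>2 / m \<tau>')"
      by (rule sum.mono_neutral_right[OF F(1)]) (use z in auto)
    also have "\<dots> \<le> (\<Sum>\<tau>'\<in>insert \<tau> F'. (upper_kernel \<tau> \<tau>')\<^sup>2 / m \<tau>')"
      by (rule sum_mono2) (use F' nn \<tau> in auto)
    also have "\<dots> = (upper_kernel \<tau> \<tau>)\<^sup>2 / m \<tau> + (\<Sum>\<tau>'\<in>F'. (upper_kernel \<tau> \<tau>')\<^sup>2 / m \<tau>')"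
      using F' nin by simp
    also have "(\<Sum>\<tau>'\<in>F'. (upper_kernel \<tau> \<tau>')\<^sup>2 / m \<tau>') \<le> (\<Sum>\<tau>'\<in>F'. \<bar>C\<bar> * m (\<tau> \<union> \<tau>'))"
    proof (rule sum_mono)
      fix \<tau>' assume \<tau>': "\<tau>' \<in> F'"
      then have f: "face S \<tau> (\<tau> \<union> \<tau>')" "face S \<tau>' (\<tau> \<union> \<tau>')" "\<tau> \<noteq> \<tau>'" "\<tau>' \<in> S" "\<tau> \<union> \<tau>' \<in> S"
        using F' by (auto simp: upper_neighbours_def face_def)
      have "\<bar>upper_kernel \<tau> \<tau>'\<bar> = m (\<tau> \<union> \<tau>')"
        using upper_kernel_off_diagonal[OF \<tau> f(4,3)] f by simp
      then have "(upper_kernel \<tau> \<tau>')\<^sup>2 / m \<tau>' = m (\<tau> \<union> \<tau>') * (m (\<tau> \<union> \<tau>') / m \<tau>')"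
        by (metis power2_abs power2_eq_square times_divide_eq_right)
      also have "\<dots> \<le> m (\<tau> \<union> \<tau>') * \<bar>C\<bar>"
        using C[OF f(2)] m_nonneg[OF f(5)] by (intro mult_left_mono) auto
      finally show "(upper_kernel \<tau> \<tau>')\<^sup>2 / m \<tau>' \<le> \<bar>C\<bar> * m (\<tau> \<union> \<tau>')" by (simp add: mult.commute)
    qed
    also have "\<dots> = \<bar>C\<bar> * (\<Sum>\<tau>'\<in>F'. m (\<tau> \<union> \<tau>'))" by (simp add: sum_distrib_left)
    also have "\<dots> \<le> \<bar>C\<bar> * (card \<tau> * (\<Sum>\<sigma>\<in>(\<union>) \<tau> ` F'. m \<sigma>))"
      by (intro mult_left_mono sum_upper_neighbours_le \<tau> F') auto
    also have "\<dots> \<le> \<bar>C\<bar> * (card \<tau> * M)"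
      unfolding M_def
      by (intro mult_left_mono finite_sum_le_infsum cofaces_summable \<tau>)
         (use F' m_nonneg in \<open>auto simp: upper_neighbours_def face_def\<close>)
    finally show ?thesis by (simp add: b_def)
  qed
  show ?thesis
  proof (rule nonneg_bdd_above_summable_on[OF nn])
    show "bdd_above (sum (\<lambda>\<tau>'. (upper_kernel \<tau> \<tau>')\<^sup>2 / m \<tau>') ` {F. F \<subseteq> S \<and> finite F})"
      by (rule bdd_aboveI2) (use bound in blast)
  qed
qed

lemma laplacian_Upper_l2:
  assumes fb: "locally_finite S \<or> balanced S m" and \<phi>: "\<phi> \<in> fin_supp S"
  shows "laplacian S m \<delta> Upper \<phi> \<in> l2_space S m"
proof -
  define F where "F = {\<tau>. \<phi> \<tau> \<noteq> 0}"
  have F: "finite F" "F \<subseteq> S" "\<And>\<tau>. \<tau> \<notin> F \<Longrightarrow> \<phi> \<tau> = 0"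
    using \<phi> by (auto simp: fin_supp_def fun_space_def F_def)
  define k where "k \<tau> = (\<lambda>\<tau>'. if \<tau>' \<in> S then upper_kernel \<tau> \<tau>' / m \<tau>' else 0)" for \<tau>
  have k: "k \<tau> \<in> l2_space S m" if "\<tau> \<in> S" for \<tau>
  proof -
    have "m \<tau>' * (k \<tau> \<tau>')\<^sup>2 = (upper_kernel \<tau> \<tau>')\<^sup>2 / m \<tau>'" if "\<tau>' \<in> S" for \<tau>'
      using that m_pos[OF that] by (simp add: k_def power2_eq_square)
    then have "(\<lambda>\<tau>'. m \<tau>' * (k \<tau> \<tau>')\<^sup>2) summable_on S"
      using upper_kernel_column_summable[OF fb that] by (simp cong: summable_on_cong)
    then show ?thesis by (auto simp: l2_space_def fun_space_def k_def)
  qed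
  have "laplacian S m \<delta> Upper \<phi> = (\<Sum>\<tau>\<in>F. \<phi> \<tau> *\<^sub>R k \<tau>)"
  proof
    fix \<tau>'
    show "laplacian S m \<delta> Upper \<phi> \<tau>' = (\<Sum>\<tau>\<in>F. \<phi> \<tau> *\<^sub>R k \<tau>) \<tau>'"
    proof (cases "\<tau>' \<in> S")
      case True
      have "laplacian S m \<delta> Upper \<phi> \<tau>' = (\<Sum>\<tau>\<in>F. \<phi> \<tau> * upper_kernel \<tau> \<tau>') / m \<tau>'"
        using laplacian_Upper_kernel[of F \<phi> \<tau>', OF F True] m_pos[OF True] by (simp add: field_simps)
      then show ?thesis using True by (simp add: sum_fun_apply k_def sum_divide_distrib)
    qed (simp add: boundary_def sum_fun_apply k_def)
  qed
  then show ?thesis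
    using F k by (auto intro!: subspace_sum[OF subspace_l2[OF weight]] subspace_scale[OF subspace_l2[OF weight]])
qed

text \<open>The boundary keeps the support finite, and the coboundary then lands in
  \<open>l2_space\<close> by local summability.\<close>

lemma laplacian_Lower_l2: "\<phi> \<in> fin_supp S \<Longrightarrow> laplacian S m \<delta> Lower \<phi> \<in> l2_space S m"
  using \<delta>_fin_supp_l2[OF boundary_fin_supp] by simp

end


section \<open>Commutator error of a cutoff\<close>

text \<open>Schur's test with constant test weights: the arithmetic-geometric inequality splits each
  product into squares, and symmetry of \<open>K\<close> turns the column sums into row
  sums.\<close>

lemma schur_bound:
  fixes K :: "'a \<Rightarrow> 'a \<Rightarrow> real"
  assumes sym: "\<And>\<tau> \<tau>'. \<tau> \<in> F \<Longrightarrow> \<tau>' \<in> F \<Longrightarrow> K \<tau> \<tau>' = K \<tau>' \<tau>"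
    and nn: "\<And>\<tau> \<tau>'. \<tau> \<in> F \<Longrightarrow> \<tau>' \<in> F \<Longrightarrow> 0 \<le> K \<tau> \<tau>'"
    and row: "\<And>\<tau>. \<tau> \<in> F \<Longrightarrow> (\<Sum>\<tau>'\<in>F. K \<tau> \<tau>') \<le> c * m \<tau>"
  shows "(\<Sum>\<tau>\<in>F. \<Sum>\<tau>'\<in>F. K \<tau> \<tau>' * (\<bar>u \<tau>\<bar> * \<bar>u \<tau>'\<bar>)) \<le> c * (\<Sum>\<tau>\<in>F. m \<tau> * (u \<tau>)\<^sup>2)"
proof -
  have "(\<Sum>\<tau>\<in>F. \<Sum>\<tau>'\<in>F. K \<tau> \<tau>' * (\<bar>u \<tau>\<bar> * \<bar>u \<tau>'\<bar>))
      \<le> (\<Sum>\<tau>\<in>F. \<Sum>\<tau>'\<in>F. K \<tau> \<tau>' * (u \<tau>)\<^sup>2 / 2 + K \<tau> \<tau>' * (u \<tau>')\<^sup>2 / 2)"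
  proof (intro sum_mono)
    fix \<tau> \<tau>' assume *: "\<tau> \<in> F" "\<tau>' \<in> F"
    have "\<bar>u \<tau>\<bar> * \<bar>u \<tau>'\<bar> \<le> ((u \<tau>)\<^sup>2 + (u \<tau>')\<^sup>2) / 2"
      using sum_squares_bound[of "\<bar>u \<tau>\<bar>" "\<bar>u \<tau>'\<bar>"] by simp
    from mult_left_mono[OF this nn[OF *]]
    show "K \<tau> \<tau>' * (\<bar>u \<tau>\<bar> * \<bar>u \<tau>'\<bar>) \<le> K \<tau> \<tau>' * (u \<tau>)\<^sup>2 / 2 + K \<tau> \<tau>' * (u \<tau>')\<^sup>2 / 2"
      by (simp add: algebra_simps add_divide_distrib)
  qed
  also have "\<dots> = (\<Sum>\<tau>\<in>F. \<Sum>\<tau>'\<in>F. K \<tau> \<tau>' * (u \<tau>)\<^sup>2 / 2) + (\<Sum>\<tau>\<in>F. \<Sum>\<tau>'\<in>F. K \<tau> \<tau>' * (u \<tau>')\<^sup>2 / 2)"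
    by (simp add: sum.distrib)
  also have "(\<Sum>\<tau>\<in>F. \<Sum>\<tau>'\<in>F. K \<tau> \<tau>' * (u \<tau>')\<^sup>2 / 2) = (\<Sum>\<tau>\<in>F. \<Sum>\<tau>'\<in>F. K \<tau> \<tau>' * (u \<tau>)\<^sup>2 / 2)"
    by (subst sum.swap, intro sum.cong refl) (simp add: sym)
  also have "(\<Sum>\<tau>\<in>F. \<Sum>\<tau>'\<in>F. K \<tau> \<tau>' * (u \<tau>)\<^sup>2 / 2) + (\<Sum>\<tau>\<in>F. \<Sum>\<tau>'\<in>F. K \<tau> \<tau>' * (u \<tau>)\<^sup>2 / 2)
      = (\<Sum>\<tau>\<in>F. (\<Sum>\<tau>'\<in>F. K \<tau> \<tau>') * (u \<tau>)\<^sup>2)"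
    unfolding sum.distrib[symmetric] sum_distrib_right by (intro sum.cong refl) simp
  also have "\<dots> \<le> (\<Sum>\<tau>\<in>F. c * m \<tau> * (u \<tau>)\<^sup>2)"
    by (intro sum_mono mult_right_mono row) auto
  finally show ?thesis by (simp add: sum_distrib_left mult.assoc)
qed

text \<open>Each Lipschitz estimate bounds one squared difference \<open>x i\<close> times the total
  weight of its row; this converts such estimates into a bound on the row's weighted sum. A row of
  total weight zero gives no information on \<open>x\<close> but contributes nothing.\<close>

lemma weighted_sum_le:
  fixes a x :: "'a \<Rightarrow> real"
  assumes "finite I" "\<And>i. i \<in> I \<Longrightarrow> 0 \<le> a i" "\<And>i. i \<in> I \<Longrightarrow> sum a I * x i \<le> B" "0 \<le> B"
  shows "(\<Sum>i\<in>I. a i * x i) \<le> B"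
proof (cases "sum a I = 0")
  case True
  then have "\<And>i. i \<in> I \<Longrightarrow> a i = 0" using assms by (simp add: sum_nonneg_eq_0_iff)
  then show ?thesis using assms(4) by simp
next
  case False
  then have pos: "sum a I > 0" using sum_nonneg[of I a] assms(2) by fastforce
  have "(\<Sum>i\<in>I. a i * x i) \<le> (\<Sum>i\<in>I. a i * (B / sum a I))"
    by (intro sum_mono mult_left_mono) (use assms pos in \<open>auto simp: pos_le_divide_eq mult.commute\<close>)
  also have "\<dots> = sum a I * (B / sum a I)" by (simp only: sum_distrib_right)
  also have "\<dots> = B" using pos by simp
  finally show ?thesis .
qed

text \<open>Brings a Lipschitz bound by an edge weight back to real numbers. \<open>X\<close> may be
  infinite, in which case \<open>d\<close> is forced to be 0.\<close>

lemma inv_sqrt_bound: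
  assumes "ennreal d \<le> ennreal c * inv_sqrt X" "ennreal A \<le> X" "0 \<le> A" "0 \<le> d" "0 \<le> c"
  shows "A * d\<^sup>2 \<le> c\<^sup>2"
proof (cases "A = 0")
  \<comment> \<open>With \<open>A\<close> positive, \<open>X\<close> cannot be 0, so the value
    \<infinity> of \<open>inv_sqrt\<close> does not arise.\<close>
  case False
  then have A: "A > 0" using assms by simp
  have "X \<noteq> 0" using assms(2) A by auto
  have "inv_sqrt X \<le> ennreal (1 / sqrt A)"
  proof (cases "X = \<infinity>")
    case False
    then obtain r where r: "X = ennreal r" "0 \<le> r" by (cases X) auto
    then have "A \<le> r" using assms(2) by simp
    then have "r powr (-1/2) \<le> A powr (-1/2)" using A by (intro powr_mono2') auto
    also have "\<dots> = 1 / sqrt A" using A by (simp add: powr_minus powr_half_sqrt field_simps flip: powr_half_sqrt)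
    finally show ?thesis using r \<open>X \<noteq> 0\<close> by (auto simp: inv_sqrt_def intro: ennreal_leI)
  qed (simp add: inv_sqrt_def)
  then have "ennreal d \<le> ennreal c * ennreal (1 / sqrt A)"
    using assms(1) by (meson mult_left_mono order_trans zero_le)
  also have "\<dots> = ennreal (c * (1 / sqrt A))" using assms by (simp flip: ennreal_mult')
  finally have "d \<le> c / sqrt A" using assms A by simp
  then have "d\<^sup>2 \<le> (c / sqrt A)\<^sup>2" using assms by (intro power_mono) auto
  also have "\<dots> = c\<^sup>2 / A" using A by (simp add: power_divide)
  finally show ?thesis using A by (simp add: pos_le_divide_eq mult.commute)
qed (use assms in auto)

lemma sum_le_infsum_ennreal:
  fixes g :: "'a \<Rightarrow> real"
  assumes "finite B" "B \<subseteq> A" "\<And>x. x \<in> B \<Longrightarrow> 0 \<le> g x"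
  shows "ennreal (sum g B) \<le> (\<Sum>\<^sub>\<infinity>x\<in>A. ennreal (g x))"
proof -
  have "ennreal (sum g B) = (\<Sum>\<^sub>\<infinity>x\<in>B. ennreal (g x))"
    using assms by (simp add: sum_ennreal)
  also have "\<dots> \<le> (\<Sum>\<^sub>\<infinity>x\<in>A. ennreal (g x))"
    by (rule infsum_mono_neutral) (use assms in \<open>auto intro: nonneg_summable_on_complete\<close>)
  finally show ?thesis .
qed

text \<open>Inserting 1 gives the empty simplex the value 1 and does not alter the minimum elsewhere
  when \<open>f\<close> is at most 1, as for \<open>dist_cutoff\<close> with a positive
  slope.\<close>

definition simplex_cutoff :: "('v \<Rightarrow> real) \<Rightarrow> 'v set \<Rightarrow> real" where
  "simplex_cutoff f \<tau> = Min (insert 1 (f ` \<tau>))"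

lemma simplex_cutoff_insert:
  "finite \<rho> \<Longrightarrow> simplex_cutoff f (insert x \<rho>) = min (f x) (simplex_cutoff f \<rho>)"
  by (simp add: simplex_cutoff_def insert_commute[of 1])

text \<open>Both sides share the value at \<open>\<rho>\<close>, and taking the minimum with a fixed
  number is a contraction.\<close>

lemma simplex_cutoff_diff:
  assumes "finite \<rho>"
  shows "(simplex_cutoff f (insert x \<rho>) - simplex_cutoff f (insert x' \<rho>))\<^sup>2 \<le> (f x - f x')\<^sup>2"
  unfolding simplex_cutoff_insert[OF assms] by (rule abs_le_square_iff[THEN iffD1]) (auto simp: min_def)

lemma simplex_cutoff_le_1: "finite \<tau> \<Longrightarrow> simplex_cutoff f \<tau> \<le> 1"
  by (simp add: simplex_cutoff_def)

lemma simplex_cutoff_nonneg: "finite \<tau> \<Longrightarrow> (\<And>v. 0 \<le> f v) \<Longrightarrow> 0 \<le> simplex_cutoff f \<tau>"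
  by (auto simp: simplex_cutoff_def)

lemma simplex_cutoff_eq_1: "finite \<tau> \<Longrightarrow> (\<And>v. v \<in> \<tau> \<Longrightarrow> f v = 1) \<Longrightarrow> simplex_cutoff f \<tau> = 1"
  by (auto simp: simplex_cutoff_def intro!: Min_eqI)

lemma simplex_cutoff_eq_0:
  assumes "finite \<tau>" "\<And>v. 0 \<le> f v" "v \<in> \<tau>" "f v = 0"
  shows "simplex_cutoff f \<tau> = 0"
proof (rule antisym)
  have "Min (insert 1 (f ` \<tau>)) \<le> f v" by (rule Min_le) (use assms in auto)
  then show "simplex_cutoff f \<tau> \<le> 0" using assms(4) by (simp add: simplex_cutoff_def)
qed (rule simplex_cutoff_nonneg[OF assms(1,2)])

context weighted_complex
begin

lemma adjacentI:
  assumes "\<sigma> \<in> S" "x \<in> \<sigma>" "y \<in> \<sigma>" "x \<noteq> y"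
  shows "adjacent S x y"
proof -
  have "{x, y} \<in> S" by (rule subsimplex[OF assms(1)]) (use assms in auto)
  then show ?thesis using assms(4) by (simp add: adjacent_def simplices_def sdim_def)
qed

lemma lower_kernel_eq_0:
  assumes "\<tau> \<in> S" "\<tau>' \<in> S" "\<tau> \<noteq> \<tau>'" "\<not> (face S (\<tau> \<inter> \<tau>') \<tau> \<and> face S (\<tau> \<inter> \<tau>') \<tau>')"
  shows "lower_kernel \<tau> \<tau>' = 0"
  using lower_kernel_off_diagonal[OF assms(1-3)] assms(4) by (metis abs_eq_0)

lemma sum_le_l2_inner:
  assumes "u \<in> l2_space S m" "finite F" "F \<subseteq> S"
  shows "(\<Sum>\<tau>\<in>F. m \<tau> * (u \<tau>)\<^sup>2) \<le> l2_inner S m u u"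
  unfolding l2_inner_self
  by (rule finite_sum_le_infsum) (use assms m_nonneg in \<open>auto simp: l2_space_def\<close>)

text \<open>Neighbours exchange \<open>x\<close> for \<open>x'\<close> inside a common coface, so
  these vertices are adjacent. As \<open>x\<close> lies in \<open>\<tau>\<close>, the simplex
  \<open>\<tau>\<close> competes in the infimum defining \<open>w_upper\<close>, and its term there
  is governed by the row sum \<open>A\<close> of the same \<open>\<tau>\<close>.\<close>

lemma upper_cutoff_error:
  assumes F: "finite F" "F \<subseteq> S" and u: "u \<in> l2_space S m" and "0 \<le> c"
    and lip: "\<And>x y. adjacent S x y \<Longrightarrow> ennreal \<bar>f x - f y\<bar> \<le> ennreal c * w_upper S m x y"
  shows "(\<Sum>\<tau>\<in>F. \<Sum>\<tau>'\<in>F. \<bar>upper_kernel \<tau> \<tau>'\<bar> * \<bar>u \<tau>\<bar> * \<bar>u \<tau>'\<bar> * (simplex_cutoff f \<tau> - simplex_cutoff f \<tau>')\<^sup>2)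
    \<le> c\<^sup>2 * l2_inner S m u u"
proof -
  let ?\<eta> = "simplex_cutoff f"
  have "(\<Sum>\<tau>\<in>F. \<Sum>\<tau>'\<in>F. (\<bar>upper_kernel \<tau> \<tau>'\<bar> * (?\<eta> \<tau> - ?\<eta> \<tau>')\<^sup>2) * (\<bar>u \<tau>\<bar> * \<bar>u \<tau>'\<bar>))
      \<le> c\<^sup>2 * (\<Sum>\<tau>\<in>F. m \<tau> * (u \<tau>)\<^sup>2)"
  proof (rule schur_bound)
    fix \<tau> assume "\<tau> \<in> F"
    then have \<tau>: "\<tau> \<in> S" using F by auto
    define G where "G = F \<inter> upper_neighbours \<tau>"
    define A where "A = (\<Sum>\<tau>'\<in>G. m (\<tau> \<union> \<tau>'))"
    have G: "finite G" "G \<subseteq> upper_neighbours \<tau>" "G \<subseteq> S" using F by (auto simp: G_def)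
    have nbD: "face S \<tau> (\<tau> \<union> \<tau>')" "face S \<tau>' (\<tau> \<union> \<tau>')" "\<tau> \<noteq> \<tau>'" "\<tau> \<union> \<tau>' \<in> S" if "\<tau>' \<in> G" for \<tau>'
      using that G by (auto simp: upper_neighbours_def face_def)
    have A0: "0 \<le> A" unfolding A_def by (intro sum_nonneg m_nonneg nbD)
    have "(\<Sum>\<tau>'\<in>F. \<bar>upper_kernel \<tau> \<tau>'\<bar> * (?\<eta> \<tau> - ?\<eta> \<tau>')\<^sup>2) = (\<Sum>\<tau>'\<in>G. m (\<tau> \<union> \<tau>') * (?\<eta> \<tau> - ?\<eta> \<tau>')\<^sup>2)"
    proof (rule sum.mono_neutral_cong_right[OF F(1)])
      show "\<forall>\<tau>'\<in>F - G. \<bar>upper_kernel \<tau> \<tau>'\<bar> * (?\<eta> \<tau> - ?\<eta> \<tau>')\<^sup>2 = 0"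
      proof
        fix \<tau>' assume "\<tau>' \<in> F - G"
        then have "\<tau>' = \<tau> \<or> upper_kernel \<tau> \<tau>' = 0"
          using upper_kernel_eq_0[OF \<tau>, of \<tau>'] F unfolding G_def by blast
        then show "\<bar>upper_kernel \<tau> \<tau>'\<bar> * (?\<eta> \<tau> - ?\<eta> \<tau>')\<^sup>2 = 0" by auto
      qed
      fix \<tau>' assume "\<tau>' \<in> G"
      then show "\<bar>upper_kernel \<tau> \<tau>'\<bar> * (?\<eta> \<tau> - ?\<eta> \<tau>')\<^sup>2 = m (\<tau> \<union> \<tau>') * (?\<eta> \<tau> - ?\<eta> \<tau>')\<^sup>2"
        using upper_kernel_off_diagonal[OF \<tau>, of \<tau>'] nbD[of \<tau>'] G by auto
    qed (auto simp: G_def)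
    also have "\<dots> \<le> c\<^sup>2 * m \<tau>"
    proof (rule weighted_sum_le[OF G(1)])
      show "0 \<le> c\<^sup>2 * m \<tau>" using m_nonneg[OF \<tau>] by simp
      fix \<tau>' assume \<tau>': "\<tau>' \<in> G"
      show "0 \<le> m (\<tau> \<union> \<tau>')" by (intro m_nonneg nbD \<tau>')
      obtain x x' where x: "\<tau> = insert x (\<tau> \<inter> \<tau>')" "\<tau>' = insert x' (\<tau> \<inter> \<tau>')" "x \<noteq> x'" "x \<in> \<tau>" "x' \<in> \<tau>'"
        using common_cofaceE[OF nbD(1-3)[OF \<tau>']] by metis
      have adj: "adjacent S x x'"
        by (rule adjacentI[OF nbD(4)[OF \<tau>']]) (use x in auto)
      let ?X = "ennreal (real_of_int (sdim \<tau> + 1) / m \<tau>) * (\<Sum>\<^sub>\<infinity>\<sigma>\<in>{\<sigma>. face S \<tau> \<sigma>}. ennreal (m \<sigma>))"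
      have "w_upper S m x x' \<le> inv_sqrt ?X"
        unfolding w_upper_def by (rule INF_lower) (use \<tau> x in auto)
      then have "ennreal \<bar>f x - f x'\<bar> \<le> ennreal c * inv_sqrt ?X"
        using lip[OF adj] by (meson mult_left_mono order_trans zero_le)
      moreover have "ennreal (A / m \<tau>) \<le> ?X"
      proof -
        \<comment> \<open>The factor \<open>sdim \<tau> + 1\<close> of \<open>w_upper\<close> is
          \<open>card \<tau>\<close>, the largest number of neighbours that can share one
          coface.\<close>
        have "A / m \<tau> \<le> card \<tau> * (\<Sum>\<sigma>\<in>(\<union>) \<tau> ` G. m \<sigma>) / m \<tau>"
          unfolding A_def by (intro divide_right_mono sum_upper_neighbours_le \<tau> G m_nonneg)
        also have "\<dots> = real_of_int (sdim \<tau> + 1) / m \<tau> * (\<Sum>\<sigma>\<in>(\<union>) \<tau> ` G. m \<sigma>)"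
          by (simp add: sdim_def)
        finally have "ennreal (A / m \<tau>) \<le> ennreal (real_of_int (sdim \<tau> + 1) / m \<tau> * (\<Sum>\<sigma>\<in>(\<union>) \<tau> ` G. m \<sigma>))"
          by (rule ennreal_leI)
        also have "\<dots> = ennreal (real_of_int (sdim \<tau> + 1) / m \<tau>) * ennreal (\<Sum>\<sigma>\<in>(\<union>) \<tau> ` G. m \<sigma>)"
          using m_nonneg[OF \<tau>] by (intro ennreal_mult') (simp add: sdim_def)
        also have "\<dots> \<le> ?X"
          by (intro mult_left_mono sum_le_infsum_ennreal) (use G nbD m_nonneg in auto)
        finally show ?thesis .
      qed
      ultimately have "A / m \<tau> * \<bar>f x - f x'\<bar>\<^sup>2 \<le> c\<^sup>2"
        by (rule inv_sqrt_bound) (use A0 m_nonneg[OF \<tau>] \<open>0 \<le> c\<close> in auto)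
      then have "A * (f x - f x')\<^sup>2 \<le> c\<^sup>2 * m \<tau>"
        using m_pos[OF \<tau>] by (simp add: pos_divide_le_eq)
      moreover have "A * (?\<eta> \<tau> - ?\<eta> \<tau>')\<^sup>2 \<le> A * (f x - f x')\<^sup>2"
        using simplex_cutoff_diff[of "\<tau> \<inter> \<tau>'" f x x'] finite_simplex[OF \<tau>] x(1,2) A0
        by (intro mult_left_mono) auto
      ultimately show "(\<Sum>\<tau>'\<in>G. m (\<tau> \<union> \<tau>')) * (?\<eta> \<tau> - ?\<eta> \<tau>')\<^sup>2 \<le> c\<^sup>2 * m \<tau>"
        unfolding A_def by linarith
    qed
    finally show "(\<Sum>\<tau>'\<in>F. \<bar>upper_kernel \<tau> \<tau>'\<bar> * (?\<eta> \<tau> - ?\<eta> \<tau>')\<^sup>2) \<le> c\<^sup>2 * m \<tau>" .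
  qed (simp_all add: upper_kernel_commute power2_commute)
  also have "\<dots> \<le> c\<^sup>2 * l2_inner S m u u"
    by (intro mult_left_mono sum_le_l2_inner u F) auto
  finally show ?thesis by (simp add: mult_ac)
qed

text \<open>Faces \<open>\<rho>\<close> with \<open>\<rho> \<noteq> {}\<close>: the two vertices exchanged between \<open>\<tau>\<close> and \<open>\<tau>'\<close> need not be adjacent,
  but both are adjacent to any vertex of \<open>\<rho>\<close>. This is what the factor \<open>1/2\<close> in \<^const>\<open>w_lower\<close> is for.\<close>

lemma lower_cutoff_error_nonempty:
  assumes F: "finite F" "F \<subseteq> S" and u: "u \<in> l2_space S m" and "0 \<le> c"
    and lip: "\<And>x y. adjacent S x y \<Longrightarrow> ennreal \<bar>f x - f y\<bar> \<le> ennreal c * w_lower S m x y"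
  shows "(\<Sum>\<tau>\<in>F. \<Sum>\<tau>'\<in>F. if \<tau> \<inter> \<tau>' = {} then 0 else
      \<bar>lower_kernel \<tau> \<tau>'\<bar> * \<bar>u \<tau>\<bar> * \<bar>u \<tau>'\<bar> * (simplex_cutoff f \<tau> - simplex_cutoff f \<tau>')\<^sup>2)
    \<le> c\<^sup>2 * l2_inner S m u u"
proof -
  let ?\<eta> = "simplex_cutoff f"
  define K where "K \<tau> \<tau>' = (if \<tau> \<inter> \<tau>' = {} then 0 else \<bar>lower_kernel \<tau> \<tau>'\<bar> * (?\<eta> \<tau> - ?\<eta> \<tau>')\<^sup>2)" for \<tau> \<tau>'
  have "(\<Sum>\<tau>\<in>F. \<Sum>\<tau>'\<in>F. K \<tau> \<tau>' * (\<bar>u \<tau>\<bar> * \<bar>u \<tau>'\<bar>)) \<le> c\<^sup>2 * (\<Sum>\<tau>\<in>F. m \<tau> * (u \<tau>)\<^sup>2)"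
  proof (rule schur_bound)
    fix \<tau> assume "\<tau> \<in> F"
    then have \<tau>: "\<tau> \<in> S" using F by auto
    let ?N = "{\<tau>'. \<tau>' \<noteq> \<tau> \<and> face S (\<tau> \<inter> \<tau>') \<tau> \<and> face S (\<tau> \<inter> \<tau>') \<tau>'}"
    define G where "G = {\<tau>'\<in>F. \<tau> \<inter> \<tau>' \<noteq> {} \<and> \<tau>' \<in> ?N}"
    define A where "A = (\<Sum>\<tau>'\<in>G. m \<tau>' / m (\<tau> \<inter> \<tau>'))"
    have G: "finite G" "G \<subseteq> ?N" "G \<subseteq> S" using F by (auto simp: G_def)
    have nbD: "face S (\<tau> \<inter> \<tau>') \<tau>" "face S (\<tau> \<inter> \<tau>') \<tau>'" "\<tau> \<noteq> \<tau>'" "\<tau> \<inter> \<tau>' \<noteq> {}" "\<tau>' \<in> S" "\<tau> \<inter> \<tau>' \<in> S"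
      if "\<tau>' \<in> G" for \<tau>'
      using that G by (auto simp: G_def face_def)
    have a0: "0 \<le> m \<tau>' / m (\<tau> \<inter> \<tau>')" if "\<tau>' \<in> G" for \<tau>'
      by (intro divide_nonneg_nonneg m_nonneg nbD that)
    then have A0: "0 \<le> A" unfolding A_def by (rule sum_nonneg)
    have "(\<Sum>\<tau>'\<in>F. K \<tau> \<tau>') = (\<Sum>\<tau>'\<in>G. m \<tau> * (m \<tau>' / m (\<tau> \<inter> \<tau>') * (?\<eta> \<tau> - ?\<eta> \<tau>')\<^sup>2))"
    proof (rule sum.mono_neutral_cong_right[OF F(1)])
      show "\<forall>\<tau>'\<in>F - G. K \<tau> \<tau>' = 0"
      proof
        fix \<tau>' assume \<tau>': "\<tau>' \<in> F - G"
        show "K \<tau> \<tau>' = 0"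
        proof (cases "\<tau>' = \<tau> \<or> \<tau> \<inter> \<tau>' = {}")
          case False
          then have "lower_kernel \<tau> \<tau>' = 0"
            using \<tau>' F by (intro lower_kernel_eq_0 \<tau>) (auto simp: G_def)
          then show ?thesis by (simp add: K_def)
        qed (auto simp: K_def)
      qed
      fix \<tau>' assume "\<tau>' \<in> G"
      then show "K \<tau> \<tau>' = m \<tau> * (m \<tau>' / m (\<tau> \<inter> \<tau>') * (?\<eta> \<tau> - ?\<eta> \<tau>')\<^sup>2)"
        using lower_kernel_off_diagonal[OF \<tau>, of \<tau>'] nbD[of \<tau>'] by (simp add: K_def)
    qed (auto simp: G_def)
    also have "\<dots> = m \<tau> * (\<Sum>\<tau>'\<in>G. m \<tau>' / m (\<tau> \<inter> \<tau>') * (?\<eta> \<tau> - ?\<eta> \<tau>')\<^sup>2)"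
      by (simp only: sum_distrib_left)
    also have "\<dots> \<le> m \<tau> * c\<^sup>2"
    proof (intro mult_left_mono m_nonneg \<tau>, rule weighted_sum_le[OF G(1) a0])
      fix \<tau>' assume \<tau>': "\<tau>' \<in> G"
      obtain x x' where x: "\<tau> = insert x (\<tau> \<inter> \<tau>')" "\<tau>' = insert x' (\<tau> \<inter> \<tau>')" "x \<noteq> x'" "x \<in> \<tau>" "x' \<in> \<tau>'"
        using common_faceE[OF nbD(1-3)[OF \<tau>']] by metis
      obtain y where y: "y \<in> \<tau>" "y \<in> \<tau>'" using nbD(4)[OF \<tau>'] by blast
      let ?X = "\<Sum>\<^sub>\<infinity>\<tau>'\<in>?N. ennreal (m \<tau>' / m (\<tau> \<inter> \<tau>'))"
      \<comment> \<open>Used for \<open>z = x\<close> and \<open>z = x'\<close>. Although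
        \<open>x'\<close> is not in \<open>\<tau>\<close>, the endpoint \<open>y\<close> is, so
        \<open>\<tau>\<close> competes in both infima and the same row sum \<open>A\<close> controls
        both edges.\<close>
      have half: "A * \<bar>f z - f y\<bar>\<^sup>2 \<le> (c / 2)\<^sup>2" if adj: "adjacent S z y" for z
      proof (rule inv_sqrt_bound)
        have "w_lower S m z y \<le> ennreal (1/2) * inv_sqrt ?X"
          unfolding w_lower_def by (rule INF_lower) (use \<tau> y in auto)
        then have "ennreal \<bar>f z - f y\<bar> \<le> ennreal c * (ennreal (1/2) * inv_sqrt ?X)"
          using lip[OF adj] by (meson mult_left_mono order_trans zero_le)
        also have "\<dots> = ennreal (c / 2) * inv_sqrt ?X"
          using ennreal_mult'[of c "1/2"] \<open>0 \<le> c\<close> by (simp add: mult.assoc)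
        finally show "ennreal \<bar>f z - f y\<bar> \<le> ennreal (c / 2) * inv_sqrt ?X" .
        show "ennreal A \<le> ?X"
          unfolding A_def by (rule sum_le_infsum_ennreal[OF G(1,2) a0])
      qed (use A0 \<open>0 \<le> c\<close> in auto)
      have xy: "A * (f x - f y)\<^sup>2 \<le> c\<^sup>2 / 4"
      proof (cases "x = y")
        case False
        then show ?thesis using half[OF adjacentI[OF \<tau> x(4) y(1)]] by (simp add: power_divide)
      qed simp
      have x'y: "A * (f x' - f y)\<^sup>2 \<le> c\<^sup>2 / 4"
      proof (cases "x' = y")
        case False
        then show ?thesis using half[OF adjacentI[OF nbD(5)[OF \<tau>'] x(5) y(2)]] by (simp add: power_divide)
      qed simp
      \<comment> \<open>The detour through \<open>y\<close> costs a factor 2 on each of two squares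
        bounded by \<open>c\<^sup>2 / 4\<close> after multiplication by \<open>A\<close>, so the
        total is exactly \<open>c\<^sup>2\<close>.\<close>
      have "(f x - f x')\<^sup>2 \<le> 2 * (f x - f y)\<^sup>2 + 2 * (f x' - f y)\<^sup>2"
        using zero_le_power2[of "(f x - f y) + (f x' - f y)"] by (simp add: power2_eq_square algebra_simps)
      then have "A * (f x - f x')\<^sup>2 \<le> A * (2 * (f x - f y)\<^sup>2 + 2 * (f x' - f y)\<^sup>2)"
        using A0 by (rule mult_left_mono)
      also have "\<dots> = 2 * (A * (f x - f y)\<^sup>2) + 2 * (A * (f x' - f y)\<^sup>2)"
        by (simp add: algebra_simps)
      also have "\<dots> \<le> c\<^sup>2" using xy x'y by linarith
      finally have "A * (f x - f x')\<^sup>2 \<le> c\<^sup>2" .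
      moreover have "A * (?\<eta> \<tau> - ?\<eta> \<tau>')\<^sup>2 \<le> A * (f x - f x')\<^sup>2"
        using simplex_cutoff_diff[of "\<tau> \<inter> \<tau>'" f x x'] finite_simplex[OF \<tau>] x(1,2) A0
        by (intro mult_left_mono) auto
      ultimately show "(\<Sum>\<tau>'\<in>G. m \<tau>' / m (\<tau> \<inter> \<tau>')) * (?\<eta> \<tau> - ?\<eta> \<tau>')\<^sup>2 \<le> c\<^sup>2"
        unfolding A_def by linarith
    qed auto
    finally show "(\<Sum>\<tau>'\<in>F. K \<tau> \<tau>') \<le> c\<^sup>2 * m \<tau>" by (simp add: mult.commute)
  qed (simp_all add: K_def lower_kernel_commute power2_commute Int_commute)
  also have "\<dots> \<le> c\<^sup>2 * l2_inner S m u u"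
    by (intro mult_left_mono sum_le_l2_inner u F) auto
  also have "(\<Sum>\<tau>\<in>F. \<Sum>\<tau>'\<in>F. K \<tau> \<tau>' * (\<bar>u \<tau>\<bar> * \<bar>u \<tau>'\<bar>)) = (\<Sum>\<tau>\<in>F. \<Sum>\<tau>'\<in>F. if \<tau> \<inter> \<tau>' = {} then 0 else
      \<bar>lower_kernel \<tau> \<tau>'\<bar> * \<bar>u \<tau>\<bar> * \<bar>u \<tau>'\<bar> * (?\<eta> \<tau> - ?\<eta> \<tau>')\<^sup>2)"
    by (intro sum.cong refl) (simp add: K_def mult_ac)
  finally show ?thesis .
qed

text \<open>The face \<open>\<rho> = {}\<close> couples all vertices, at any distance. Its contribution is small because
  the vertices have finite total mass and the cutoff equals \<open>1\<close> on most of it.\<close>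

lemma lower_cutoff_error_empty:
  fixes \<eta> :: "'v set \<Rightarrow> real"
  assumes F: "finite F" "F \<subseteq> S"
    and \<eta>: "\<And>\<tau>. \<tau> \<in> S \<Longrightarrow> 0 \<le> \<eta> \<tau> \<and> \<eta> \<tau> \<le> 1" "\<And>\<tau>. \<tau> \<in> B \<Longrightarrow> \<eta> \<tau> = 1"
    and W: "\<And>G. finite G \<Longrightarrow> G \<subseteq> {\<tau>. face S {} \<tau>} \<Longrightarrow> (\<Sum>\<tau>\<in>G. m \<tau> * \<bar>u \<tau>\<bar>) \<le> W"
    and t: "\<And>G. finite G \<Longrightarrow> G \<subseteq> {\<tau>. face S {} \<tau>} - B \<Longrightarrow> (\<Sum>\<tau>\<in>G. m \<tau> * \<bar>u \<tau>\<bar>) \<le> t"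
    and E: "{} \<in> S"
  shows "(\<Sum>\<tau>\<in>F. \<Sum>\<tau>'\<in>F. if \<tau> \<inter> \<tau>' = {} then
      \<bar>lower_kernel \<tau> \<tau>'\<bar> * \<bar>u \<tau>\<bar> * \<bar>u \<tau>'\<bar> * (\<eta> \<tau> - \<eta> \<tau>')\<^sup>2 else 0) \<le> 2 * W * t / m {}"
proof -
  \<comment> \<open>For the empty common face the kernel factorizes: its product with \<bar>u\<bar>
    at both simplices is \<open>g \<tau> * g \<tau>' / m {}\<close>. The function \<open>b\<close>
    marks the simplices outside \<open>B\<close>.\<close>
  define g where "g \<tau> = (if face S {} \<tau> then m \<tau> * \<bar>u \<tau>\<bar> else 0)" for \<tau>
  define b where "b \<tau> = (if \<tau> \<in> B then 0 else (1::real))" for \<tau>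
  have g0: "0 \<le> g \<tau>" for \<tau> using m_nonneg[of \<tau>] by (simp add: g_def face_def)
  have b0: "0 \<le> b \<tau>" for \<tau> by (simp add: b_def)
  have m0: "m {} > 0" by (rule m_pos[OF E])
  have "(\<Sum>\<tau>\<in>F. \<Sum>\<tau>'\<in>F. if \<tau> \<inter> \<tau>' = {} then
      \<bar>lower_kernel \<tau> \<tau>'\<bar> * \<bar>u \<tau>\<bar> * \<bar>u \<tau>'\<bar> * (\<eta> \<tau> - \<eta> \<tau>')\<^sup>2 else 0)
    \<le> (\<Sum>\<tau>\<in>F. \<Sum>\<tau>'\<in>F. (g \<tau> * b \<tau> * g \<tau>' + g \<tau> * (g \<tau>' * b \<tau>')) / m {})"
  proof (intro sum_mono)
    fix \<tau> \<tau>' assume "\<tau> \<in> F" "\<tau>' \<in> F"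
    then have \<tau>: "\<tau> \<in> S" "\<tau>' \<in> S" using F by auto
    have rhs0: "0 \<le> (g \<tau> * b \<tau> * g \<tau>' + g \<tau> * (g \<tau>' * b \<tau>')) / m {}"
      using g0 b0 m0 by simp
    show "(if \<tau> \<inter> \<tau>' = {} then \<bar>lower_kernel \<tau> \<tau>'\<bar> * \<bar>u \<tau>\<bar> * \<bar>u \<tau>'\<bar> * (\<eta> \<tau> - \<eta> \<tau>')\<^sup>2 else 0)
      \<le> (g \<tau> * b \<tau> * g \<tau>' + g \<tau> * (g \<tau>' * b \<tau>')) / m {}"
    proof (cases "\<tau> \<inter> \<tau>' = {} \<and> \<tau> \<noteq> \<tau>' \<and> face S {} \<tau> \<and> face S {} \<tau>'")
      case True
      \<comment> \<open>On \<open>B\<close> both cutoffs are 1 and the difference vanishes;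
        otherwise the right side is at least 1. Each summand produces a total mass times a tail,
        whence the factor 2 in the bound.\<close>
      have "(\<eta> \<tau> - \<eta> \<tau>')\<^sup>2 \<le> b \<tau> + b \<tau>'"
      proof (cases "\<tau> \<in> B \<and> \<tau>' \<in> B")
        case True
        then show ?thesis using \<eta>(2) by (simp add: b_def)
      next
        case False
        have "\<bar>\<eta> \<tau> - \<eta> \<tau>'\<bar> \<le> 1" using \<eta>(1)[OF \<tau>(1)] \<eta>(1)[OF \<tau>(2)] by linarith
        then have "(\<eta> \<tau> - \<eta> \<tau>')\<^sup>2 \<le> 1" by (simp add: abs_square_le_1)
        then show ?thesis using False by (auto simp: b_def)
      qed
      then have "g \<tau> * g \<tau>' / m {} * (\<eta> \<tau> - \<eta> \<tau>')\<^sup>2 \<le> g \<tau> * g \<tau>' / m {} * (b \<tau> + b \<tau>')"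
        using g0 m0 by (intro mult_left_mono) auto
      moreover have "\<bar>lower_kernel \<tau> \<tau>'\<bar> * \<bar>u \<tau>\<bar> * \<bar>u \<tau>'\<bar> = g \<tau> * g \<tau>' / m {}"
        using lower_kernel_off_diagonal[OF \<tau>] True by (simp add: g_def)
      ultimately show ?thesis using True by (simp add: algebra_simps add_divide_distrib)
    next
      case False
      then have "\<tau> \<inter> \<tau>' \<noteq> {} \<or> \<tau> = \<tau>' \<or> lower_kernel \<tau> \<tau>' = 0"
        using lower_kernel_eq_0[OF \<tau>] by metis
      then show ?thesis using rhs0 by auto
    qed
  qed
  also have "\<dots> = 2 * (\<Sum>\<tau>\<in>F. g \<tau>) * (\<Sum>\<tau>\<in>F. g \<tau> * b \<tau>) / m {}"
  proof -
    have "(\<Sum>\<tau>\<in>F. \<Sum>\<tau>'\<in>F. g \<tau> * b \<tau> * g \<tau>') = (\<Sum>\<tau>\<in>F. g \<tau> * b \<tau>) * (\<Sum>\<tau>\<in>F. g \<tau>)"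
      "(\<Sum>\<tau>\<in>F. \<Sum>\<tau>'\<in>F. g \<tau> * (g \<tau>' * b \<tau>')) = (\<Sum>\<tau>\<in>F. g \<tau>) * (\<Sum>\<tau>\<in>F. g \<tau> * b \<tau>)"
      by (simp_all only: sum_product)
    then show ?thesis by (simp add: sum.distrib flip: sum_divide_distrib)
  qed
  also have "\<dots> \<le> 2 * W * t / m {}"
  proof -
    have sg: "(\<Sum>\<tau>\<in>F. g \<tau>) = (\<Sum>\<tau>\<in>F \<inter> {\<tau>. face S {} \<tau>}. m \<tau> * \<bar>u \<tau>\<bar>)"
      by (rule sum.mono_neutral_cong_right[OF F(1)]) (auto simp: g_def)
    have sb: "(\<Sum>\<tau>\<in>F. g \<tau> * b \<tau>) = (\<Sum>\<tau>\<in>F \<inter> ({\<tau>. face S {} \<tau>} - B). m \<tau> * \<bar>u \<tau>\<bar>)"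
      by (rule sum.mono_neutral_cong_right[OF F(1)]) (auto simp: g_def b_def)
    have "(\<Sum>\<tau>\<in>F. g \<tau>) \<le> W" unfolding sg by (rule W) (use F in auto)
    moreover have "(\<Sum>\<tau>\<in>F. g \<tau> * b \<tau>) \<le> t" unfolding sb by (rule t) (use F in auto)
    moreover have "0 \<le> (\<Sum>\<tau>\<in>F. g \<tau>)" "0 \<le> (\<Sum>\<tau>\<in>F. g \<tau> * b \<tau>)"
      using g0 b0 by (auto intro!: sum_nonneg)
    ultimately have "(\<Sum>\<tau>\<in>F. g \<tau>) * (\<Sum>\<tau>\<in>F. g \<tau> * b \<tau>) \<le> W * t"
      by (intro mult_mono) auto
    then show ?thesis using m0 by (simp add: divide_right_mono mult.assoc)
  qed
  finally show ?thesis .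
qed

end


section \<open>Cutoffs from the path metric\<close>

lemma adjacent_commute: "adjacent S x y \<longleftrightarrow> adjacent S y x"
  by (auto simp: adjacent_def insert_commute)

lemma edge_length_commute: "edge_length S m c x y = edge_length S m c y x"
  by (cases c) (auto simp: w_upper_def w_lower_def insert_commute)

lemma path_metric_refl: "path_metric S m c v v = 0"
proof -
  have "path_metric S m c v v \<le> 0"
    unfolding path_metric_def
    by (rule Inf_lower) (auto intro!: exI[of _ "0::nat"] exI[of _ "\<lambda>_. v"])
  then show ?thesis by simp
qed

text \<open>Appending \<open>v'\<close> to a path ending at \<open>v\<close>. A finite edge length
  is subtracted first, so that the infimum over paths can be bounded directly; an infinite one makes
  the claim trivial.\<close>

lemma path_metric_step:
  assumes adj: "adjacent S v v'"
  shows "path_metric S m c e v' \<le> edge_length S m c v v' + path_metric S m c e v"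
proof (cases "edge_length S m c v v' = top")
  case False
  have "path_metric S m c e v' - edge_length S m c v v' \<le> path_metric S m c e v"
    unfolding path_metric_def[of S m c e v]
  proof (rule Inf_greatest, clarify)
    fix n p assume p: "e = p 0" "v = p n" "\<forall>k<n. adjacent S (p k) (p (Suc k))"
    define q where "q = p(Suc n := v')"
    have "(\<Sum>k<Suc n. edge_length S m c (q k) (q (Suc k)))
        = (\<Sum>k<n. edge_length S m c (p k) (p (Suc k))) + edge_length S m c v v'"
      by (simp add: q_def p(2))
    moreover have "path_metric S m c e v' \<le> (\<Sum>k<Suc n. edge_length S m c (q k) (q (Suc k)))"
      unfolding path_metric_def
    proof (rule Inf_lower, rule CollectI, intro exI conjI)
      show "\<forall>k<Suc n. adjacent S (q k) (q (Suc k))"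
        using p adj by (auto simp: q_def less_Suc_eq)
    qed (auto simp: q_def p)
    ultimately show "path_metric S m c (p 0) v' - edge_length S m c (p n) v'
        \<le> (\<Sum>k<n. edge_length S m c (p k) (p (Suc k)))"
      using False p by (simp add: ennreal_minus_le_iff add.commute)
  qed
  then show ?thesis by (simp add: ennreal_minus_le_iff)
qed simp

text \<open>Distance from a set rather than a point: the cutoff has to be 1 on several simplices,
  which may lie at infinite distance from each other.\<close>

definition set_dist ::
  "'v set set \<Rightarrow> ('v set \<Rightarrow> real) \<Rightarrow> laplace_type \<Rightarrow> 'v set \<Rightarrow> 'v \<Rightarrow> ennreal" where
  "set_dist S m c E v = (INF e\<in>E. path_metric S m c e v)"

lemma set_dist_step:
  assumes "adjacent S v v'"
  shows "set_dist S m c E v' \<le> edge_length S m c v v' + set_dist S m c E v"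
proof (cases "edge_length S m c v v' = top")
  case False
  have "set_dist S m c E v' - edge_length S m c v v' \<le> set_dist S m c E v"
    unfolding set_dist_def[of S m c E v]
  proof (rule INF_greatest)
    fix e assume "e \<in> E"
    then have "set_dist S m c E v' \<le> path_metric S m c e v'"
      unfolding set_dist_def by (rule INF_lower)
    also have "\<dots> \<le> edge_length S m c v v' + path_metric S m c e v"
      by (rule path_metric_step[OF assms])
    finally show "set_dist S m c E v' - edge_length S m c v v' \<le> path_metric S m c e v"
      using False by (simp add: ennreal_minus_le_iff)
  qed
  then show ?thesis by (simp add: ennreal_minus_le_iff)
qed simp

text \<open>Infinite distance is treated apart because \<open>enn2real\<close> sends
  \<open>top\<close> to 0, which would give the value 1 instead of 0. The parameter \<open>r\<close>
  is the slope.\<close>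

definition dist_cutoff ::
  "'v set set \<Rightarrow> ('v set \<Rightarrow> real) \<Rightarrow> laplace_type \<Rightarrow> 'v set \<Rightarrow> real \<Rightarrow> 'v \<Rightarrow> real" where
  "dist_cutoff S m c E r v =
     (if set_dist S m c E v = top then 0 else max 0 (1 - r * enn2real (set_dist S m c E v)))"

lemma dist_cutoff_nonneg: "0 \<le> dist_cutoff S m c E r v"
  by (simp add: dist_cutoff_def)

lemma dist_cutoff_eq_1:
  assumes "v \<in> E"
  shows "dist_cutoff S m c E r v = 1"
proof -
  have "set_dist S m c E v \<le> path_metric S m c v v"
    unfolding set_dist_def by (rule INF_lower[OF assms])
  then have "set_dist S m c E v = 0" by (simp add: path_metric_refl)
  then show ?thesis by (simp add: dist_cutoff_def)
qed

text \<open>The value 0 at infinite distance causes no jump: across an edge of finite length, both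
  endpoints are at finite distance from \<open>E\<close> or neither is. Across an edge of infinite
  length there is nothing to prove since \<open>r\<close> is positive.\<close>

lemma dist_cutoff_lipschitz:
  assumes adj: "adjacent S x y" and r: "0 < r"
  shows "ennreal \<bar>dist_cutoff S m c E r x - dist_cutoff S m c E r y\<bar> \<le> ennreal r * edge_length S m c x y"
proof (cases "edge_length S m c x y = top")
  case True
  then show ?thesis using r by (simp add: ennreal_mult_top)
next
  case False
  then obtain w where w: "edge_length S m c x y = ennreal w" "0 \<le> w"
    by (cases "edge_length S m c x y") auto
  have 1: "set_dist S m c E y \<le> ennreal w + set_dist S m c E x"
    using set_dist_step[OF adj, of m c E] by (simp add: w)
  have 2: "set_dist S m c E x \<le> ennreal w + set_dist S m c E y"
    using set_dist_step[of S y x m c E] adj by (simp add: adjacent_commute edge_length_commute[of S m c y] w)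
  show ?thesis
  proof (cases "set_dist S m c E x = top \<or> set_dist S m c E y = top")
    case True
    then have "set_dist S m c E x = top" "set_dist S m c E y = top"
      using 1 2 by (auto simp: top_unique)
    then show ?thesis by (simp add: dist_cutoff_def)
  next
    case False
    then obtain a b where ab: "set_dist S m c E x = ennreal a" "set_dist S m c E y = ennreal b" "0 \<le> a" "0 \<le> b"
      by (cases "set_dist S m c E x"; cases "set_dist S m c E y") auto
    have "b \<le> w + a" "a \<le> w + b"
      using 1 2 ab w by (simp_all flip: ennreal_plus)
    then have "r * b \<le> r * (w + a)" "r * a \<le> r * (w + b)"
      using r by (auto intro: mult_left_mono)
    then have "\<bar>dist_cutoff S m c E r x - dist_cutoff S m c E r y\<bar> \<le> r * w"
      using ab by (simp add: dist_cutoff_def algebra_simps)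
    then have "ennreal \<bar>dist_cutoff S m c E r x - dist_cutoff S m c E r y\<bar> \<le> ennreal (r * w)"
      by (rule ennreal_leI)
    then show ?thesis using r w by (simp add: ennreal_mult)
  qed
qed

text \<open>A positive cutoff means distance strictly below \<open>1 / r\<close>, and strictness
  lets the infimum over \<open>E\<close> be undercut by a single member.\<close>

lemma dist_cutoff_support:
  assumes r: "0 < r" and v: "{v} \<in> S" and nz: "dist_cutoff S m c E r v \<noteq> 0"
  shows "\<exists>e\<in>E. v \<in> path_ball S m c e (1 / r)"
proof -
  obtain a where a: "set_dist S m c E v = ennreal a" "0 \<le> a"
    using nz by (cases "set_dist S m c E v") (auto simp: dist_cutoff_def)
  then have "r * a < 1" using nz by (auto simp: dist_cutoff_def max_def split: if_splits)
  then have "a < 1 / r" using r by (simp add: pos_less_divide_eq mult.commute)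
  then have "set_dist S m c E v < ennreal (1 / r)" using a by (simp add: ennreal_less_iff)
  then obtain e where "e \<in> E" "path_metric S m c e v < ennreal (1 / r)"
    unfolding set_dist_def by (auto simp: INF_less_iff)
  then show ?thesis using v by (auto simp: path_ball_def simplices_def sdim_def intro!: less_imp_le)
qed

text \<open>A function that is Lipschitz for the Hodge metric thus serves as a cutoff for both
  kernels at once.\<close>

lemma edge_length_Hodge_le:
  assumes "x \<noteq> y"
  shows "edge_length S m Hodge x y \<le> w_upper S m x y" "edge_length S m Hodge x y \<le> w_lower S m x y"
proof -
  have "1 / sqrt 2 \<le> (1::real)" by simp
  then have "ennreal (1 / sqrt 2) \<le> 1" by (metis ennreal_1 ennreal_leI)
  then have "edge_length S m Hodge x y \<le> 1 * min (w_upper S m x y) (w_lower S m x y)"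
    using assms by (simp only: edge_length.simps if_False) (intro mult_right_mono, auto)
  then show "edge_length S m Hodge x y \<le> w_upper S m x y" "edge_length S m Hodge x y \<le> w_lower S m x y"
    by auto
qed

section \<open>One cutoff for each Laplacian, and the conclusion\<close>

fun laplace_kernel ::
  "'v set set \<Rightarrow> ('v set \<Rightarrow> real) \<Rightarrow> 'v fun_op \<Rightarrow> laplace_type \<Rightarrow> 'v set \<Rightarrow> 'v set \<Rightarrow> real" where
  "laplace_kernel S m \<delta> Upper \<tau> \<tau>' = weighted_complex.upper_kernel S m \<delta> \<tau> \<tau>'"
| "laplace_kernel S m \<delta> Lower \<tau> \<tau>' = weighted_complex.lower_kernel S m \<delta> \<tau> \<tau>'"
| "laplace_kernel S m \<delta> Hodge \<tau> \<tau>' =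
    weighted_complex.upper_kernel S m \<delta> \<tau> \<tau>' + weighted_complex.lower_kernel S m \<delta> \<tau> \<tau>'"

context weighted_complex
begin

text \<open>\<open>B\<close> depends on \<open>u\<close> and \<open>e\<close> but not on the cutoff,
  so the cutoff can afterwards be built to equal 1 on \<open>B\<close>. When the empty simplex is
  present, local summability at it is the finite total mass of the vertices.\<close>

lemma lower_cutoff_error_empty_small:
  assumes u: "u \<in> l2_space S m" and e: "0 < e"
  shows "\<exists>B. finite B \<and> B \<subseteq> S \<and> (\<forall>F \<eta>. finite F \<longrightarrow> F \<subseteq> S \<longrightarrow> (\<forall>\<tau>\<in>S. 0 \<le> \<eta> \<tau> \<and> \<eta> \<tau> \<le> 1) \<longrightarrow>
    (\<forall>\<tau>\<in>B. \<eta> \<tau> = 1) \<longrightarrow> (\<Sum>\<tau>\<in>F. \<Sum>\<tau>'\<in>F. if \<tau> \<inter> \<tau>' = {} then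
      \<bar>lower_kernel \<tau> \<tau>'\<bar> * \<bar>u \<tau>\<bar> * \<bar>u \<tau>'\<bar> * (\<eta> \<tau> - \<eta> \<tau>')\<^sup>2 else 0) \<le> e)"
proof (cases "{} \<in> S")
  case False
  have "(\<Sum>\<tau>\<in>F. \<Sum>\<tau>'\<in>F. if \<tau> \<inter> \<tau>' = {} then
      \<bar>lower_kernel \<tau> \<tau>'\<bar> * \<bar>u \<tau>\<bar> * \<bar>u \<tau>'\<bar> * (\<eta> \<tau> - \<eta> \<tau>')\<^sup>2 else 0) = 0" if "F \<subseteq> S" for F \<eta>
  proof (intro sum.neutral ballI)
    fix \<tau> \<tau>' assume \<tau>: "\<tau> \<in> F" "\<tau>' \<in> F"
    show "(if \<tau> \<inter> \<tau>' = {} then \<bar>lower_kernel \<tau> \<tau>'\<bar> * \<bar>u \<tau>\<bar> * \<bar>u \<tau>'\<bar> * (\<eta> \<tau> - \<eta> \<tau>')\<^sup>2 else 0) = 0"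
    proof (cases "\<tau> = \<tau>' \<or> \<tau> \<inter> \<tau>' \<noteq> {}")
      case False
      then have "lower_kernel \<tau> \<tau>' = 0"
        using \<tau> that \<open>{} \<notin> S\<close> by (intro lower_kernel_eq_0) (auto simp: face_def)
      then show ?thesis by simp
    qed auto
  qed
  then show ?thesis using e by (intro exI[of _ "{}"]) (auto intro: less_imp_le)
next
  case True
  have m0: "m {} > 0" by (rule m_pos[OF True])
  let ?Z = "{\<tau>. face S {} \<tau>}"
  have ZS: "?Z \<subseteq> S" by (auto simp: face_def)
  have sm: "(\<lambda>\<tau>. m \<tau> * \<bar>u \<tau>\<bar>) summable_on ?Z"
  proof (rule summable_on_comparison_test)
    have "(\<lambda>\<tau>. m \<tau> * (u \<tau>)\<^sup>2) summable_on ?Z"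
      by (rule summable_on_subset_banach[OF _ ZS]) (use u in \<open>simp add: l2_space_def\<close>)
    then show "(\<lambda>\<tau>. m \<tau> + m \<tau> * (u \<tau>)\<^sup>2) summable_on ?Z"
      by (rule summable_on_add[OF cofaces_summable[OF True]])
    fix \<tau> assume "\<tau> \<in> ?Z"
    then have mp: "0 \<le> m \<tau>" using ZS m_nonneg by auto
    \<comment> \<open>Finite mass makes the constant 1 summable, so square summability of
      \<open>u\<close> on the vertices implies summability.\<close>
    have "\<bar>u \<tau>\<bar> \<le> 1 + (u \<tau>)\<^sup>2"
      using sum_squares_bound[of "\<bar>u \<tau>\<bar>" 1] abs_ge_zero[of "u \<tau>"] unfolding power2_abs power_one by linarith
    from mult_left_mono[OF this mp]
    show "m \<tau> * \<bar>u \<tau>\<bar> \<le> m \<tau> + m \<tau> * (u \<tau>)\<^sup>2" by (simp add: distrib_left)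
    show "0 \<le> m \<tau> * \<bar>u \<tau>\<bar>" using mp by simp
  qed
  have g0: "0 \<le> m \<tau> * \<bar>u \<tau>\<bar>" if "\<tau> \<in> ?Z" for \<tau> using that ZS m_nonneg[of \<tau>] by auto
  define W where "W = (\<Sum>\<^sub>\<infinity>\<tau>\<in>?Z. m \<tau> * \<bar>u \<tau>\<bar>)"
  have W: "(\<Sum>\<tau>\<in>G. m \<tau> * \<bar>u \<tau>\<bar>) \<le> W" if "finite G" "G \<subseteq> ?Z" for G
    unfolding W_def by (rule finite_sum_le_infsum[OF sm that]) (use g0 in blast)
  have W0: "0 \<le> W" unfolding W_def by (rule infsum_nonneg[OF g0])
  \<comment> \<open>Chosen to make \<open>2 * W * t / m {}\<close> at most \<open>e\<close>;
    \<open>W + 1\<close> avoids dividing by zero.\<close>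
  define t where "t = e * m {} / (2 * (W + 1))"
  have t: "0 < t" using e m0 W0 by (simp add: t_def)
  have "t / m {} = e / (2 * (W + 1))"
    using m0 by (simp add: t_def)
  then have "2 * W * t / m {} = 2 * W * (e / (2 * (W + 1)))"
    by (metis times_divide_eq_right)
  also have "\<dots> = e * (W / (W + 1))"
    using W0 by (simp add: field_simps)
  also have "\<dots> \<le> e * 1" using e W0 by (intro mult_left_mono) auto
  finally have bound: "2 * W * t / m {} \<le> e" by simp
  obtain B where B: "finite B" "B \<subseteq> ?Z" "dist (\<Sum>\<tau>\<in>B. m \<tau> * \<bar>u \<tau>\<bar>) W \<le> t"
    using infsum_finite_approximation[OF sm t] unfolding W_def by blast
  have tail: "(\<Sum>\<tau>\<in>G. m \<tau> * \<bar>u \<tau>\<bar>) \<le> t" if "finite G" "G \<subseteq> ?Z - B" for G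
  proof -
    have "(\<Sum>\<tau>\<in>B. m \<tau> * \<bar>u \<tau>\<bar>) + (\<Sum>\<tau>\<in>G. m \<tau> * \<bar>u \<tau>\<bar>) = (\<Sum>\<tau>\<in>B \<union> G. m \<tau> * \<bar>u \<tau>\<bar>)"
      by (rule sum.union_disjoint[symmetric]) (use B that in auto)
    also have "\<dots> \<le> W" by (rule W) (use B that in auto)
    finally show ?thesis using B(3) unfolding dist_real_def by linarith
  qed
  show ?thesis
  proof (intro exI[of _ B] conjI allI impI)
    fix F \<eta> assume "finite F" "F \<subseteq> S" "\<forall>\<tau>\<in>S. 0 \<le> \<eta> \<tau> \<and> \<eta> \<tau> \<le> (1::real)" "\<forall>\<tau>\<in>B. \<eta> \<tau> = 1"
    then show "(\<Sum>\<tau>\<in>F. \<Sum>\<tau>'\<in>F. if \<tau> \<inter> \<tau>' = {} then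
      \<bar>lower_kernel \<tau> \<tau>'\<bar> * \<bar>u \<tau>\<bar> * \<bar>u \<tau>'\<bar> * (\<eta> \<tau> - \<eta> \<tau>')\<^sup>2 else 0) \<le> e"
      by (intro order_trans[OF lower_cutoff_error_empty[where B = B and W = W and t = t] bound] W tail True) auto
  qed (use B ZS in auto)
qed

text \<open>The slope \<open>r\<close> is fixed by the norm of \<open>u\<close>, the set
  \<open>B\<close> by the tail at the empty face, and only then the center \<open>E\<close> of the
  cutoff. Enlarging \<open>E\<close> does not affect the Lipschitz constant, so the two demands do
  not interfere.\<close>

lemma cutoff_exists:
  assumes sub: "\<And>\<tau>. \<tau> \<in> S \<Longrightarrow> \<tau> \<subseteq> V" and vert: "\<And>v. v \<in> V \<Longrightarrow> {v} \<in> S"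
    and balls: "\<And>v r. v \<in> V \<Longrightarrow> finite (path_ball S m c v r)"
    and u: "u \<in> l2_space S m" and \<tau>0: "\<tau>0 \<in> S" and e: "0 < e"
  shows "\<exists>\<eta>. \<eta> \<tau>0 = 1 \<and> finite {\<tau>\<in>S. \<eta> \<tau> \<noteq> 0} \<and> (\<forall>F. finite F \<longrightarrow> F \<subseteq> S \<longrightarrow>
    (\<Sum>\<tau>\<in>F. \<Sum>\<tau>'\<in>F. \<bar>laplace_kernel S m \<delta> c \<tau> \<tau>'\<bar> * \<bar>u \<tau>\<bar> * \<bar>u \<tau>'\<bar> * (\<eta> \<tau> - \<eta> \<tau>')\<^sup>2) \<le> e)"
proof -
  define N where "N = l2_inner S m u u"
  have N: "0 \<le> N"
    unfolding N_def l2_inner_self by (intro infsum_nonneg mult_nonneg_nonneg m_nonneg) auto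
  \<comment> \<open>Gives \<open>r\<^sup>2 * N \<le> e / 4\<close>. The Hodge case adds three errors
    of this size: upper, lower over nonempty faces, lower over the empty face.\<close>
  define r where "r = sqrt (e / (4 * (N + 1)))"
  have r: "0 < r" using e N by (simp add: r_def)
  have "r\<^sup>2 * N = e / 4 * (N / (N + 1))" using e N by (simp add: r_def field_simps)
  also have "\<dots> \<le> e / 4 * 1" using e N by (intro mult_left_mono) auto
  finally have rN: "r\<^sup>2 * N \<le> e / 4" by simp
  obtain B where B: "finite B" "B \<subseteq> S" and
    B_err: "\<And>F \<eta>. \<lbrakk>finite F; F \<subseteq> S; \<forall>\<tau>\<in>S. 0 \<le> \<eta> \<tau> \<and> \<eta> \<tau> \<le> 1; \<forall>\<tau>\<in>B. \<eta> \<tau> = 1\<rbrakk> \<Longrightarrow>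
      (\<Sum>\<tau>\<in>F. \<Sum>\<tau>'\<in>F. if \<tau> \<inter> \<tau>' = {} then
      \<bar>lower_kernel \<tau> \<tau>'\<bar> * \<bar>u \<tau>\<bar> * \<bar>u \<tau>'\<bar> * (\<eta> \<tau> - \<eta> \<tau>')\<^sup>2 else 0) \<le> e / 4"
    using lower_cutoff_error_empty_small[OF u, of "e / 4"] e by auto
  \<comment> \<open>All vertices of \<open>\<tau>0\<close> and of the members of \<open>B\<close>
    are at distance 0, so the minimum over the vertices of each of these simplices is 1.\<close>
  define E where "E = \<tau>0 \<union> \<Union>B"
  have "finite (\<Union>B)" by (rule finite_Union[OF B(1)]) (use B(2) finite_simplex in blast)
  then have E: "finite E" "E \<subseteq> V"
    using B(2) sub \<tau>0 finite_simplex[OF \<tau>0] by (auto simp: E_def)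
  define f where "f = dist_cutoff S m c E r"
  define \<eta> where "\<eta> = simplex_cutoff f"
  have f0: "0 \<le> f v" for v by (simp add: f_def dist_cutoff_nonneg)
  have \<eta>1: "\<eta> \<tau> = 1" if "\<tau> \<in> insert \<tau>0 B" for \<tau>
    unfolding \<eta>_def
  proof (rule simplex_cutoff_eq_1)
    show "finite \<tau>" using that \<tau>0 B finite_simplex by auto
    show "f v = 1" if "v \<in> \<tau>" for v
      unfolding f_def by (rule dist_cutoff_eq_1) (use that \<open>\<tau> \<in> insert \<tau>0 B\<close> in \<open>auto simp: E_def\<close>)
  qed
  have fin: "finite {\<tau>\<in>S. \<eta> \<tau> \<noteq> 0}"
  proof (rule finite_subset)
    show "{\<tau>\<in>S. \<eta> \<tau> \<noteq> 0} \<subseteq> Pow (\<Union>x\<in>E. path_ball S m c x (1 / r))"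
    proof clarify
      fix \<tau> v assume \<tau>: "\<tau> \<in> S" "\<eta> \<tau> \<noteq> 0" "v \<in> \<tau>"
      then have "f v \<noteq> 0"
        using simplex_cutoff_eq_0[OF finite_simplex[OF \<tau>(1)], of f v] f0 by (auto simp: \<eta>_def)
      then show "v \<in> (\<Union>x\<in>E. path_ball S m c x (1 / r))"
        using dist_cutoff_support[OF r, of v S m c E] vert sub \<tau> by (auto simp: f_def)
    qed
    show "finite (Pow (\<Union>x\<in>E. path_ball S m c x (1 / r)))"
      using E balls by auto
  qed
  have lip: "ennreal \<bar>f x - f y\<bar> \<le> ennreal r * edge_length S m c x y" if "adjacent S x y" for x y
    unfolding f_def by (rule dist_cutoff_lipschitz[OF that r])
  define up where "up F = (\<Sum>\<tau>\<in>F. \<Sum>\<tau>'\<in>F. \<bar>upper_kernel \<tau> \<tau>'\<bar> * \<bar>u \<tau>\<bar> * \<bar>u \<tau>'\<bar> * (\<eta> \<tau> - \<eta> \<tau>')\<^sup>2)" for F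
  define lo where "lo F = (\<Sum>\<tau>\<in>F. \<Sum>\<tau>'\<in>F. \<bar>lower_kernel \<tau> \<tau>'\<bar> * \<bar>u \<tau>\<bar> * \<bar>u \<tau>'\<bar> * (\<eta> \<tau> - \<eta> \<tau>')\<^sup>2)" for F
  have upper: "up F \<le> e / 4" if F: "finite F" "F \<subseteq> S" and c: "c \<noteq> Lower" for F
  proof -
    have "ennreal \<bar>f x - f y\<bar> \<le> ennreal r * w_upper S m x y" if adj: "adjacent S x y" for x y
    proof -
      have "x \<noteq> y" using adj by (simp add: adjacent_def)
      then have "edge_length S m c x y \<le> w_upper S m x y"
        using c edge_length_Hodge_le(1)[of x y S m] by (cases c) auto
      then show ?thesis using lip[OF adj] by (meson mult_left_mono order_trans zero_le)
    qed
    from upper_cutoff_error[OF F u less_imp_le[OF r] this] rN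
    show ?thesis by (simp add: up_def \<eta>_def N_def)
  qed
  have lower: "lo F \<le> e / 2" if F: "finite F" "F \<subseteq> S" and c: "c \<noteq> Upper" for F
  proof -
    have l: "ennreal \<bar>f x - f y\<bar> \<le> ennreal r * w_lower S m x y" if adj: "adjacent S x y" for x y
    proof -
      have "x \<noteq> y" using adj by (simp add: adjacent_def)
      then have "edge_length S m c x y \<le> w_lower S m x y"
        using c edge_length_Hodge_le(2)[of x y S m] by (cases c) auto
      then show ?thesis using lip[OF adj] by (meson mult_left_mono order_trans zero_le)
    qed
    \<comment> \<open>Distinct simplices coupled by the lower kernel share the face
      \<open>\<tau> \<inter> \<tau>'\<close>; the Lipschitz bound handles nonempty faces and the
      choice of \<open>B\<close> the empty one.\<close>
    have "lo F = (\<Sum>\<tau>\<in>F. \<Sum>\<tau>'\<in>F. if \<tau> \<inter> \<tau>' = {} then 0 else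
        \<bar>lower_kernel \<tau> \<tau>'\<bar> * \<bar>u \<tau>\<bar> * \<bar>u \<tau>'\<bar> * (\<eta> \<tau> - \<eta> \<tau>')\<^sup>2)
      + (\<Sum>\<tau>\<in>F. \<Sum>\<tau>'\<in>F. if \<tau> \<inter> \<tau>' = {} then
        \<bar>lower_kernel \<tau> \<tau>'\<bar> * \<bar>u \<tau>\<bar> * \<bar>u \<tau>'\<bar> * (\<eta> \<tau> - \<eta> \<tau>')\<^sup>2 else 0)"
      unfolding lo_def sum.distrib[symmetric] by (intro sum.cong refl) auto
    moreover have "(\<Sum>\<tau>\<in>F. \<Sum>\<tau>'\<in>F. if \<tau> \<inter> \<tau>' = {} then 0 else
        \<bar>lower_kernel \<tau> \<tau>'\<bar> * \<bar>u \<tau>\<bar> * \<bar>u \<tau>'\<bar> * (\<eta> \<tau> - \<eta> \<tau>')\<^sup>2) \<le> r\<^sup>2 * N"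
      unfolding \<eta>_def N_def by (rule lower_cutoff_error_nonempty[OF F u less_imp_le[OF r] l])
    moreover have "(\<Sum>\<tau>\<in>F. \<Sum>\<tau>'\<in>F. if \<tau> \<inter> \<tau>' = {} then
        \<bar>lower_kernel \<tau> \<tau>'\<bar> * \<bar>u \<tau>\<bar> * \<bar>u \<tau>'\<bar> * (\<eta> \<tau> - \<eta> \<tau>')\<^sup>2 else 0) \<le> e / 4"
      by (rule B_err[OF F]) (use \<eta>1 finite_simplex f0 in
        \<open>auto simp: \<eta>_def intro: simplex_cutoff_nonneg simplex_cutoff_le_1\<close>)
    ultimately show ?thesis using rN by linarith
  qed
  show ?thesis
  proof (intro exI[of _ \<eta>] conjI allI impI fin)
    show "\<eta> \<tau>0 = 1" by (simp add: \<eta>1)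
    fix F assume F: "finite F" "F \<subseteq> S"
    show "(\<Sum>\<tau>\<in>F. \<Sum>\<tau>'\<in>F. \<bar>laplace_kernel S m \<delta> c \<tau> \<tau>'\<bar> * \<bar>u \<tau>\<bar> * \<bar>u \<tau>'\<bar> * (\<eta> \<tau> - \<eta> \<tau>')\<^sup>2) \<le> e"
    proof (cases c)
      case Upper
      then show ?thesis using upper[OF F] e by (simp add: up_def)
    next
      case Lower
      then show ?thesis using lower[OF F] e by (simp add: lo_def)
    next
      case Hodge
      have "(\<Sum>\<tau>\<in>F. \<Sum>\<tau>'\<in>F. \<bar>laplace_kernel S m \<delta> c \<tau> \<tau>'\<bar> * \<bar>u \<tau>\<bar> * \<bar>u \<tau>'\<bar> * (\<eta> \<tau> - \<eta> \<tau>')\<^sup>2) \<le> up F + lo F"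
        unfolding up_def lo_def sum.distrib[symmetric]
      proof (intro sum_mono)
        fix \<tau> \<tau>'
        have "\<bar>laplace_kernel S m \<delta> c \<tau> \<tau>'\<bar> * (\<bar>u \<tau>\<bar> * \<bar>u \<tau>'\<bar> * (\<eta> \<tau> - \<eta> \<tau>')\<^sup>2)
          \<le> (\<bar>upper_kernel \<tau> \<tau>'\<bar> + \<bar>lower_kernel \<tau> \<tau>'\<bar>) * (\<bar>u \<tau>\<bar> * \<bar>u \<tau>'\<bar> * (\<eta> \<tau> - \<eta> \<tau>')\<^sup>2)"
          by (intro mult_right_mono) (auto simp: Hodge)
        then show "\<bar>laplace_kernel S m \<delta> c \<tau> \<tau>'\<bar> * \<bar>u \<tau>\<bar> * \<bar>u \<tau>'\<bar> * (\<eta> \<tau> - \<eta> \<tau>')\<^sup>2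
          \<le> \<bar>upper_kernel \<tau> \<tau>'\<bar> * \<bar>u \<tau>\<bar> * \<bar>u \<tau>'\<bar> * (\<eta> \<tau> - \<eta> \<tau>')\<^sup>2
            + \<bar>lower_kernel \<tau> \<tau>'\<bar> * \<bar>u \<tau>\<bar> * \<bar>u \<tau>'\<bar> * (\<eta> \<tau> - \<eta> \<tau>')\<^sup>2"
          by (simp add: distrib_right mult.assoc)
      qed
      also have "\<dots> \<le> e" using upper[OF F] lower[OF F] Hodge e by simp
      finally show ?thesis .
    qed
  qed
qed

lemma laplacian_kernel:
  assumes F: "finite F" "F \<subseteq> S" "\<And>\<tau>. \<tau> \<notin> F \<Longrightarrow> \<phi> \<tau> = 0" and \<tau>': "\<tau>' \<in> S"
  shows "m \<tau>' * laplacian S m \<delta> c \<phi> \<tau>' = (\<Sum>\<tau>\<in>F. \<phi> \<tau> * laplace_kernel S m \<delta> c \<tau> \<tau>')"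
proof -
  have \<phi>: "\<phi> \<in> fin_supp S"
    using F by (auto simp: fin_supp_def fun_space_def intro: rev_finite_subset[of F])
  have U: "m \<tau>' * laplacian S m \<delta> Upper \<phi> \<tau>' = (\<Sum>\<tau>\<in>F. \<phi> \<tau> * upper_kernel \<tau> \<tau>')"
    by (rule laplacian_Upper_kernel[OF F \<tau>'])
  have L: "m \<tau>' * laplacian S m \<delta> Lower \<phi> \<tau>' = (\<Sum>\<tau>\<in>F. \<phi> \<tau> * lower_kernel \<tau> \<tau>')"
    by (rule laplacian_Lower_kernel[OF F \<tau>'])
  show ?thesis
  proof (cases c)
    case Hodge
    then show ?thesis
      using U L by (simp add: laplacian_Hodge[OF \<phi>] distrib_left sum.distrib del: laplacian.simps)
  qed (use U L in \<open>simp_all del: laplacian.simps\<close>)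
qed

theorem laplacian_essentially_self_adjoint:
  assumes sub: "\<And>\<tau>. \<tau> \<in> S \<Longrightarrow> \<tau> \<subseteq> V" and vert: "\<And>v. v \<in> V \<Longrightarrow> {v} \<in> S"
    and balls: "\<And>v r. v \<in> V \<Longrightarrow> finite (path_ball S m c v r)"
    and fb: "locally_finite S \<or> balanced S m"
  shows "essentially_self_adjoint (l2_space S m) (l2_inner S m) (fin_supp S) (laplacian S m \<delta> c)"
proof (rule matrix_operator_essentially_self_adjoint[OF weight _ laplacian_kernel])
  show "laplacian S m \<delta> c \<in> fin_supp S \<rightarrow> l2_space S m"
  proof
    fix \<phi> assume \<phi>: "\<phi> \<in> fin_supp S"
    note UL = laplacian_Upper_l2[OF fb \<phi>] laplacian_Lower_l2[OF \<phi>]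
    show "laplacian S m \<delta> c \<phi> \<in> l2_space S m"
    proof (cases c)
      case Hodge
      then show ?thesis
        using subspace_add[OF subspace_l2[OF weight] UL] by (simp only: laplacian_Hodge[OF \<phi>])
    qed (use UL in \<open>simp_all only:\<close>)
  qed
  show "laplace_kernel S m \<delta> c \<tau> \<tau>' = laplace_kernel S m \<delta> c \<tau>' \<tau>" for \<tau> \<tau>'
    using upper_kernel_commute[of \<tau> \<tau>'] lower_kernel_commute[of \<tau> \<tau>'] by (cases c) simp_all
  show "0 \<le> (\<Sum>\<tau>\<in>F. \<Sum>\<tau>'\<in>F. laplace_kernel S m \<delta> c \<tau> \<tau>' * \<phi> \<tau> * \<phi> \<tau>')" if "finite F" "F \<subseteq> S" for F \<phi>
    using upper_kernel_psd[OF that, of \<phi>] lower_kernel_psd[OF that, of \<phi>]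
    by (cases c) (simp_all add: distrib_right sum.distrib)
  show "\<exists>\<eta>. \<eta> \<tau>0 = 1 \<and> finite {\<tau>\<in>S. \<eta> \<tau> \<noteq> 0} \<and> (\<forall>F. finite F \<longrightarrow> F \<subseteq> S \<longrightarrow>
    (\<Sum>\<tau>\<in>F. \<Sum>\<tau>'\<in>F. \<bar>laplace_kernel S m \<delta> c \<tau> \<tau>'\<bar> * \<bar>u \<tau>\<bar> * \<bar>u \<tau>'\<bar> * (\<eta> \<tau> - \<eta> \<tau>')\<^sup>2) \<le> e)"
    if "u \<in> l2_space S m" "\<tau>0 \<in> S" "e > 0" for u \<tau>0 e
    by (rule cutoff_exists[OF sub vert balls that])
qed

end

theorem theorem4p11:
  fixes V :: "'v set" and Sh S :: "'v set set" and m :: "'v set \<Rightarrow> real"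
    and \<delta> :: "'v fun_op" and c :: laplace_type
  assumes "abstract_complex V Sh"
    and "weight Sh m"
    and "S = reduced_complex Sh m"
    and "coboundary_operator S \<delta>"
    and "locally_summable S m"
    and "\<forall>v\<in>V. \<forall>r. finite (path_ball S m c v r)"
    and "locally_finite S \<or> balanced S m"
  shows "essentially_self_adjoint (l2_space S m) (l2_inner S m) (fin_supp S) (laplacian S m \<delta> c)"
proof -
  \<comment> \<open>Reduction can remove only the empty simplex, so closure under nonempty faces and
    all vertices are inherited.\<close>
  have S: "S \<subseteq> Sh" "Sh - {{}} \<subseteq> S"
    using assms(3) by (auto simp: reduced_complex_def)
  interpret weighted_complex S m \<delta>
  proof
    show "finite \<tau>" if "\<tau> \<in> S" for \<tau>
      using assms(1) S that by (auto simp: abstract_complex_def)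
    show "\<rho> \<in> S" if "\<tau> \<in> S" "\<rho> \<subseteq> \<tau>" "\<rho> \<noteq> {}" for \<tau> \<rho>
    proof -
      have "\<rho> \<in> Sh" using assms(1) S(1) that unfolding abstract_complex_def by blast
      then show ?thesis using S(2) that by blast
    qed
    show "weight S m" using assms(2) S by (auto simp: weight_def)
  qed (fact assms)+
  show ?thesis
  proof (rule laplacian_essentially_self_adjoint)
    show "\<tau> \<subseteq> V" if "\<tau> \<in> S" for \<tau>
      using assms(1) S(1) that unfolding abstract_complex_def by blast
    show "{v} \<in> S" if "v \<in> V" for v
    proof -
      have "{v} \<in> Sh" using assms(1) that unfolding abstract_complex_def by blast
      then show ?thesis using S(2) by auto
    qed
  qed (use assms(6,7) in auto)
qed

end
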